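(* There is a universal constant $C$ such that the following holds for all positive integers $n,s,d$. Let $Z$ be uniformly distributed on the unit sphere of $\mathbb{C}^n\otimes\mathbb{C}^s$ and let $\rho_{n,s}=\operatorname{tr}_2(ZZ^* )\in M_n(\mathbb{C})$. Let $B_1,\dots,B_d$ be traceless $n\times n$ Hermitian matrices with $\operatorname{tr}(B_jB_k)=\delta_{jk}$ for all $j,k$. For $j=1,\dots,d$ let $X_j:=\operatorname{tr}(\rho_{n,s}B_j)$, let $X=(X_1,\dots,X_d)$, and let $g$ be a standard Gaussian random vector in $\mathbb{R}^d$. Then $$W_1\left(\sqrt{n(ns+1)}\,X,\ g\right)\le\frac{C}{\sqrt s}\sum_{j=1}^d\|B_j\|_4^2.$$
   Context: $\operatorname{tr}_2:M_n(\mathbb{C})\otimes M_s(\mathbb{C})\to M_n(\mathbb{C})$ is the partial trace, the linear map defined by $\operatorname{tr}_2(A\otimes B)=(\operatorname{tr}B)A$; here $ZZ^*$ is regarded as an element of $M_{ns}(\mathbb{C})\cong M_n(\mathbb{C})\otimes M_s(\mathbb{C})$. $\|A\|_4$ denotes the Schatten $4$-norm (the $\ell_4$ norm of the sequence of singular values of $A$). For random vectors $X,Y$ in $\mathbb{R}^d$, the $L_1$-Wasserstein distance is $W_1(X,Y)=\inf \mathbb{E}\|Z_1-Z_2\|$, the infimum over couplings $(Z_1,Z_2)$ with $Z_1\overset{d}{=}X$, $Z_2\overset{d}{=}Y$; equivalently $W_1(X,Y)=\sup_{|f|_L\le1}|\mathbb{E}f(X)-\mathbb{E}f(Y)|$,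 where $|f|_L$ is the Lipschitz constant of $f:\mathbb{R}^d\to\mathbb{R}$ (Euclidean norm). A standard Gaussian random vector has mean $0$ and covariance $I_d$. *)

theory Defs
  imports
    "HOL-Probability.Probability"
    "Jordan_Normal_Form.Char_Poly"
    "Jordan_Normal_Form.Schur_Decomposition"
begin

definition mtrace :: "'a::comm_monoid_add mat \<Rightarrow> 'a" where
  "mtrace A = (\<Sum>i<dim_row A. A $$ (i, i))"

definition hermitian_mat :: "complex mat \<Rightarrow> bool" where
  "hermitian_mat A \<longleftrightarrow> mat_adjoint A = A"

(* Square roots of the eigenvalues of A* A, with algebraic multiplicity. These eigenvalues are
   nonnegative reals, so Re only changes the type. *)
definition singular_values :: "complex mat \<Rightarrow> real multiset" where
  "singular_values A = image_mset (\<lambda>l. sqrt (Re l)) (proots (char_poly (mat_adjoint A * A)))"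

definition schatten_norm :: "real \<Rightarrow> complex mat \<Rightarrow> real" where
  "schatten_norm p A = (\<Sum>\<sigma>\<in>#singular_values A. \<sigma> powr p) powr (1 / p)"

(* The identification of M_n \<otimes> M_s with M_{ns}: the basis vector e_i \<otimes> e_k of C^n \<otimes> C^s is the
   basis vector of C^{ns} with (zero-based) index i * s + k. *)
definition kronecker :: "complex mat \<Rightarrow> complex mat \<Rightarrow> complex mat" where
  "kronecker A B = Matrix.mat (dim_row A * dim_row B) (dim_col A * dim_col B)
     (\<lambda>(a, b). A $$ (a div dim_row B, b div dim_col B) * B $$ (a mod dim_row B, b mod dim_col B))"

(* Since the matrices kronecker A B span M_{ns}, the partial trace is determined by the
   lemmas below: it is linear and maps kronecker A B to tr B times A. *)
definition partial_trace2 :: "nat \<Rightarrow> nat \<Rightarrow> complex mat \<Rightarrow> complex mat" where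
  "partial_trace2 n s W = Matrix.mat n n (\<lambda>(i, j). \<Sum>k<s. W $$ (i * s + k, j * s + k))"

lemma mult_add_less:
  fixes i k n s :: nat
  assumes "i < n" "k < s"
  shows "i * s + k < n * s"
proof -
  have "i * s + k < Suc i * s" using assms(2) by simp
  also have "\<dots> \<le> n * s" using assms(1) by (intro mult_le_mono1) simp
  finally show ?thesis .
qed

lemma partial_trace2_kronecker:
  assumes "A \<in> carrier_mat n n" "B \<in> carrier_mat s s"
  shows "partial_trace2 n s (kronecker A B) = mtrace B \<cdot>\<^sub>m A"
  using assms
  by (intro eq_matI)
     (auto simp: partial_trace2_def kronecker_def mtrace_def mult_add_less sum_distrib_left
           mult.commute intro!: sum.cong)

lemma partial_trace2_add:
  assumes "V \<in> carrier_mat (n * s) (n * s)" "W \<in> carrier_mat (n * s) (n * s)"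
  shows "partial_trace2 n s (V + W) = partial_trace2 n s V + partial_trace2 n s W"
  using assms by (intro eq_matI) (auto simp: partial_trace2_def mult_add_less sum.distrib)

lemma partial_trace2_smult:
  assumes "W \<in> carrier_mat (n * s) (n * s)"
  shows "partial_trace2 n s (c \<cdot>\<^sub>m W) = c \<cdot>\<^sub>m partial_trace2 n s W"
  using assms by (intro eq_matI) (auto simp: partial_trace2_def mult_add_less sum_distrib_left)

(* The matrix z z* of z in C^N, where z is given by its coordinates z 0, ..., z (N - 1). *)
definition rank_one :: "nat \<Rightarrow> (nat \<Rightarrow> complex) \<Rightarrow> complex mat" where
  "rank_one N z = Matrix.mat N N (\<lambda>(a, b). z a * cnj (z b))"

definition reduced_density :: "nat \<Rightarrow> nat \<Rightarrow> (nat \<Rightarrow> complex) \<Rightarrow> complex mat" where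
  "reduced_density n s z = partial_trace2 n s (rank_one (n * s) z)"

(* Normalized surface measure on the unit sphere of C^N: the measure of A is the proportion of
   the volume of the unit ball taken up by the cone {t z | 0 < t \<le> 1, z in A}, that is, it is the
   image of the uniform distribution on the ball under z / |z|. The origin is a null set. *)
definition sphere_measure :: "nat \<Rightarrow> (nat \<Rightarrow> complex) measure" where
  "sphere_measure N =
     (let L = Pi\<^sub>M {..<N} (\<lambda>_. lborel);
          nrm = (\<lambda>z. L2_set (\<lambda>a. cmod (z a)) {..<N})
      in distr (uniform_measure L {z \<in> space L. nrm z \<le> 1}) (Pi\<^sub>M {..<N} (\<lambda>_. borel))
           (\<lambda>z. \<lambda>a\<in>{..<N}. z a / complex_of_real (nrm z)))"

(* R^d with its Borel sets, as functions on {0, ..., d - 1}. *)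
abbreviation borel_vec :: "nat \<Rightarrow> (nat \<Rightarrow> real) measure" where
  "borel_vec d \<equiv> Pi\<^sub>M {..<d} (\<lambda>_. borel)"

definition std_gaussian :: "nat \<Rightarrow> (nat \<Rightarrow> real) measure" where
  "std_gaussian d = Pi\<^sub>M {..<d} (\<lambda>_. density lborel std_normal_density)"

definition couplings :: "'a measure \<Rightarrow> 'a measure \<Rightarrow> ('a \<times> 'a) measure set" where
  "couplings \<mu> \<nu> = {\<gamma>. sets \<gamma> = sets (\<mu> \<Otimes>\<^sub>M \<nu>) \<and> distr \<gamma> \<mu> fst = \<mu> \<and> distr \<gamma> \<nu> snd = \<nu>}"

(* The distance of two random vectors in R^d, as a function of their laws. *)
definition wasserstein1 :: "nat \<Rightarrow> (nat \<Rightarrow> real) measure \<Rightarrow> (nat \<Rightarrow> real) measure \<Rightarrow> ennreal" where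
  "wasserstein1 d \<mu> \<nu> =
     (INF \<gamma>\<in>couplings \<mu> \<nu>. \<integral>\<^sup>+ p. ennreal (L2_set (\<lambda>i. fst p i - snd p i) {..<d}) \<partial>\<gamma>)"

(* The traces below are real, because the reduced density matrix and every B j are Hermitian. *)
definition density_coords ::
  "nat \<Rightarrow> nat \<Rightarrow> nat \<Rightarrow> (nat \<Rightarrow> complex mat) \<Rightarrow> (nat \<Rightarrow> complex) \<Rightarrow> (nat \<Rightarrow> real)" where
  "density_coords n s d B z = (\<lambda>j\<in>{..<d}. Re (mtrace (reduced_density n s z * B j)))"

end

theory Submission
  imports Defs
begin

text \<open>
  Let x be a standard Gaussian vector in C^n \<otimes> C^s, normalised so that every real coordinate has
  variance 1. Its direction x / |x| is uniformly distributed on the sphere and independent of |x|,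
  so Z may be taken to be x / |x|. Then Q_j(x) = <x, (B_j \<otimes> I) x> / (2 sqrt s) equals the j-th
  coordinate of sqrt (n (n s + 1)) X times |x|^2 / (2 sqrt (n s (n s + 1))). The root
  mean square distance of the latter factor from 1 is at most sqrt (2 / (n s)), so replacing the
  normalised X by Q costs at most sqrt (2 d / (n s)). Since |B_j|_4^2 is at least 1 / sqrt n, this is
  of the required order.

  It remains to couple Q(x) with a standard Gaussian vector y of R^d. The argument is Stein's method
  carried out on the couplings themselves. Let w be the infimum of E |Q(x) - y|^2 over all joint laws
  with standard Gaussian marginals. From one such law build another one by a small rotation: with
  c^2 + s^2 = 1 and an independent Gaussian \<xi>, put x' = c x + s \<xi> and
  y' = c^2 y + sqrt (1 - c^4) \<psi>. Here Q(x') = c^2 Q(x) + (linear in \<xi>) + s^2 Q(\<xi>), and \<psi> is chosen,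
  given x, as a standard Gaussian vector close to the normalised linear term. The marginals are
  preserved, and orthogonality of the three contributions gives

    w \<le> c^4 w + (1 - c^4) V + O(s^4),

  where V is the mean squared Hilbert-Schmidt distance between the identity and one half of the Gram
  matrix of the gradients of the Q_j. As 1 - c^4 is of order s^2, letting s tend to 0 yields w \<le> V
  (near_optimal_coupling). So any coupling can be improved until its cost is about V.

  The vector \<psi> comes from the following fact (nn_integral_cayley_coupling and cayley_cost). If A is a
  matrix with d rows, S = A A^T and \<eta> is an independent standard Gaussian vector, then
  2 (I + S)^{-1} (A \<xi> + \<eta>) - \<eta> is standard Gaussian and its root mean square distance
  from A \<xi> is at most |I - S|_HS. It is one component of an orthogonal map which is a product of
  three block shears, and shears preserve Lebesgue measure by translation invariance and Fubini's
  theorem.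

  Finally the variance of a Gaussian Hermitian form is four times the squared Hilbert-Schmidt norm of
  its matrix (variance_kernel_form). Therefore V is a sum over j and k of
  |(B_j B_k + B_k B_j) / 2|_HS^2 / s, and Cauchy-Schwarz bounds these terms by
  |B_j|_4^2 |B_k|_4^2 / s. Taking square roots gives the claim with C = 3.
\<close>

section \<open>Standard Gaussian vectors\<close>

definition gauss_density :: "'a::euclidean_space \<Rightarrow> real" where
  "gauss_density x = exp (- (norm x)\<^sup>2 / 2) / sqrt (2 * pi) ^ DIM('a)"

definition gauss :: "'a::euclidean_space measure" where
  "gauss = density lborel (\<lambda>x. ennreal (gauss_density x))"

lemma sets_gauss [simp, measurable_cong]: "sets gauss = sets borel"
  and space_gauss [simp]: "space gauss = UNIV"
  by (simp_all add: gauss_def)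

lemma gauss_density_pos: "0 < gauss_density x"
  by (simp add: gauss_density_def)

lemma gauss_density_measurable [measurable]: "gauss_density \<in> borel_measurable borel"
  unfolding gauss_density_def[abs_def] by measurable

lemma gauss_density_real: "gauss_density x = std_normal_density x"
  by (simp add: gauss_density_def std_normal_density_def)

lemma gauss_real: "(gauss :: real measure) = density lborel std_normal_density"
  by (simp add: gauss_def gauss_density_real)

lemma prod_gauss_density:
  fixes x :: "'i \<Rightarrow> 'a::euclidean_space"
  shows "(\<Prod>i\<in>I. gauss_density (x i))
    = exp (- (\<Sum>i\<in>I. (norm (x i))\<^sup>2) / 2) / sqrt (2 * pi) ^ (DIM('a) * card I)"
  by (cases "finite I")
     (simp_all add: gauss_density_def prod_dividef exp_sum power_mult sum_divide_distrib flip: sum_negf)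

text \<open>
  The density depends on the norm only, and the square of the norm is the sum of the squared
  coordinates; hence the coordinates are independent standard normal variables.
\<close>

lemma gauss_density_Basis:
  "gauss_density (x::'a::euclidean_space) = (\<Prod>b\<in>Basis. gauss_density (inner x b))"
proof -
  have "(norm x)\<^sup>2 = (\<Sum>b\<in>Basis. (norm (inner x b))\<^sup>2)"
    by (subst power2_norm_eq_inner, subst euclidean_inner) (simp add: power2_eq_square)
  then show ?thesis
    unfolding prod_gauss_density by (simp add: gauss_density_def)
qed

lemma prob_space_gauss_real: "prob_space (gauss :: real measure)"
  unfolding gauss_real by (rule prob_space_normal_density) simp

lemma product_prob_gauss_real: "product_prob_space (\<lambda>_. gauss :: real measure)"
  by (intro product_prob_spaceI prob_space_gauss_real)

lemma PiM_density:
  assumes I: "finite I" and f [measurable]: "f \<in> borel_measurable M"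
    and D: "sigma_finite_measure (density M f)" and M': "sigma_finite_measure M"
  shows "PiM I (\<lambda>_. density M f) = density (PiM I (\<lambda>_. M)) (\<lambda>x. \<Prod>i\<in>I. f (x i))"
proof -
  interpret D: product_sigma_finite "\<lambda>_. density M f"
    using D by (simp add: product_sigma_finite_def)
  interpret M: product_sigma_finite "\<lambda>_. M"
    using M' by (simp add: product_sigma_finite_def)
  show ?thesis
  proof (rule D.PiM_eqI[symmetric, OF I])
    show "sets (density (PiM I (\<lambda>_. M)) (\<lambda>x. \<Prod>i\<in>I. f (x i))) = sets (PiM I (\<lambda>_. density M f))"
      by (simp cong: sets_PiM_cong)
    fix A assume A: "\<And>i. i \<in> I \<Longrightarrow> A i \<in> sets (density M f)"
    then have A' [measurable]: "\<And>i. i \<in> I \<Longrightarrow> A i \<in> sets M" by simp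
    have [measurable]: "Pi\<^sub>E I A \<in> sets (PiM I (\<lambda>_. M))"
      using I A' by (intro sets_PiM_I_finite) auto
    have "emeasure (density (PiM I (\<lambda>_. M)) (\<lambda>x. \<Prod>i\<in>I. f (x i))) (Pi\<^sub>E I A)
        = (\<integral>\<^sup>+x. (\<Prod>i\<in>I. f (x i)) * indicator (Pi\<^sub>E I A) x \<partial>PiM I (\<lambda>_. M))"
      by (subst emeasure_density) (use I in auto)
    also have "\<dots> = (\<integral>\<^sup>+x. (\<Prod>i\<in>I. f (x i) * indicator (A i) (x i)) \<partial>PiM I (\<lambda>_. M))"
    proof (rule nn_integral_cong)
      fix x assume x: "x \<in> space (PiM I (\<lambda>_. M))"
      have "indicator (Pi\<^sub>E I A) x = (\<Prod>i\<in>I. indicator (A i) (x i) :: ennreal)"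
      proof (cases "\<forall>i\<in>I. x i \<in> A i")
        case True then show ?thesis using x by (auto simp: space_PiM PiE_iff indicator_def)
      next
        case False then show ?thesis using x I by (auto simp: PiE_iff indicator_def)
      qed
      then show "(\<Prod>i\<in>I. f (x i)) * indicator (Pi\<^sub>E I A) x = (\<Prod>i\<in>I. f (x i) * indicator (A i) (x i))"
        by (simp add: prod.distrib)
    qed
    also have "\<dots> = (\<Prod>i\<in>I. \<integral>\<^sup>+x. f x * indicator (A i) x \<partial>M)"
      using I by (intro M.product_nn_integral_prod) auto
    also have "\<dots> = (\<Prod>i\<in>I. emeasure (density M f) (A i))"
      by (intro prod.cong refl) (simp add: emeasure_density)
    finally show "emeasure (density (PiM I (\<lambda>_. M)) (\<lambda>x. \<Prod>i\<in>I. f (x i))) (Pi\<^sub>E I A) = \<dots>" .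
  qed
qed

lemma gauss_eq_distr:
  "(gauss :: 'a::euclidean_space measure)
    = distr (PiM Basis (\<lambda>_. gauss :: real measure)) borel (\<lambda>f. \<Sum>b\<in>Basis. f b *\<^sub>R b)"
proof -
  have [measurable]: "(\<lambda>f. \<Sum>b\<in>Basis. f b *\<^sub>R b) \<in> (PiM Basis (\<lambda>_. lborel :: real measure)) \<rightarrow>\<^sub>M (borel :: 'a measure)"
    by measurable
  have "(gauss :: 'a measure) = density (distr (PiM Basis (\<lambda>_. lborel)) borel (\<lambda>f. \<Sum>b\<in>Basis. f b *\<^sub>R b))
      (\<lambda>x. ennreal (gauss_density x))"
    unfolding gauss_def by (subst lborel_eq) simp
  also have "\<dots> = distr (density (PiM Basis (\<lambda>_. lborel)) (\<lambda>f. ennreal (gauss_density (\<Sum>b\<in>Basis. f b *\<^sub>R b :: 'a))))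
      borel (\<lambda>f. \<Sum>b\<in>Basis. f b *\<^sub>R b)"
    by (rule density_distr) auto
  also have "(\<lambda>f. ennreal (gauss_density (\<Sum>b\<in>Basis. f b *\<^sub>R b :: 'a))) = (\<lambda>f. \<Prod>b\<in>Basis. ennreal (gauss_density (f b)))"
    by (rule ext, subst gauss_density_Basis)
       (simp add: inner_sum_left inner_Basis prod_ennreal less_imp_le gauss_density_pos if_distrib cong: if_cong prod.cong)
  also have "density (PiM Basis (\<lambda>_. lborel)) \<dots> = PiM Basis (\<lambda>_. gauss :: real measure)"
    unfolding gauss_def
    by (rule PiM_density[symmetric])
       (auto intro: lborel.sigma_finite_measure_axioms prob_space_imp_sigma_finite prob_space_gauss_real simp flip: gauss_def)
  finally show ?thesis .
qed

lemma prob_space_gauss: "prob_space (gauss :: 'a::euclidean_space measure)"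
proof -
  interpret product_prob_space "\<lambda>_. gauss :: real measure" "Basis :: 'a set" by (rule product_prob_gauss_real)
  show ?thesis by (subst gauss_eq_distr) (intro prob_space_distr, auto)
qed

lemma product_prob_gauss: "product_prob_space (\<lambda>_. gauss :: 'a::euclidean_space measure)"
  by (intro product_prob_spaceI prob_space_gauss)

definition gauss_vec :: "'i set \<Rightarrow> ('i \<Rightarrow> 'a::euclidean_space) measure" where
  "gauss_vec I = PiM I (\<lambda>_. gauss)"

lemma sets_gauss_vec [simp, measurable_cong]: "sets (gauss_vec I) = sets (PiM I (\<lambda>_. borel))"
  unfolding gauss_vec_def by (rule sets_PiM_cong) auto

lemma space_gauss_vec [simp]: "space (gauss_vec I) = space (PiM I (\<lambda>_. borel))"
  by (rule sets_eq_imp_space_eq) simp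

lemma prob_space_gauss_vec: "prob_space (gauss_vec I :: ('i \<Rightarrow> 'a::euclidean_space) measure)"
proof -
  interpret product_prob_space "\<lambda>_. gauss :: 'a measure" I by (rule product_prob_gauss)
  show ?thesis unfolding gauss_vec_def by unfold_locales
qed

definition inner_on :: "'i set \<Rightarrow> ('i \<Rightarrow> 'a::euclidean_space) \<Rightarrow> ('i \<Rightarrow> 'a) \<Rightarrow> real" where
  "inner_on I x y = (\<Sum>i\<in>I. inner (x i) (y i))"

definition gauss_vec_density :: "'i set \<Rightarrow> ('i \<Rightarrow> 'a::euclidean_space) \<Rightarrow> real" where
  "gauss_vec_density I x = exp (- inner_on I x x / 2) / sqrt (2 * pi) ^ (DIM('a) * card I)"

abbreviation lborel_vec :: "'i set \<Rightarrow> ('i \<Rightarrow> 'a::euclidean_space) measure" where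
  "lborel_vec I \<equiv> PiM I (\<lambda>_. lborel)"

lemma sets_lborel_vec [measurable_cong]: "sets (lborel_vec I) = sets (PiM I (\<lambda>_. borel))"
  by (rule sets_PiM_cong) auto

lemma sigma_finite_lborel_vec:
  "finite I \<Longrightarrow> sigma_finite_measure (lborel_vec I :: ('i \<Rightarrow> 'a::euclidean_space) measure)"
proof -
  assume "finite I"
  interpret finite_product_sigma_finite "\<lambda>_. lborel :: 'a measure" I by standard fact
  show ?thesis by unfold_locales
qed

lemma inner_on_measurable [measurable (raw)]:
  assumes [measurable]: "\<And>i. i \<in> I \<Longrightarrow> (\<lambda>w. f w i) \<in> borel_measurable M" "\<And>i. i \<in> I \<Longrightarrow> (\<lambda>w. g w i) \<in> borel_measurable M"
  shows "(\<lambda>w. inner_on I (f w) (g w)) \<in> borel_measurable M"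
  unfolding inner_on_def by measurable

lemma gauss_vec_eq_density:
  fixes I :: "'i set"
  assumes I: "finite I"
  shows "(gauss_vec I :: ('i \<Rightarrow> 'a::euclidean_space) measure)
    = density (lborel_vec I) (\<lambda>x. ennreal (gauss_vec_density I x))"
proof -
  have "(gauss_vec I :: ('i \<Rightarrow> 'a) measure)
      = density (lborel_vec I) (\<lambda>x. \<Prod>i\<in>I. ennreal (gauss_density (x i)))"
    unfolding gauss_vec_def gauss_def
    by (rule PiM_density[OF I])
       (auto intro: lborel.sigma_finite_measure_axioms prob_space_imp_sigma_finite prob_space_gauss simp flip: gauss_def)
  also have "(\<lambda>x::'i \<Rightarrow> 'a. \<Prod>i\<in>I. ennreal (gauss_density (x i))) = (\<lambda>x. ennreal (gauss_vec_density I x))"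
    by (rule ext, subst prod_ennreal)
       (auto simp: less_imp_le gauss_density_pos prod_gauss_density gauss_vec_density_def inner_on_def power2_norm_eq_inner)
  finally show ?thesis .
qed

lemma distr_PiM_componentwise:
  fixes h :: "'i \<Rightarrow> 'a \<Rightarrow> 'a"
  assumes I: "finite I" and M: "sigma_finite_measure M"
    and h: "\<And>i. i \<in> I \<Longrightarrow> h i \<in> M \<rightarrow>\<^sub>M M" and D: "\<And>i. i \<in> I \<Longrightarrow> distr M M (h i) = M"
  shows "distr (PiM I (\<lambda>_. M)) (PiM I (\<lambda>_. M)) (\<lambda>x. \<lambda>i\<in>I. h i (x i)) = PiM I (\<lambda>_. M)"
proof -
  interpret product_sigma_finite "\<lambda>_. M" using M by (simp add: product_sigma_finite_def)
  show ?thesis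
  proof (rule PiM_eqI[OF I])
    fix A assume A: "\<And>i. i \<in> I \<Longrightarrow> A i \<in> sets M"
    have "emeasure (distr (PiM I (\<lambda>_. M)) (PiM I (\<lambda>_. M)) (\<lambda>x. \<lambda>i\<in>I. h i (x i))) (Pi\<^sub>E I A)
      = emeasure (PiM I (\<lambda>_. M)) (Pi\<^sub>E I (\<lambda>i. h i -` A i \<inter> space M))"
      using A I h
      by (subst emeasure_distr)
         (auto simp: space_PiM PiE_iff extensional_def intro!: arg_cong[where f="emeasure _"] sets_PiM_I_finite
           measurable_restrict measurable_compose[OF measurable_component_singleton])
    also have "\<dots> = (\<Prod>i\<in>I. emeasure M (h i -` A i \<inter> space M))"
      using I measurable_sets[OF h A] by (subst emeasure_PiM) auto
    also have "\<dots> = (\<Prod>i\<in>I. emeasure M (A i))"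
      by (intro prod.cong refl) (metis A D emeasure_distr h)
    finally show "emeasure (distr (PiM I (\<lambda>_. M)) (PiM I (\<lambda>_. M)) (\<lambda>x. \<lambda>i\<in>I. h i (x i))) (Pi\<^sub>E I A)
      = (\<Prod>i\<in>I. emeasure M (A i))" .
  qed simp
qed

lemma lborel_vec_translate:
  fixes v :: "'i \<Rightarrow> 'a::euclidean_space"
  assumes "finite I"
  shows "distr (lborel_vec I) (lborel_vec I) (\<lambda>x. \<lambda>i\<in>I. x i + v i) = lborel_vec I"
proof (rule distr_PiM_componentwise[OF assms lborel.sigma_finite_measure_axioms])
  fix i
  have "distr lborel lborel (\<lambda>x. x + v i) = distr lborel borel ((+) (v i))"
    by (rule distr_cong) (auto simp: add.commute)
  then show "distr lborel lborel (\<lambda>x. x + v i) = lborel" by (simp add: lborel_distr_plus)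
qed simp

lemma nn_integral_lborel_vec_translate:
  fixes v :: "'i \<Rightarrow> 'a::euclidean_space"
  assumes I: "finite I" and f [measurable]: "f \<in> borel_measurable (PiM I (\<lambda>_. borel))"
  shows "(\<integral>\<^sup>+x. f (\<lambda>i\<in>I. x i + v i) \<partial>lborel_vec I) = (\<integral>\<^sup>+x. f x \<partial>lborel_vec I)"
  by (subst (2) lborel_vec_translate[OF I, of v, symmetric]) (subst nn_integral_distr, auto)

section \<open>Gaussian measure under shears and rotations\<close>

lemma nn_integral_gauss_vec:
  assumes "finite I" and [measurable]: "f \<in> borel_measurable (PiM I (\<lambda>_. borel))"
  shows "(\<integral>\<^sup>+x. f x \<partial>gauss_vec I)
    = (\<integral>\<^sup>+x. ennreal (gauss_vec_density I x) * f x \<partial>lborel_vec I)"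
  unfolding gauss_vec_eq_density[OF assms(1)]
  by (subst nn_integral_density) (auto simp: gauss_vec_density_def[abs_def])

lemma gauss_vec_density_measurable [measurable]:
  "gauss_vec_density I \<in> borel_measurable (PiM I (\<lambda>_. borel))"
  unfolding gauss_vec_density_def[abs_def] by measurable

lemma gauss_vec_density_nonneg: "0 \<le> gauss_vec_density I x"
  by (simp add: gauss_vec_density_def)

lemma inner_on_cong:
  "(\<And>i. i \<in> I \<Longrightarrow> x i = x' i) \<Longrightarrow> (\<And>i. i \<in> I \<Longrightarrow> y i = y' i) \<Longrightarrow> inner_on I x y = inner_on I x' y'"
  by (auto simp: inner_on_def intro!: sum.cong)

lemma inner_on_restrict [simp]:
  "inner_on I (restrict x I) y = inner_on I x y" "inner_on I x (restrict y I) = inner_on I x y"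
  by (auto simp: inner_on_def intro!: sum.cong)

text \<open>
  Consider the three shears that subtract \<tau> \<eta> from \<xi>, then add \<delta> \<xi> to \<eta>, and then subtract \<tau> \<psi>
  from \<xi>. Each of them translates one component by an amount depending on the other one, so it
  preserves Lebesgue measure. The hypothesis says that their product preserves the total norm, hence
  it preserves the Gaussian measure as well, and so its second component is again Gaussian. Only
  translation invariance and the order of integration enter; no determinant has to be computed.
\<close>

lemma nn_integral_gauss_vec_double_shear:
  fixes \<tau> :: "('j \<Rightarrow> 'b::euclidean_space) \<Rightarrow> 'i \<Rightarrow> 'a::euclidean_space"
    and \<delta> :: "('i \<Rightarrow> 'a) \<Rightarrow> 'j \<Rightarrow> 'b"
  assumes I: "finite I" and J: "finite J"
    and \<tau>: "\<tau> \<in> PiM J (\<lambda>_. borel) \<rightarrow>\<^sub>M PiM I (\<lambda>_. borel)"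
    and \<delta>: "\<delta> \<in> PiM I (\<lambda>_. borel) \<rightarrow>\<^sub>M PiM J (\<lambda>_. borel)"
    and iso: "\<And>\<xi> \<eta> \<psi>. \<psi> = (\<lambda>j\<in>J. \<eta> j + \<delta> \<xi> j) \<Longrightarrow>
        inner_on I (\<lambda>i. \<xi> i - \<tau> \<psi> i) (\<lambda>i. \<xi> i - \<tau> \<psi> i) + inner_on J \<psi> \<psi>
      = inner_on I (\<lambda>i. \<xi> i + \<tau> \<eta> i) (\<lambda>i. \<xi> i + \<tau> \<eta> i) + inner_on J \<eta> \<eta>"
    and f [measurable]: "f \<in> borel_measurable (PiM J (\<lambda>_. borel))"
  shows "(\<integral>\<^sup>+\<xi>. \<integral>\<^sup>+\<eta>. f (\<lambda>j\<in>J. \<eta> j + \<delta> (\<lambda>i\<in>I. \<xi> i - \<tau> \<eta> i) j) \<partial>gauss_vec J \<partial>gauss_vec I)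
    = (\<integral>\<^sup>+\<eta>. f \<eta> \<partial>gauss_vec J)"
proof -
  interpret PI: sigma_finite_measure "lborel_vec I :: ('i \<Rightarrow> 'a) measure" by (rule sigma_finite_lborel_vec[OF I])
  interpret PJ: sigma_finite_measure "lborel_vec J :: ('j \<Rightarrow> 'b) measure" by (rule sigma_finite_lborel_vec[OF J])
  interpret IJ: pair_sigma_finite "lborel_vec I :: ('i \<Rightarrow> 'a) measure" "lborel_vec J :: ('j \<Rightarrow> 'b) measure" ..
  interpret JI: pair_sigma_finite "lborel_vec J :: ('j \<Rightarrow> 'b) measure" "lborel_vec I :: ('i \<Rightarrow> 'a) measure" ..
  interpret GI: prob_space "gauss_vec I :: ('i \<Rightarrow> 'a) measure" by (rule prob_space_gauss_vec)
  interpret GJ: prob_space "gauss_vec J :: ('j \<Rightarrow> 'b) measure" by (rule prob_space_gauss_vec)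
  have [measurable (raw)]: "(\<lambda>w. \<tau> (g w) i) \<in> borel_measurable M"
    if "i \<in> I" "g \<in> M \<rightarrow>\<^sub>M PiM J (\<lambda>_. borel)" for g i and M :: "'z measure"
    using measurable_compose[OF measurable_compose[OF that(2) \<tau>] measurable_component_singleton[OF that(1)]] .
  have [measurable (raw)]: "(\<lambda>w. \<delta> (g w) i) \<in> borel_measurable M"
    if "i \<in> J" "g \<in> M \<rightarrow>\<^sub>M PiM I (\<lambda>_. borel)" for g i and M :: "'z measure"
    using measurable_compose[OF measurable_compose[OF that(2) \<delta>] measurable_component_singleton[OF that(1)]] .
  note \<tau>[measurable] \<delta>[measurable]
  define D where "D \<xi> \<eta> = gauss_vec_density I \<xi> * gauss_vec_density J \<eta>" for \<xi> :: "'i \<Rightarrow> 'a" and \<eta> :: "'j \<Rightarrow> 'b"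
  have D: "D \<xi> \<eta> = exp (- (inner_on I \<xi> \<xi> + inner_on J \<eta> \<eta>) / 2) /
      (sqrt (2 * pi) ^ (DIM('a) * card I) * sqrt (2 * pi) ^ (DIM('b) * card J))" for \<xi> \<eta>
    unfolding D_def gauss_vec_density_def by (simp add: exp_add[symmetric] add_divide_distrib diff_divide_distrib)
  have [measurable (raw)]: "(\<lambda>w. D (g w) (h w)) \<in> borel_measurable M"
    if [measurable]: "g \<in> M \<rightarrow>\<^sub>M PiM I (\<lambda>_. borel)" "h \<in> M \<rightarrow>\<^sub>M PiM J (\<lambda>_. borel)" for g h and M :: "'z measure"
    unfolding D_def by measurable
  \<comment> \<open>H is the integrand expressed in the variables after the second shear, F after the first\<close>
  define H where "H \<xi> \<psi> = ennreal (D (\<lambda>i\<in>I. \<xi> i - \<tau> \<psi> i) \<psi>) * f \<psi>" for \<xi> \<psi>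
  define F where "F \<xi> \<eta> = ennreal (D (\<lambda>i\<in>I. \<xi> i + \<tau> \<eta> i) \<eta>) * f (\<lambda>j\<in>J. \<eta> j + \<delta> \<xi> j)" for \<xi> \<eta>
  have pair_sets: "borel_measurable (lborel_vec I \<Otimes>\<^sub>M lborel_vec J)
      = (borel_measurable (PiM I (\<lambda>_. borel) \<Otimes>\<^sub>M PiM J (\<lambda>_. borel)) :: (('i \<Rightarrow> 'a) \<times> ('j \<Rightarrow> 'b) \<Rightarrow> ennreal) set)"
     "borel_measurable (lborel_vec J \<Otimes>\<^sub>M lborel_vec I)
      = (borel_measurable (PiM J (\<lambda>_. borel) \<Otimes>\<^sub>M PiM I (\<lambda>_. borel)) :: (('j \<Rightarrow> 'b) \<times> ('i \<Rightarrow> 'a) \<Rightarrow> ennreal) set)"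
    by (intro measurable_cong_sets sets_pair_measure_cong sets_lborel_vec refl)+
  have F_measurable: "(\<lambda>w. F (g w) (h w)) \<in> borel_measurable M"
    if [measurable]: "g \<in> M \<rightarrow>\<^sub>M PiM I (\<lambda>_. borel)" "h \<in> M \<rightarrow>\<^sub>M PiM J (\<lambda>_. borel)" for g h and M :: "'z measure"
    unfolding F_def by measurable
  have H_measurable: "(\<lambda>w. H (g w) (h w)) \<in> borel_measurable M"
    if [measurable]: "g \<in> M \<rightarrow>\<^sub>M PiM I (\<lambda>_. borel)" "h \<in> M \<rightarrow>\<^sub>M PiM J (\<lambda>_. borel)" for g h and M :: "'z measure"
    unfolding H_def by measurable
  have FH: "F \<xi> \<eta> = H \<xi> (\<lambda>j\<in>J. \<eta> j + \<delta> \<xi> j)" for \<xi> \<eta>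
    using iso[OF refl, of \<xi> \<eta>] unfolding F_def H_def D
    by simp
  have "(\<integral>\<^sup>+\<xi>. \<integral>\<^sup>+\<eta>. f (\<lambda>j\<in>J. \<eta> j + \<delta> (\<lambda>i\<in>I. \<xi> i - \<tau> \<eta> i) j) \<partial>gauss_vec J \<partial>gauss_vec I)
     = (\<integral>\<^sup>+\<xi>. \<integral>\<^sup>+\<eta>. ennreal (D \<xi> \<eta>) * f (\<lambda>j\<in>J. \<eta> j + \<delta> (\<lambda>i\<in>I. \<xi> i - \<tau> \<eta> i) j) \<partial>lborel_vec J \<partial>lborel_vec I)"
  proof -
    have "(\<integral>\<^sup>+\<xi>. \<integral>\<^sup>+\<eta>. f (\<lambda>j\<in>J. \<eta> j + \<delta> (\<lambda>i\<in>I. \<xi> i - \<tau> \<eta> i) j) \<partial>gauss_vec J \<partial>gauss_vec I)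
      = (\<integral>\<^sup>+\<xi>. ennreal (gauss_vec_density I \<xi>) *
          (\<integral>\<^sup>+\<eta>. f (\<lambda>j\<in>J. \<eta> j + \<delta> (\<lambda>i\<in>I. \<xi> i - \<tau> \<eta> i) j) \<partial>gauss_vec J) \<partial>lborel_vec I)"
      by (rule nn_integral_gauss_vec[OF I]) measurable
    also have "\<dots> = (\<integral>\<^sup>+\<xi>. ennreal (gauss_vec_density I \<xi>) *
          (\<integral>\<^sup>+\<eta>. ennreal (gauss_vec_density J \<eta>) * f (\<lambda>j\<in>J. \<eta> j + \<delta> (\<lambda>i\<in>I. \<xi> i - \<tau> \<eta> i) j)
             \<partial>lborel_vec J) \<partial>lborel_vec I)"
      by (intro nn_integral_cong arg_cong2[where f="(*)"] refl nn_integral_gauss_vec[OF J]) measurable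
    also have "\<dots> = (\<integral>\<^sup>+\<xi>. \<integral>\<^sup>+\<eta>. ennreal (gauss_vec_density I \<xi>) *
          (ennreal (gauss_vec_density J \<eta>) * f (\<lambda>j\<in>J. \<eta> j + \<delta> (\<lambda>i\<in>I. \<xi> i - \<tau> \<eta> i) j))
             \<partial>lborel_vec J \<partial>lborel_vec I)"
      by (intro nn_integral_cong nn_integral_cmult[symmetric]) measurable
    finally show ?thesis
      by (simp add: D_def ennreal_mult gauss_vec_density_nonneg mult.assoc)
  qed
  also have "\<dots> = (\<integral>\<^sup>+\<xi>. \<integral>\<^sup>+\<eta>. F (\<lambda>i\<in>I. \<xi> i + (- \<tau> \<eta> i)) \<eta> \<partial>lborel_vec J \<partial>lborel_vec I)"
  proof (intro nn_integral_cong)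
    fix \<xi> :: "'i \<Rightarrow> 'a" and \<eta> :: "'j \<Rightarrow> 'b"
    assume "\<xi> \<in> space (lborel_vec I)"
    then have "(\<lambda>i\<in>I. (\<lambda>i\<in>I. \<xi> i + (- \<tau> \<eta> i)) i + \<tau> \<eta> i) = \<xi>"
      by (auto simp: space_PiM PiE_iff extensional_def restrict_def)
    then show "ennreal (D \<xi> \<eta>) * f (\<lambda>j\<in>J. \<eta> j + \<delta> (\<lambda>i\<in>I. \<xi> i - \<tau> \<eta> i) j) = F (\<lambda>i\<in>I. \<xi> i + (- \<tau> \<eta> i)) \<eta>"
      by (simp add: F_def)
  qed
  also have "\<dots> = (\<integral>\<^sup>+\<eta>. \<integral>\<^sup>+\<xi>. F (\<lambda>i\<in>I. \<xi> i + (- \<tau> \<eta> i)) \<eta> \<partial>lborel_vec I \<partial>lborel_vec J)"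
    by (rule JI.Fubini') (unfold case_prod_beta' pair_sets, rule F_measurable, measurable)
  also have "\<dots> = (\<integral>\<^sup>+\<eta>. \<integral>\<^sup>+\<xi>. F \<xi> \<eta> \<partial>lborel_vec I \<partial>lborel_vec J)"
    by (intro nn_integral_cong nn_integral_lborel_vec_translate[OF I] F_measurable) (auto simp: space_PiM)
  also have "\<dots> = (\<integral>\<^sup>+\<xi>. \<integral>\<^sup>+\<eta>. F \<xi> \<eta> \<partial>lborel_vec J \<partial>lborel_vec I)"
    by (rule IJ.Fubini') (unfold case_prod_beta' pair_sets, rule F_measurable, measurable)
  also have "\<dots> = (\<integral>\<^sup>+\<xi>. \<integral>\<^sup>+\<psi>. H \<xi> \<psi> \<partial>lborel_vec J \<partial>lborel_vec I)"
    unfolding FH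
    by (intro nn_integral_cong nn_integral_lborel_vec_translate[OF J] H_measurable) (auto simp: space_PiM)
  also have "\<dots> = (\<integral>\<^sup>+\<psi>. \<integral>\<^sup>+\<xi>. H \<xi> \<psi> \<partial>lborel_vec I \<partial>lborel_vec J)"
    by (rule JI.Fubini') (unfold case_prod_beta' pair_sets, rule H_measurable, measurable)
  also have "\<dots> = (\<integral>\<^sup>+\<psi>. \<integral>\<^sup>+\<xi>. ennreal (D \<xi> \<psi>) * f \<psi> \<partial>lborel_vec I \<partial>lborel_vec J)"
  proof (rule nn_integral_cong)
    fix \<psi> :: "'j \<Rightarrow> 'b" assume [measurable]: "\<psi> \<in> space (lborel_vec J)"
    have "(\<integral>\<^sup>+\<xi>. ennreal (D (\<lambda>i\<in>I. \<xi> i + - \<tau> \<psi> i) \<psi>) * f \<psi> \<partial>lborel_vec I)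
      = (\<integral>\<^sup>+\<xi>. ennreal (D \<xi> \<psi>) * f \<psi> \<partial>lborel_vec I)"
      by (rule nn_integral_lborel_vec_translate[OF I]) (simp add: D_def)
    then show "(\<integral>\<^sup>+\<xi>. H \<xi> \<psi> \<partial>lborel_vec I) = (\<integral>\<^sup>+\<xi>. ennreal (D \<xi> \<psi>) * f \<psi> \<partial>lborel_vec I)"
      by (simp add: H_def)
  qed
  also have "\<dots> = (\<integral>\<^sup>+\<psi>. \<integral>\<^sup>+(\<xi>::'i \<Rightarrow> 'a). f \<psi> \<partial>gauss_vec I \<partial>gauss_vec J)"
  proof -
    have "(\<integral>\<^sup>+\<psi>. \<integral>\<^sup>+(\<xi>::'i \<Rightarrow> 'a). f \<psi> \<partial>gauss_vec I \<partial>gauss_vec J)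
      = (\<integral>\<^sup>+\<psi>. ennreal (gauss_vec_density J \<psi>) * (\<integral>\<^sup>+(\<xi>::'i \<Rightarrow> 'a). f \<psi> \<partial>gauss_vec I) \<partial>lborel_vec J)"
      by (rule nn_integral_gauss_vec[OF J]) measurable
    also have "\<dots> = (\<integral>\<^sup>+\<psi>. ennreal (gauss_vec_density J \<psi>) *
        (\<integral>\<^sup>+(\<xi>::'i \<Rightarrow> 'a). ennreal (gauss_vec_density I \<xi>) * f \<psi> \<partial>lborel_vec I) \<partial>lborel_vec J)"
      by (intro nn_integral_cong arg_cong2[where f="(*)"] refl nn_integral_gauss_vec[OF I]) measurable
    also have "\<dots> = (\<integral>\<^sup>+\<psi>. (\<integral>\<^sup>+(\<xi>::'i \<Rightarrow> 'a). ennreal (gauss_vec_density J \<psi>) *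
        (ennreal (gauss_vec_density I \<xi>) * f \<psi>) \<partial>lborel_vec I) \<partial>lborel_vec J)"
      by (intro nn_integral_cong nn_integral_cmult[symmetric]) measurable
    finally show ?thesis
      by (simp add: D_def ennreal_mult gauss_vec_density_nonneg mult_ac)
  qed
  also have "\<dots> = (\<integral>\<^sup>+\<eta>. f \<eta> \<partial>gauss_vec J)"
    using GI.emeasure_space_1 by simp
  finally show ?thesis .
qed

text \<open>
  A plane rotation is the product of three shears whose outer coefficient is the tangent of half the
  angle.
\<close>

lemma nn_integral_gauss_vec_rotate:
  fixes f :: "('i \<Rightarrow> 'a::euclidean_space) \<Rightarrow> ennreal"
  assumes I: "finite I" and c: "0 < c" and cs: "c\<^sup>2 + s\<^sup>2 = 1"
    and f [measurable]: "f \<in> borel_measurable (PiM I (\<lambda>_. borel))"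
  shows "(\<integral>\<^sup>+x. \<integral>\<^sup>+y. f (\<lambda>i\<in>I. c *\<^sub>R x i + s *\<^sub>R y i) \<partial>gauss_vec I \<partial>gauss_vec I)
    = (\<integral>\<^sup>+x. f x \<partial>gauss_vec I)"
proof -
  \<comment> \<open>the tangent of half of the angle whose sine is c\<close>
  define a where "a = (1 - s) / c"
  have ab: "1 - c * a = s" using c by (simp add: a_def)
  have "c * (1 + a\<^sup>2) = 2 * a"
  proof -
    have "c * (c * (1 + a\<^sup>2)) = c\<^sup>2 + (c * a)\<^sup>2" by (simp add: algebra_simps power2_eq_square)
    also have "\<dots> = c\<^sup>2 + (1 - s)\<^sup>2" using c by (simp add: a_def)
    also have "\<dots> = 2 * (1 - s)" using cs by (simp add: power2_eq_square algebra_simps)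
    also have "\<dots> = c * (2 * a)" using c by (simp add: a_def)
    finally show ?thesis using c by simp
  qed
  then have c_eq: "c + c * a\<^sup>2 = 2 * a" by (simp add: algebra_simps)
  have key: "inner (u - a *\<^sub>R (v + c *\<^sub>R u)) (u - a *\<^sub>R (v + c *\<^sub>R u)) + inner (v + c *\<^sub>R u) (v + c *\<^sub>R u)
     = inner (u + a *\<^sub>R v) (u + a *\<^sub>R v) + inner v v" for u v :: 'a
  proof -
    have "inner (u - a *\<^sub>R (v + c *\<^sub>R u)) (u - a *\<^sub>R (v + c *\<^sub>R u)) + inner (v + c *\<^sub>R u) (v + c *\<^sub>R u)
      - (inner (u + a *\<^sub>R v) (u + a *\<^sub>R v) + inner v v)
      = (c + c * a\<^sup>2 - 2 * a) * c * inner u u + (c + c * a\<^sup>2 - 2 * a) * 2 * inner u v"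
      by (simp add: inner_add_left inner_add_right inner_diff_left inner_diff_right inner_commute algebra_simps power2_eq_square)
    then show ?thesis using c_eq by simp
  qed
  have "(\<integral>\<^sup>+x. \<integral>\<^sup>+y. f (\<lambda>i\<in>I. y i + (\<lambda>i\<in>I. c *\<^sub>R (\<lambda>i\<in>I. x i - (\<lambda>i\<in>I. a *\<^sub>R y i) i) i) i) \<partial>gauss_vec I \<partial>gauss_vec I)
    = (\<integral>\<^sup>+x. f x \<partial>gauss_vec I)"
  proof (rule nn_integral_gauss_vec_double_shear[OF I I, where \<tau> = "\<lambda>y. \<lambda>i\<in>I. a *\<^sub>R y i" and \<delta> = "\<lambda>x. \<lambda>i\<in>I. c *\<^sub>R x i"])
    fix \<xi> \<eta> \<psi> :: "'i \<Rightarrow> 'a" assume "\<psi> = (\<lambda>j\<in>I. \<eta> j + (\<lambda>i\<in>I. c *\<^sub>R \<xi> i) j)"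
    then show "inner_on I (\<lambda>i. \<xi> i - (\<lambda>i\<in>I. a *\<^sub>R \<psi> i) i) (\<lambda>i. \<xi> i - (\<lambda>i\<in>I. a *\<^sub>R \<psi> i) i) + inner_on I \<psi> \<psi> =
       inner_on I (\<lambda>i. \<xi> i + (\<lambda>i\<in>I. a *\<^sub>R \<eta> i) i) (\<lambda>i. \<xi> i + (\<lambda>i\<in>I. a *\<^sub>R \<eta> i) i) + inner_on I \<eta> \<eta>"
      unfolding inner_on_def sum.distrib[symmetric] by (intro sum.cong) (simp_all add: key)
  qed auto
  moreover have "(\<lambda>i\<in>I. y i + (\<lambda>i\<in>I. c *\<^sub>R (\<lambda>i\<in>I. x i - (\<lambda>i\<in>I. a *\<^sub>R y i) i) i) i)
    = (\<lambda>i\<in>I. c *\<^sub>R x i + s *\<^sub>R y i)" for x y :: "'i \<Rightarrow> 'a"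
    by (rule restrict_ext) (simp add: ab[symmetric] algebra_simps)
  ultimately show ?thesis by simp
qed

section \<open>Moments of Gaussian vectors\<close>

definition square_integrable :: "'a measure \<Rightarrow> ('a \<Rightarrow> real) \<Rightarrow> bool" where
  "square_integrable M f \<longleftrightarrow> f \<in> borel_measurable M \<and> integrable M (\<lambda>x. (f x)\<^sup>2)"

lemma square_integrable_measurable: "square_integrable M f \<Longrightarrow> f \<in> borel_measurable M"
  by (simp add: square_integrable_def)

lemma square_integrable_mult:
  assumes "square_integrable M f" "square_integrable M g"
  shows "integrable M (\<lambda>x. f x * g x)"
proof (rule Bochner_Integration.integrable_bound[of M "\<lambda>x. (f x)\<^sup>2 + (g x)\<^sup>2"])
  have *: "\<bar>u * v\<bar> \<le> u\<^sup>2 + v\<^sup>2" for u v :: real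
  proof -
    have "0 \<le> (\<bar>u\<bar> - \<bar>v\<bar>)\<^sup>2 + u\<^sup>2 + v\<^sup>2" by simp
    then show ?thesis by (simp add: power2_eq_square algebra_simps abs_mult)
  qed
  show "AE x in M. norm (f x * g x) \<le> norm ((f x)\<^sup>2 + (g x)\<^sup>2)"
    using * by auto
qed (use assms in \<open>auto simp: square_integrable_def\<close>)

lemma square_integrable_add:
  assumes f: "square_integrable M f" and g: "square_integrable M g"
  shows "square_integrable M (\<lambda>x. f x + g x)"
  using square_integrable_mult[OF f g] f g
  by (auto simp: square_integrable_def power2_sum mult.assoc)

lemma square_integrable_cmult: "square_integrable M f \<Longrightarrow> square_integrable M (\<lambda>x. c * f x)"
  by (auto simp: square_integrable_def power_mult_distrib)

lemma square_integrable_zero: "square_integrable M (\<lambda>x. 0)"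
  by (simp add: square_integrable_def)

lemma square_integrable_sum:
  assumes "\<And>i. i \<in> I \<Longrightarrow> square_integrable M (f i)"
  shows "square_integrable M (\<lambda>x. \<Sum>i\<in>I. f i x)"
  using assms
  by (induction I rule: infinite_finite_induct) (auto simp: square_integrable_zero square_integrable_add)

lemma square_integrable_diff:
  assumes f: "square_integrable M f" and g: "square_integrable M g"
  shows "square_integrable M (\<lambda>x. f x - g x)"
  using square_integrable_add[OF f square_integrable_cmult[OF g, of "-1"]] by simp

lemma square_integrable_bound:
  assumes g: "square_integrable M g" and [measurable]: "f \<in> borel_measurable M"
    and le: "\<And>x. x \<in> space M \<Longrightarrow> \<bar>f x\<bar> \<le> \<bar>g x\<bar>"
  shows "square_integrable M f"
proof -
  have "integrable M (\<lambda>x. (f x)\<^sup>2)"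
  proof (rule Bochner_Integration.integrable_bound[of M "\<lambda>x. (g x)\<^sup>2"])
    show "AE x in M. norm ((f x)\<^sup>2) \<le> norm ((g x)\<^sup>2)"
      using le by (auto simp: abs_le_square_iff)
  qed (use g in \<open>auto simp: square_integrable_def\<close>)
  then show ?thesis by (simp add: square_integrable_def)
qed

lemma (in finite_measure) square_integrable_const: "square_integrable M (\<lambda>x. c)"
  by (simp add: square_integrable_def)

lemma (in finite_measure) square_integrable_integrable: "square_integrable M f \<Longrightarrow> integrable M f"
  using square_integrable_mult[of M f "\<lambda>_. 1"] square_integrable_const[of 1] by simp

lemma square_integrable_distr:
  assumes [measurable]: "h \<in> M \<rightarrow>\<^sub>M N" and "f \<in> borel_measurable N"
  shows "square_integrable (distr M N h) f \<longleftrightarrow> square_integrable M (\<lambda>x. f (h x))"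
proof -
  note [measurable] = assms(2)
  show ?thesis
    unfolding square_integrable_def by (subst integrable_distr_eq) auto
qed

text \<open>
  Mean zero, covariance the identity, and a finite fourth moment. Linear functionals of a vector with
  independent isotropic entries have the same first and second moments as in the Gaussian case. This
  is applied to the coordinates of a single point, which passes from the real line to any Euclidean
  space, and then to vectors with entries in such a space.
\<close>

definition isotropic :: "'a::euclidean_space measure \<Rightarrow> bool" where
  "isotropic M \<longleftrightarrow> prob_space M \<and> sets M = sets borel \<and> square_integrable M (\<lambda>z. (norm z)\<^sup>2) \<and>
     (\<forall>u. (\<integral>z. inner z u \<partial>M) = 0) \<and> (\<forall>u v. (\<integral>z. inner z u * inner z v \<partial>M) = inner u v)"

lemma isotropic_gauss_real: "isotropic (gauss :: real measure)"
proof -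
  have int: "integrable gauss (\<lambda>x::real. x ^ k)" for k
    unfolding gauss_real using integrable_std_normal_moment[of k] by (subst integrable_density) auto
  have m1: "(\<integral>x. x \<partial>gauss) = (0::real)"
    unfolding gauss_real using integral_std_normal_moment_odd[of 0] by (subst integral_density) auto
  have m2: "(\<integral>x. x\<^sup>2 \<partial>gauss) = (1::real)"
    unfolding gauss_real using integral_std_normal_moment_even[of 1] by (subst integral_density) auto
  have m2': "(\<integral>z. z * u * (z * v) \<partial>gauss) = u * v" for u v :: real
  proof -
    have "(\<integral>z. z * u * (z * v) \<partial>gauss) = (\<integral>z. z\<^sup>2 * (u * v) \<partial>gauss)"
      by (intro Bochner_Integration.integral_cong) (auto simp: power2_eq_square)
    then show ?thesis using m2 by simp
  qed
  have "square_integrable gauss (\<lambda>z::real. (norm z)\<^sup>2)"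
    using int[of 4] by (simp add: square_integrable_def flip: power_mult)
  then show ?thesis
    using prob_space_gauss_real m1 m2' by (simp add: isotropic_def)
qed

locale isotropic_vector =
  fixes M :: "'a::euclidean_space measure" and I :: "'i set"
  assumes isotropic: "isotropic M" and finite_I: "finite I"
begin

abbreviation "P \<equiv> PiM I (\<lambda>_. M)"

lemma prob_M: "prob_space M" and sets_M [measurable_cong]: "sets M = sets borel"
  and square_M: "square_integrable M (\<lambda>z. (norm z)\<^sup>2)" and mean_M: "(\<integral>z. inner z u \<partial>M) = 0"
  and cov_M: "(\<integral>z. inner z u * inner z v \<partial>M) = inner u v"
  using isotropic by (auto simp: isotropic_def)

sublocale M: prob_space M by (rule prob_M)

sublocale product_prob_space "\<lambda>_. M" I by (intro product_prob_spaceI prob_M)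

lemma prob_P: "prob_space P" by unfold_locales

lemma sets_P [measurable_cong]: "sets P = sets (PiM I (\<lambda>_. borel))"
  by (rule sets_PiM_cong) (auto simp: sets_M)

lemma integral_component:
  fixes f :: "'a \<Rightarrow> real"
  assumes "a \<in> I" and [measurable]: "f \<in> borel_measurable borel"
  shows "(\<integral>x. f (x a) \<partial>P) = (\<integral>z. f z \<partial>M)"
  using assms by (subst (2) PiM_component[symmetric, OF assms(1)]) (subst integral_distr, auto)

lemma square_integrable_component:
  fixes f :: "'a \<Rightarrow> real"
  assumes "a \<in> I" and [measurable]: "f \<in> borel_measurable borel"
  shows "square_integrable P (\<lambda>x. f (x a)) \<longleftrightarrow> square_integrable M f"
  using assms by (subst (2) PiM_component[symmetric, OF assms(1)]) (subst square_integrable_distr, auto)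

lemma square_norm: "a \<in> I \<Longrightarrow> square_integrable P (\<lambda>x. (norm (x a))\<^sup>2)"
  by (subst square_integrable_component) (auto intro: square_M)

lemma norm_mult_le: "norm (u::'b::real_normed_vector) * norm (v::'c::real_normed_vector) \<le> (norm u)\<^sup>2 + (norm v)\<^sup>2"
proof -
  have "0 \<le> (norm u - norm v)\<^sup>2 + (norm u)\<^sup>2 + (norm v)\<^sup>2" by simp
  then show ?thesis by (simp add: power2_eq_square algebra_simps)
qed

lemma square_bilinear:
  assumes "a \<in> I" "b \<in> I" and [measurable]: "f \<in> borel_measurable P"
    and le: "\<And>x. \<bar>f x\<bar> \<le> C * (norm (x a) * norm (x b))"
  shows "square_integrable P f"
proof (rule square_integrable_bound)
  show "square_integrable P (\<lambda>x. \<bar>C\<bar> * ((norm (x a))\<^sup>2 + (norm (x b))\<^sup>2))"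
    using assms by (intro square_integrable_cmult square_integrable_add square_norm)
  fix x show "\<bar>f x\<bar> \<le> \<bar>\<bar>C\<bar> * ((norm (x a))\<^sup>2 + (norm (x b))\<^sup>2)\<bar>"
  proof -
    have "\<bar>f x\<bar> \<le> \<bar>C\<bar> * (norm (x a) * norm (x b))"
      using le[of x] by (rule order_trans) (intro mult_right_mono, auto)
    also have "\<dots> \<le> \<bar>C\<bar> * ((norm (x a))\<^sup>2 + (norm (x b))\<^sup>2)"
      by (intro mult_left_mono norm_mult_le) auto
    finally show ?thesis by linarith
  qed
qed fact

lemma square_inner_component:
  assumes a: "a \<in> I" shows "square_integrable P (\<lambda>x. inner (x a) u)"
proof (rule square_integrable_bound)
  interpret P: prob_space P by (rule prob_P)
  show "square_integrable P (\<lambda>x. norm u * (1 + (norm (x a))\<^sup>2))"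
    using a by (intro square_integrable_cmult square_integrable_add square_norm P.square_integrable_const)
  fix x :: "'i \<Rightarrow> 'a"
  have "\<bar>inner (x a) u\<bar> \<le> norm u * norm (x a)" by (metis Cauchy_Schwarz_ineq2 mult.commute)
  also have "\<dots> \<le> norm u * (1 + (norm (x a))\<^sup>2)"
    using norm_mult_le[of "1::real" "x a"] by (intro mult_left_mono) auto
  finally show "\<bar>inner (x a) u\<bar> \<le> \<bar>norm u * (1 + (norm (x a))\<^sup>2)\<bar>" by linarith
qed (use a in measurable)

lemma mean_component: "a \<in> I \<Longrightarrow> (\<integral>x. inner (x a) u \<partial>P) = 0"
  using integral_component[of a "\<lambda>z. inner z u"] mean_M by simp

lemma covariance_components:
  assumes a: "a \<in> I" and b: "b \<in> I"
  shows "(\<integral>x. inner (x a) u * inner (x b) v \<partial>P) = (if a = b then inner u v else 0)"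
proof (cases "a = b")
  case True
  then show ?thesis using integral_component[OF a, of "\<lambda>z. inner z u * inner z v"] cov_M by simp
next
  case False
  \<comment> \<open>trivial factors away from a and b, so that the expectation factorises over all coordinates\<close>
  define f where "f i z = (if i = a then inner z u else if i = b then inner z v else 1)" for i and z :: 'a
  have prod: "(\<Prod>i\<in>I. g i) = g a * g b" if "\<And>i. i \<notin> {a, b} \<Longrightarrow> g i = 1" for g :: "'i \<Rightarrow> real"
  proof -
    have "(\<Prod>i\<in>I. g i) = (\<Prod>i\<in>{a, b}. g i)"
      using finite_I a b that by (intro prod.mono_neutral_right) auto
    then show ?thesis using False by simp
  qed
  have lin: "integrable M (\<lambda>z. inner z w)" for w
    using square_integrable_component[OF a, of "\<lambda>z. inner z w"] square_inner_component[OF a, of w]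
    by (intro M.square_integrable_integrable) simp
  have int: "integrable M (f i)" for i
    unfolding f_def[abs_def] by (cases "i = a"; cases "i = b") (simp_all add: lin)
  have "(\<integral>x. inner (x a) u * inner (x b) v \<partial>P) = (\<integral>x. (\<Prod>i\<in>I. f i (x i)) \<partial>P)"
    using False by (intro Bochner_Integration.integral_cong refl, subst prod) (auto simp: f_def)
  also have "\<dots> = (\<Prod>i\<in>I. integral\<^sup>L M (f i))"
    by (rule product_integral_prod[OF finite_I int])
  also have "\<dots> = integral\<^sup>L M (f a) * integral\<^sup>L M (f b)"
    by (rule prod) (simp add: f_def[abs_def] M.prob_space)
  also have "integral\<^sup>L M (f a) = 0"
    using mean_M by (simp add: f_def[abs_def])
  finally show ?thesis using False by simp
qed

lemma square_inner_on: "square_integrable P (\<lambda>x. inner_on I v x)"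
  unfolding inner_on_def by (subst inner_commute, rule square_integrable_sum, rule square_inner_component)

lemma mean_inner_on: "(\<integral>x. inner_on I v x \<partial>P) = 0"
proof -
  interpret P: prob_space P by (rule prob_P)
  show ?thesis unfolding inner_on_def
    by (subst inner_commute, subst Bochner_Integration.integral_sum)
       (auto simp: mean_component intro!: P.square_integrable_integrable square_inner_component)
qed

lemma covariance_inner_on: "(\<integral>x. inner_on I v x * inner_on I w x \<partial>P) = inner_on I v w"
proof -
  have "(\<integral>x. inner_on I v x * inner_on I w x \<partial>P)
      = (\<integral>x. (\<Sum>a\<in>I. \<Sum>b\<in>I. inner (x a) (v a) * inner (x b) (w b)) \<partial>P)"
    by (simp add: inner_on_def sum_product inner_commute)
  also have "\<dots> = (\<Sum>a\<in>I. \<Sum>b\<in>I. \<integral>x. inner (x a) (v a) * inner (x b) (w b) \<partial>P)"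
    by (simp add: Bochner_Integration.integral_sum square_integrable_mult square_inner_component)
  also have "\<dots> = inner_on I v w"
    using finite_I by (simp add: covariance_components inner_on_def cong: sum.cong)
  finally show ?thesis .
qed

end

lemma isotropic_gauss: "isotropic (gauss :: 'a::euclidean_space measure)"
proof -
  interpret R: isotropic_vector "gauss :: real measure" "Basis :: 'a set"
    by unfold_locales (auto intro: isotropic_gauss_real)
  let ?h = "\<lambda>f::'a \<Rightarrow> real. \<Sum>b\<in>Basis. f b *\<^sub>R b"
  have h [measurable]: "?h \<in> R.P \<rightarrow>\<^sub>M borel" by measurable
  have inner_h: "inner (?h f) u = inner_on Basis (inner u) f" for f u
    by (simp add: inner_on_def inner_sum_left) (simp add: inner_commute mult.commute)
  have "square_integrable R.P (\<lambda>f. \<Sum>b\<in>Basis. (norm (f b))\<^sup>2)"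
    by (intro square_integrable_sum R.square_norm)
  moreover have "(\<Sum>b\<in>Basis. (norm (f b))\<^sup>2) = (norm (?h f))\<^sup>2" for f
    by (subst power2_norm_eq_inner[of "?h f"], subst euclidean_inner)
       (simp add: inner_sum_left inner_Basis power2_eq_square if_distrib cong: if_cong sum.cong)
  ultimately have "square_integrable R.P (\<lambda>f. (norm (?h f))\<^sup>2)" by simp
  then have sq: "square_integrable gauss (\<lambda>z::'a. (norm z)\<^sup>2)"
    by (subst gauss_eq_distr, subst square_integrable_distr) auto
  have mean: "(\<integral>z. inner z u \<partial>gauss) = 0" for u :: 'a
    by (subst gauss_eq_distr, subst integral_distr) (auto simp: inner_h R.mean_inner_on)
  have cov: "(\<integral>z. inner z u * inner z v \<partial>gauss) = inner u v" for u v :: 'a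
    by (subst gauss_eq_distr, subst integral_distr)
       (auto simp: inner_h R.covariance_inner_on, simp add: inner_on_def euclidean_inner[of u v])
  show ?thesis
    using prob_space_gauss sq mean cov by (simp add: isotropic_def)
qed

lemma isotropic_vector_gauss: "finite I \<Longrightarrow> isotropic_vector (gauss :: 'a::euclidean_space measure) I"
  by unfold_locales (auto intro: isotropic_gauss)

lemmas square_inner_on_gauss = isotropic_vector.square_inner_on[OF isotropic_vector_gauss, folded gauss_vec_def]
  and mean_inner_on_gauss = isotropic_vector.mean_inner_on[OF isotropic_vector_gauss, folded gauss_vec_def]
  and covariance_inner_on_gauss = isotropic_vector.covariance_inner_on[OF isotropic_vector_gauss, folded gauss_vec_def]
  and square_bilinear_gauss = isotropic_vector.square_bilinear[OF isotropic_vector_gauss, folded gauss_vec_def]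
  and covariance_components_gauss = isotropic_vector.covariance_components[OF isotropic_vector_gauss, folded gauss_vec_def]
  and square_inner_component_gauss = isotropic_vector.square_inner_component[OF isotropic_vector_gauss, folded gauss_vec_def]

text \<open>
  This symmetry makes odd moments vanish; it decouples the linear from the quadratic part of an
  increment.
\<close>

lemma gauss_vec_neg:
  assumes I: "finite I"
  shows "distr (gauss_vec I) (gauss_vec I) (\<lambda>x. \<lambda>i\<in>I. - x i) = (gauss_vec I :: ('i \<Rightarrow> 'a::euclidean_space) measure)"
proof -
  have neg: "distr gauss gauss uminus = (gauss :: 'a measure)"
  proof -
    have "(lborel :: 'a measure) = density (distr lborel borel (\<lambda>x. 0 + (-1) *\<^sub>R x)) (\<lambda>_. ennreal (\<bar>- 1\<bar> ^ DIM('a)))"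
      by (rule lborel_affine) simp
    then have l: "distr lborel borel uminus = (lborel :: 'a measure)"
      by (simp add: density_1)
    have "distr (gauss :: 'a measure) borel uminus = distr (density lborel (\<lambda>x. ennreal (gauss_density (- x)))) borel uminus"
      by (simp add: gauss_def gauss_density_def)
    also have "\<dots> = density (distr lborel borel uminus) (\<lambda>x. ennreal (gauss_density x))"
      by (rule density_distr[symmetric]) auto
    finally show ?thesis unfolding l gauss_def[symmetric]
      by (metis distr_cong sets_gauss)
  qed
  show ?thesis
    unfolding gauss_vec_def
    by (rule distr_PiM_componentwise[OF I prob_space_imp_sigma_finite[OF prob_space_gauss]]) (simp_all add: neg)
qed

lemma integral_gauss_vec_odd:
  fixes f :: "('i \<Rightarrow> 'a::euclidean_space) \<Rightarrow> real"
  assumes I: "finite I" and [measurable]: "f \<in> borel_measurable (PiM I (\<lambda>_. borel))"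
    and odd: "\<And>x. f (\<lambda>i\<in>I. - x i) = - f x"
  shows "(\<integral>x. f x \<partial>gauss_vec I) = 0"
proof -
  have "(\<integral>x. f x \<partial>gauss_vec I) = (\<integral>x. f (\<lambda>i\<in>I. - x i) \<partial>gauss_vec I)"
    by (subst gauss_vec_neg[OF I, symmetric], subst integral_distr) auto
  then show ?thesis by (simp add: odd)
qed

section \<open>Coupling a linear image of a Gaussian vector with a standard one\<close>

definition kdelta :: "nat \<Rightarrow> nat \<Rightarrow> real" where "kdelta j k = (if j = k then 1 else 0)"

lemma sum_kdelta [simp]:
  "j < d \<Longrightarrow> (\<Sum>k<d. kdelta j k * f k) = f j" "j < d \<Longrightarrow> (\<Sum>k<d. kdelta k j * f k) = f j"
  "j < d \<Longrightarrow> (\<Sum>k<d. f k * kdelta j k) = f j" "j < d \<Longrightarrow> (\<Sum>k<d. f k * kdelta k j) = f j"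
proof -
  have "kdelta j k * f k = (if k = j then f k else 0)" "kdelta k j * f k = (if k = j then f k else 0)"
    "f k * kdelta j k = (if k = j then f k else 0)" "f k * kdelta k j = (if k = j then f k else 0)" for k
    by (auto simp: kdelta_def)
  then show "j < d \<Longrightarrow> (\<Sum>k<d. kdelta j k * f k) = f j" "j < d \<Longrightarrow> (\<Sum>k<d. kdelta k j * f k) = f j"
    "j < d \<Longrightarrow> (\<Sum>k<d. f k * kdelta j k) = f j" "j < d \<Longrightarrow> (\<Sum>k<d. f k * kdelta k j) = f j"
    by simp_all
qed

text \<open>
  The entries of (I + S)^{-1}, written by means of the adjugate matrix because that form makes their
  measurable dependence on S evident.
\<close>

definition resolvent :: "nat \<Rightarrow> (nat \<Rightarrow> nat \<Rightarrow> real) \<Rightarrow> nat \<Rightarrow> nat \<Rightarrow> real" where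
  "resolvent d S j k =
     (let A = mat d d (\<lambda>(j, k). kdelta j k + S j k) in adj_mat A $$ (j, k) / det A)"

lemma det_measurable:
  assumes [measurable]: "\<And>j k. j < m \<Longrightarrow> k < m \<Longrightarrow> (\<lambda>w. T w j k) \<in> borel_measurable M"
  shows "(\<lambda>w. det (mat m m (\<lambda>(j, k). T w j k :: real))) \<in> borel_measurable M"
proof -
  have "(\<lambda>w. \<Sum>p\<in>{p. p permutes {0..<m}}. signof p * (\<Prod>i = 0..<m. T w i (p i))) \<in> borel_measurable M"
  proof (intro borel_measurable_sum borel_measurable_times borel_measurable_const borel_measurable_prod)
    fix p i assume "p \<in> {p. p permutes {0..<m}}" "i \<in> {0..<m}"
    then have "p i < m" "i < m" using permutes_in_image[of p "{0..<m}" i] by auto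
    then show "(\<lambda>w. T w i (p i)) \<in> borel_measurable M" by measurable
  qed
  also have "(\<lambda>w. \<Sum>p\<in>{p. p permutes {0..<m}}. signof p * (\<Prod>i = 0..<m. T w i (p i)))
      = (\<lambda>w. det (mat m m (\<lambda>(j, k). T w j k)))"
    unfolding det_def
    by (intro ext) (auto intro!: sum.cong prod.cong dest: permutes_in_image)
  finally show ?thesis .
qed

lemma resolvent_measurable:
  assumes [measurable]: "\<And>j k. j < d \<Longrightarrow> k < d \<Longrightarrow> (\<lambda>w. S w j k) \<in> borel_measurable M"
    and jk: "j < d" "k < d"
  shows "(\<lambda>w. resolvent d (S w) j k) \<in> borel_measurable M"
proof -
  have eq: "adj_mat (mat d d (\<lambda>(j, k). kdelta j k + S w j k)) $$ (j, k)
     = (-1) ^ (k + j) * det (mat (d - 1) (d - 1) (\<lambda>(r, c).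
         kdelta (if r < k then r else Suc r) (if c < j then c else Suc c)
           + S w (if r < k then r else Suc r) (if c < j then c else Suc c)))" for w
    unfolding adj_mat_def cofactor_def mat_delete_def using jk
    by (auto intro!: arg_cong[where f=det] eq_matI)
  have [measurable]: "(\<lambda>w. det (mat (d - 1) (d - 1) (\<lambda>(r, c).
         kdelta (if r < k then r else Suc r) (if c < j then c else Suc c)
           + S w (if r < k then r else Suc r) (if c < j then c else Suc c)))) \<in> borel_measurable M"
    by (rule det_measurable) (intro borel_measurable_add borel_measurable_const assms(1), use jk in auto)
  have [measurable]: "(\<lambda>w. det (mat d d (\<lambda>(j, k). kdelta j k + S w j k))) \<in> borel_measurable M"
    by (rule det_measurable) measurable
  show ?thesis unfolding resolvent_def Let_def eq by measurable
qed

text \<open>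
  I + S is invertible since (I + S) v = 0 implies |v|^2 + v^T S v = 0.
\<close>

lemma resolvent_inverse:
  assumes psd: "\<And>v. 0 \<le> (\<Sum>j<d. \<Sum>k<d. v j * S j k * v k)" and jl: "j < d" "l < d"
  shows "(\<Sum>k<d. resolvent d S j k * (kdelta k l + S k l)) = kdelta j l"
    and "(\<Sum>k<d. (kdelta j k + S j k) * resolvent d S k l) = kdelta j l"
proof -
  define A where "A = mat d d (\<lambda>(j, k). kdelta j k + S j k)"
  have A: "A \<in> carrier_mat d d" by (simp add: A_def)
  have "det A \<noteq> 0"
  proof
    assume "det A = 0"
    then obtain v where v: "v \<in> carrier_vec d" "v \<noteq> 0\<^sub>v d" "A *\<^sub>v v = 0\<^sub>v d"
      using det_0_iff_vec_prod_zero[OF A] by auto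
    have Av: "(\<Sum>k<d. (kdelta j k + S j k) * vec_index v k) = 0" if "j < d" for j
    proof -
      have "vec_index (A *\<^sub>v v) j = (\<Sum>k<d. (kdelta j k + S j k) * vec_index v k)"
        using that v(1) by (auto simp: A_def mult_mat_vec_def scalar_prod_def lessThan_atLeast0 intro!: sum.cong)
      then show ?thesis using v(3) that by simp
    qed
    have "0 = (\<Sum>j<d. vec_index v j * (\<Sum>k<d. (kdelta j k + S j k) * vec_index v k))"
      using Av by simp
    also have "\<dots> = (\<Sum>j<d. (vec_index v j)\<^sup>2) + (\<Sum>j<d. \<Sum>k<d. vec_index v j * S j k * vec_index v k)"
      by (simp add: distrib_right sum.distrib distrib_left power2_eq_square sum_distrib_left mult.assoc)
    finally have "(\<Sum>j<d. (vec_index v j)\<^sup>2) \<le> 0" using psd[of "\<lambda>j. vec_index v j"] by linarith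
    then have "(\<Sum>j<d. (vec_index v j)\<^sup>2) = 0" by (meson order_antisym sum_nonneg zero_le_power2)
    then have "vec_index v j = 0" if "j < d" for j using that by (subst (asm) sum_nonneg_eq_0_iff) auto
    then show False using v(1,2) by (auto simp: vec_eq_iff)
  qed
  then have d: "det A \<noteq> 0" .
  have R: "resolvent d S j k = adj_mat A $$ (j, k) / det A" for j k
    by (simp add: resolvent_def A_def Let_def)
  have one: "(det A \<cdot>\<^sub>m 1\<^sub>m d) $$ (j, l) = det A * kdelta j l"
    using jl by (simp add: kdelta_def)
  have "(adj_mat A * A) $$ (j, l) = (\<Sum>k<d. adj_mat A $$ (j, k) * (kdelta k l + S k l))"
    using jl adj_mat(1)[OF A] A
    by (auto simp: times_mat_def scalar_prod_def lessThan_atLeast0 A_def intro!: sum.cong)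
  then show "(\<Sum>k<d. resolvent d S j k * (kdelta k l + S k l)) = kdelta j l"
    unfolding adj_mat(3)[OF A] one using d by (simp add: R nonzero_divide_eq_eq mult.commute flip: sum_divide_distrib)
  have "(A * adj_mat A) $$ (j, l) = (\<Sum>k<d. (kdelta j k + S j k) * adj_mat A $$ (k, l))"
    using jl adj_mat(1)[OF A] A
    by (auto simp: times_mat_def scalar_prod_def lessThan_atLeast0 A_def intro!: sum.cong)
  then show "(\<Sum>k<d. (kdelta j k + S j k) * resolvent d S k l) = kdelta j l"
    unfolding adj_mat(2)[OF A] one using d by (simp add: R nonzero_divide_eq_eq mult.commute flip: sum_divide_distrib)
qed

lemma inner_on_linear:
  "inner_on I (\<lambda>i. x i + y i) z = inner_on I x z + inner_on I y z"
  "inner_on I (\<lambda>i. x i - y i) z = inner_on I x z - inner_on I y z"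
  "inner_on I z (\<lambda>i. x i + y i) = inner_on I z x + inner_on I z y"
  "inner_on I z (\<lambda>i. x i - y i) = inner_on I z x - inner_on I z y"
  "inner_on I (\<lambda>i. c *\<^sub>R x i) z = c * inner_on I x z"
  "inner_on I z (\<lambda>i. c *\<^sub>R x i) = c * inner_on I z x"
  by (simp_all add: inner_on_def inner_add_left inner_add_right inner_diff_left inner_diff_right
      sum.distrib sum_subtractf sum_distrib_left)

lemma inner_on_sum_right: "inner_on I z (\<lambda>i. \<Sum>k\<in>K. c k *\<^sub>R x k i) = (\<Sum>k\<in>K. c k * inner_on I z (x k))"
  unfolding inner_on_def inner_sum_right inner_scaleR_right sum_distrib_left by (rule sum.swap)

lemma inner_on_commute: "inner_on I x y = inner_on I y x"
  by (simp add: inner_on_def inner_commute)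

lemma inner_on_sum_left: "inner_on I (\<lambda>i. \<Sum>k\<in>K. c k *\<^sub>R x k i) z = (\<Sum>k\<in>K. c k * inner_on I (x k) z)"
  by (subst (1 2) inner_on_commute) (rule inner_on_sum_right)

lemma inner_on_nonneg: "0 \<le> inner_on I x x"
  by (simp add: inner_on_def sum_nonneg)

lemma bilinear_sum_swap:
  fixes x s :: "nat \<Rightarrow> real"
  shows "(\<Sum>j<d. \<Sum>k<d. x j * M j k * s k) = (\<Sum>k<d. (\<Sum>j<d. M j k * x j) * s k)"
  by (subst sum.swap) (simp add: sum_distrib_left sum_distrib_right mult_ac)

definition gram :: "'i set \<Rightarrow> (nat \<Rightarrow> 'i \<Rightarrow> 'a::euclidean_space) \<Rightarrow> nat \<Rightarrow> nat \<Rightarrow> real" where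
  "gram I a j k = inner_on I (a j) (a k)"

lemma gram_psd: "(\<Sum>j<d. \<Sum>k<d. v j * gram I a j k * v k) = inner_on I (\<lambda>i. \<Sum>j<d. v j *\<^sub>R a j i) (\<lambda>i. \<Sum>j<d. v j *\<^sub>R a j i)"
  by (simp add: inner_on_sum_left inner_on_sum_right gram_def sum_distrib_left mult_ac)

lemma gram_psd_nonneg: "0 \<le> (\<Sum>j<d. \<Sum>k<d. v j * gram I a j k * v k)"
  unfolding gram_psd by (rule inner_on_nonneg)

lemma gram_sym: "gram I a j k = gram I a k j"
  by (simp add: gram_def inner_on_commute)

definition cayley_coupling ::
  "'i set \<Rightarrow> nat \<Rightarrow> (nat \<Rightarrow> 'i \<Rightarrow> 'a::euclidean_space) \<Rightarrow> ('i \<Rightarrow> 'a) \<Rightarrow> (nat \<Rightarrow> real) \<Rightarrow> nat \<Rightarrow> real" where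
  "cayley_coupling I d a \<xi> \<eta> =
     (\<lambda>j\<in>{..<d}. 2 * (\<Sum>k<d. resolvent d (gram I a) j k * (inner_on I (a k) \<xi> + \<eta> k)) - \<eta> j)"

text \<open>
  With A the matrix whose rows are the a j, take \<tau> = A^T and \<delta> = 2 (I + S)^{-1} A in the double shear.
  As \<psi> - \<eta> = \<delta> \<xi> satisfies (I + S) (\<psi> - \<eta>) = 2 A \<xi>, the quadratic form of I + S changes by
  2 <A \<xi>, \<psi> + \<eta>> between \<eta> and \<psi>, which is what invariance of the norm requires. The resulting
  second component is 2 (I + S)^{-1} (A \<xi> + \<eta>) - \<eta>.
\<close>

lemma nn_integral_cayley_coupling:
  fixes a :: "nat \<Rightarrow> 'i \<Rightarrow> 'a::euclidean_space"
  assumes I: "finite I" and f [measurable]: "f \<in> borel_measurable (PiM {..<d} (\<lambda>_. borel))"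
  shows "(\<integral>\<^sup>+\<xi>. \<integral>\<^sup>+\<eta>. f (cayley_coupling I d a \<xi> \<eta>) \<partial>gauss_vec {..<d} \<partial>gauss_vec I)
    = (\<integral>\<^sup>+\<eta>. f \<eta> \<partial>gauss_vec {..<d})"
proof -
  define R where "R = resolvent d (gram I a)"
  define M where "M j k = kdelta j k + gram I a j k" for j k
  have RM: "(\<Sum>k<d. R j k * M k l) = kdelta j l" and MR: "(\<Sum>k<d. M j k * R k l) = kdelta j l"
    if "j < d" "l < d" for j l
    unfolding R_def M_def using resolvent_inverse[OF gram_psd_nonneg that] by auto
  have M_sym: "M j k = M k j" for j k by (simp add: M_def gram_sym[of I a j k] kdelta_def)
  define \<tau> where "\<tau> \<eta> = (\<lambda>i\<in>I. \<Sum>l<d. \<eta> l *\<^sub>R a l i)" for \<eta> :: "nat \<Rightarrow> real"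
  define \<delta> where "\<delta> \<xi> = (\<lambda>j\<in>{..<d}. 2 * (\<Sum>k<d. R j k * inner_on I (a k) \<xi>))" for \<xi>
  have [measurable]: "\<tau> \<in> PiM {..<d} (\<lambda>_. borel) \<rightarrow>\<^sub>M PiM I (\<lambda>_. borel)"
    unfolding \<tau>_def[abs_def] by measurable
  have [measurable]: "\<delta> \<in> PiM I (\<lambda>_. borel) \<rightarrow>\<^sub>M PiM {..<d} (\<lambda>_. borel)"
    unfolding \<delta>_def[abs_def] by measurable
  have \<tau>_inner: "inner_on I x (\<tau> \<eta>) = (\<Sum>l<d. \<eta> l * inner_on I (a l) x)" for x \<eta>
    unfolding \<tau>_def by (simp add: inner_on_sum_right inner_on_commute)
  have \<tau>\<tau>: "inner_on I (\<tau> \<eta>) (\<tau> \<eta>') + (\<Sum>j<d. \<eta> j * \<eta>' j) = (\<Sum>j<d. \<Sum>k<d. \<eta> j * M j k * \<eta>' k)" for \<eta> \<eta>'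
  proof -
    have "(\<Sum>j<d. \<Sum>k<d. \<eta> j * M j k * \<eta>' k) = (\<Sum>j<d. \<eta> j * \<eta>' j) + (\<Sum>j<d. \<Sum>k<d. \<eta> j * gram I a j k * \<eta>' k)"
      unfolding M_def by (simp add: distrib_left distrib_right sum.distrib mult.assoc flip: sum_distrib_left)
    moreover have "inner_on I (\<tau> \<eta>) (\<tau> \<eta>') = (\<Sum>j<d. \<Sum>k<d. \<eta> j * gram I a j k * \<eta>' k)"
      unfolding \<tau>_def
      by (simp add: inner_on_sum_left inner_on_sum_right gram_def sum_distrib_left mult_ac) (rule sum.swap)
    ultimately show ?thesis by simp
  qed
  have "(\<integral>\<^sup>+\<xi>. \<integral>\<^sup>+\<eta>. f (\<lambda>j\<in>{..<d}. \<eta> j + \<delta> (\<lambda>i\<in>I. \<xi> i - \<tau> \<eta> i) j) \<partial>gauss_vec {..<d} \<partial>gauss_vec I)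
    = (\<integral>\<^sup>+\<eta>. f \<eta> \<partial>gauss_vec {..<d})"
  proof (rule nn_integral_gauss_vec_double_shear[OF I])
    fix \<xi> :: "'i \<Rightarrow> 'a" and \<eta> \<psi> :: "nat \<Rightarrow> real"
    assume \<psi>: "\<psi> = (\<lambda>j\<in>{..<d}. \<eta> j + \<delta> \<xi> j)"
    define u where "u k = inner_on I (a k) \<xi>" for k
    have "(\<Sum>j<d. \<Sum>k<d. \<psi> j * M j k * \<psi> k) - (\<Sum>j<d. \<Sum>k<d. \<eta> j * M j k * \<eta> k)
        = (\<Sum>j<d. \<Sum>k<d. (\<psi> j - \<eta> j) * M j k * (\<psi> k + \<eta> k))"
    proof -
      have "(\<Sum>j<d. \<Sum>k<d. \<psi> j * M j k * \<eta> k) = (\<Sum>j<d. \<Sum>k<d. \<eta> j * M j k * \<psi> k)"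
        by (subst sum.swap) (simp add: M_sym mult_ac)
      then show ?thesis by (simp add: algebra_simps sum.distrib sum_subtractf)
    qed
    also have "\<dots> = (\<Sum>k<d. (\<Sum>j<d. M j k * (\<psi> j - \<eta> j)) * (\<psi> k + \<eta> k))"
      by (rule bilinear_sum_swap)
    also have "\<dots> = (\<Sum>k<d. 2 * u k * (\<psi> k + \<eta> k))"
    proof (intro sum.cong refl arg_cong2[where f="(*)"])
      fix k assume k: "k \<in> {..<d}"
      have "(\<Sum>j<d. M k j * \<delta> \<xi> j) = 2 * (\<Sum>j<d. \<Sum>l<d. M k j * R j l * u l)"
        by (simp add: \<delta>_def u_def sum_distrib_left mult_ac)
      also have "\<dots> = 2 * (\<Sum>l<d. (\<Sum>j<d. M k j * R j l) * u l)"
        by (subst sum.swap) (simp add: sum_distrib_right)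
      also have "\<dots> = 2 * u k" using k MR by simp
      finally show "(\<Sum>j<d. M j k * (\<psi> j - \<eta> j)) = 2 * u k"
        by (simp add: \<psi> M_sym)
    qed
    also have "\<dots> = 2 * inner_on I \<xi> (\<tau> \<psi>) + 2 * inner_on I \<xi> (\<tau> \<eta>)"
      unfolding \<tau>_inner u_def[symmetric] sum_distrib_left sum.distrib[symmetric]
      by (intro sum.cong refl) (simp add: algebra_simps)
    finally have "(\<Sum>j<d. \<Sum>k<d. \<psi> j * M j k * \<psi> k) - (\<Sum>j<d. \<Sum>k<d. \<eta> j * M j k * \<eta> k)
        = 2 * inner_on I \<xi> (\<tau> \<psi>) + 2 * inner_on I \<xi> (\<tau> \<eta>)" .
    moreover have "inner_on {..<d} v v = (\<Sum>j<d. v j * v j)" for v :: "nat \<Rightarrow> real"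
      by (simp add: inner_on_def)
    ultimately show "inner_on I (\<lambda>i. \<xi> i - \<tau> \<psi> i) (\<lambda>i. \<xi> i - \<tau> \<psi> i) + inner_on {..<d} \<psi> \<psi>
      = inner_on I (\<lambda>i. \<xi> i + \<tau> \<eta> i) (\<lambda>i. \<xi> i + \<tau> \<eta> i) + inner_on {..<d} \<eta> \<eta>"
      using \<tau>\<tau>[of \<psi> \<psi>] \<tau>\<tau>[of \<eta> \<eta>]
      by (simp add: inner_on_linear inner_on_commute[of I "\<tau> _" \<xi>])
  qed auto
  moreover have "(\<lambda>j\<in>{..<d}. \<eta> j + \<delta> (\<lambda>i\<in>I. \<xi> i - \<tau> \<eta> i) j) = cayley_coupling I d a \<xi> \<eta>" for \<xi> \<eta>
    unfolding cayley_coupling_def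
  proof (rule restrict_ext)
    fix j assume j: "j \<in> {..<d}"
    have "(\<Sum>k<d. R j k * (\<Sum>l<d. \<eta> l * gram I a k l)) + (\<Sum>k<d. R j k * \<eta> k)
      = (\<Sum>k<d. R j k * (\<Sum>l<d. M k l * \<eta> l))"
      by (simp add: M_def distrib_right sum.distrib distrib_left mult_ac)
    also have "\<dots> = (\<Sum>l<d. (\<Sum>k<d. R j k * M k l) * \<eta> l)"
      by (simp add: sum_distrib_left sum_distrib_right mult.assoc) (rule sum.swap)
    also have "\<dots> = \<eta> j" using j RM by simp
    finally have *: "(\<Sum>k<d. R j k * (\<Sum>l<d. \<eta> l * gram I a k l)) = \<eta> j - (\<Sum>k<d. R j k * \<eta> k)" by simp
    have "\<delta> (\<lambda>i\<in>I. \<xi> i - \<tau> \<eta> i) j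
       = 2 * ((\<Sum>k<d. R j k * inner_on I (a k) \<xi>) - (\<Sum>k<d. R j k * (\<Sum>l<d. \<eta> l * gram I a k l)))"
      using j by (simp add: \<delta>_def inner_on_linear \<tau>_inner gram_def right_diff_distrib sum_subtractf)
        (simp add: inner_on_commute)
    then show "\<eta> j + \<delta> (\<lambda>i\<in>I. \<xi> i - \<tau> \<eta> i) j
      = 2 * (\<Sum>k<d. resolvent d (gram I a) j k * (inner_on I (a k) \<xi> + \<eta> k)) - \<eta> j"
      unfolding * R_def[symmetric] by (simp add: distrib_left sum.distrib)
  qed
  ultimately show ?thesis by simp
qed

text \<open>
  The Cayley transform (I - S) (I + S)^{-1}. It maps A \<xi> + \<eta> to the displacement between A \<xi> and its
  standard Gaussian partner.
\<close>

definition cayley :: "nat \<Rightarrow> (nat \<Rightarrow> nat \<Rightarrow> real) \<Rightarrow> nat \<Rightarrow> nat \<Rightarrow> real" where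
  "cayley d S j k = 2 * resolvent d S j k - kdelta j k"

lemma cayley_coupling_diff:
  "j < d \<Longrightarrow> cayley_coupling I d a \<xi> \<eta> j - inner_on I (a j) \<xi>
     = (\<Sum>k<d. cayley d (gram I a) j k * (inner_on I (a k) \<xi> + \<eta> k))"
  by (simp add: cayley_coupling_def cayley_def left_diff_distrib sum_subtractf sum_distrib_left mult.assoc)

lemma cayley_times:
  assumes "\<And>v. 0 \<le> (\<Sum>j<d. \<Sum>k<d. v j * S j k * v k)" and "j < d" "l < d"
  shows "(\<Sum>k<d. cayley d S j k * (kdelta k l + S k l)) = kdelta j l - S j l"
  using resolvent_inverse(1)[OF assms] assms(2,3)
  by (simp add: cayley_def left_diff_distrib sum_subtractf mult.assoc flip: sum_distrib_left)

text \<open>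
  The left-hand side is tr (W (I + S) W^T), the mean square of the displacement W (A \<xi> + \<eta>). Put
  E = I - S. Since W (I + S) = E, it equals <W, E>, and since S is positive it is at least |W|^2. From
  2 <W, E> \<le> |W|^2 + |E|^2 it follows that it is at most |E|^2.
\<close>

lemma cayley_cost:
  assumes psd: "\<And>v. 0 \<le> (\<Sum>j<d. \<Sum>k<d. v j * S j k * v k)"
  defines "W \<equiv> cayley d S"
  shows "(\<Sum>j<d. \<Sum>k<d. \<Sum>l<d. W j k * W j l * (kdelta k l + S k l)) \<le> (\<Sum>j<d. \<Sum>k<d. (kdelta j k - S j k)\<^sup>2)"
proof -
  let ?E = "\<lambda>j k. kdelta j k - S j k"
  let ?C = "\<Sum>j<d. \<Sum>k<d. \<Sum>l<d. W j k * W j l * (kdelta k l + S k l)"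
  have C: "?C = (\<Sum>j<d. \<Sum>l<d. W j l * ?E j l)"
  proof (rule sum.cong[OF refl])
    fix j assume j: "j \<in> {..<d}"
    have "(\<Sum>k<d. \<Sum>l<d. W j k * W j l * (kdelta k l + S k l)) = (\<Sum>l<d. W j l * (\<Sum>k<d. W j k * (kdelta k l + S k l)))"
      by (subst sum.swap) (simp add: sum_distrib_left mult_ac)
    also have "\<dots> = (\<Sum>l<d. W j l * ?E j l)"
      using j by (intro sum.cong refl) (simp add: W_def cayley_times[OF psd])
    finally show "(\<Sum>k<d. \<Sum>l<d. W j k * W j l * (kdelta k l + S k l)) = \<dots>" .
  qed
  have "(\<Sum>j<d. \<Sum>l<d. (W j l)\<^sup>2) \<le> ?C"
  proof (rule sum_mono)
    fix j
    have "(\<Sum>k<d. \<Sum>l<d. W j k * W j l * (kdelta k l + S k l))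
      = (\<Sum>k<d. (W j k)\<^sup>2) + (\<Sum>k<d. \<Sum>l<d. W j k * S k l * W j l)"
      by (simp add: distrib_left sum.distrib power2_eq_square mult_ac flip: sum_distrib_left)
    then show "(\<Sum>l<d. (W j l)\<^sup>2) \<le> (\<Sum>k<d. \<Sum>l<d. W j k * W j l * (kdelta k l + S k l))"
      using psd[of "W j"] by simp
  qed
  moreover have "2 * ?C \<le> (\<Sum>j<d. \<Sum>l<d. (W j l)\<^sup>2) + (\<Sum>j<d. \<Sum>k<d. (?E j k)\<^sup>2)"
    unfolding C sum.distrib[symmetric] sum_distrib_left
  proof (intro sum_mono)
    fix j l show "2 * (W j l * ?E j l) \<le> (W j l)\<^sup>2 + (?E j l)\<^sup>2"
      using zero_le_power2[of "W j l - ?E j l"] by (simp add: power2_diff)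
  qed
  ultimately show ?thesis by linarith
qed

section \<open>Coupling quadratic forms with a Gaussian vector\<close>

lemma marginal_fst:
  assumes "prob_space M" "prob_space N" shows "distr (M \<Otimes>\<^sub>M N) M fst = M"
proof (rule measure_eqI)
  interpret N: prob_space N by fact
  fix A assume "A \<in> sets (distr (M \<Otimes>\<^sub>M N) M fst)"
  then have A: "A \<in> sets M" by simp
  have "fst -` A \<inter> space (M \<Otimes>\<^sub>M N) = A \<times> space N"
    using sets.sets_into_space[OF A] by (auto simp: space_pair_measure)
  then show "emeasure (distr (M \<Otimes>\<^sub>M N) M fst) A = emeasure M A"
    using A by (simp add: emeasure_distr N.emeasure_pair_measure_Times N.emeasure_space_1)
qed simp

lemma marginal_snd:
  assumes "prob_space M" "prob_space N" shows "distr (M \<Otimes>\<^sub>M N) N snd = N"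
proof (rule measure_eqI)
  interpret M: prob_space M by fact
  interpret N: prob_space N by fact
  fix A assume "A \<in> sets (distr (M \<Otimes>\<^sub>M N) N snd)"
  then have A: "A \<in> sets N" by simp
  have "snd -` A \<inter> space (M \<Otimes>\<^sub>M N) = space M \<times> A"
    using sets.sets_into_space[OF A] by (auto simp: space_pair_measure)
  then show "emeasure (distr (M \<Otimes>\<^sub>M N) N snd) A = emeasure N A"
    using A by (simp add: emeasure_distr N.emeasure_pair_measure_Times M.emeasure_space_1)
qed simp

locale prob_pair = M: prob_space M + N: prob_space N for M :: "'a measure" and N :: "'b measure"
begin

sublocale pair_prob_space M N ..

lemma square_fst: "square_integrable M f \<Longrightarrow> square_integrable (M \<Otimes>\<^sub>M N) (\<lambda>p. f (fst p))"
  using marginal_fst[OF M.prob_space_axioms N.prob_space_axioms] square_integrable_distr[of fst "M \<Otimes>\<^sub>M N" M f]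
    square_integrable_measurable[of M f] by simp

lemma square_snd: "square_integrable N f \<Longrightarrow> square_integrable (M \<Otimes>\<^sub>M N) (\<lambda>p. f (snd p))"
  using marginal_snd[OF M.prob_space_axioms N.prob_space_axioms] square_integrable_distr[of snd "M \<Otimes>\<^sub>M N" N f]
    square_integrable_measurable[of N f] by simp

lemma expectation_fst: "f \<in> borel_measurable M \<Longrightarrow> (\<integral>p. f (fst p) \<partial>(M \<Otimes>\<^sub>M N)) = (\<integral>x. (f x :: real) \<partial>M)"
  by (subst (2) marginal_fst[OF M.prob_space_axioms N.prob_space_axioms, symmetric]) (simp add: integral_distr)

lemma expectation_snd: "f \<in> borel_measurable N \<Longrightarrow> (\<integral>p. f (snd p) \<partial>(M \<Otimes>\<^sub>M N)) = (\<integral>x. (f x :: real) \<partial>N)"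
  by (subst (2) marginal_snd[OF M.prob_space_axioms N.prob_space_axioms, symmetric]) (simp add: integral_distr)

lemma expectation_mult:
  assumes f: "square_integrable M f" and g: "square_integrable N g"
  shows "(\<integral>p. f (fst p) * g (snd p) \<partial>(M \<Otimes>\<^sub>M N)) = (\<integral>x. f x \<partial>M) * (\<integral>y. g y \<partial>N)"
proof -
  have "integrable (M \<Otimes>\<^sub>M N) (\<lambda>p. f (fst p) * g (snd p))"
    by (intro square_integrable_mult square_fst square_snd f g)
  from integral_fst'[OF this] show ?thesis by simp
qed

end

text \<open>
  The three contributions to the increment of the cost: the old discrepancy, the error of matching
  the linear term, and the quadratic remainder.
\<close>

lemma (in prob_space) expectation_square_three:
  assumes Z: "square_integrable M Z" and X: "square_integrable M X"
    and "expectation Z = 0" "expectation X = 0" "(\<integral>w. Z w * X w \<partial>M) = 0"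
  shows "(\<integral>w. (p + q * Z w + r * X w)\<^sup>2 \<partial>M)
    = p\<^sup>2 + q\<^sup>2 * (\<integral>w. (Z w)\<^sup>2 \<partial>M) + r\<^sup>2 * (\<integral>w. (X w)\<^sup>2 \<partial>M)"
proof -
  have [simp]: "integrable M (\<lambda>w. (Z w)\<^sup>2)" "integrable M (\<lambda>w. (X w)\<^sup>2)" "integrable M Z" "integrable M X"
    "integrable M (\<lambda>w. Z w * X w)"
    using Z X by (auto simp: square_integrable_def square_integrable_integrable square_integrable_mult)
  have "(p + q * Z w + r * X w)\<^sup>2 = p\<^sup>2 + q\<^sup>2 * (Z w)\<^sup>2 + r\<^sup>2 * (X w)\<^sup>2 + 2 * p * q * Z w + 2 * p * r * X w
      + 2 * q * r * (Z w * X w)" for w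
    by (simp add: power2_eq_square algebra_simps)
  then have "(\<integral>w. (p + q * Z w + r * X w)\<^sup>2 \<partial>M) = (\<integral>w. p\<^sup>2 + q\<^sup>2 * (Z w)\<^sup>2 + r\<^sup>2 * (X w)\<^sup>2 + 2 * p * q * Z w
     + 2 * p * r * X w + 2 * q * r * (Z w * X w) \<partial>M)" by simp
  also have "\<dots> = p\<^sup>2 + q\<^sup>2 * (\<integral>w. (Z w)\<^sup>2 \<partial>M) + r\<^sup>2 * (\<integral>w. (X w)\<^sup>2 \<partial>M)"
    using assms(3-5) by (simp add: prob_space)
  finally show ?thesis .
qed

lemma nn_integral_square:
  "square_integrable M f \<Longrightarrow> (\<integral>\<^sup>+x. ennreal ((f x)\<^sup>2) \<partial>M) = ennreal (\<integral>x. (f x)\<^sup>2 \<partial>M)"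
  by (rule nn_integral_eq_integral) (auto simp: square_integrable_def)

text \<open>
  The joint laws of two random elements which may take values in different spaces. Here the first one is
  the Gaussian vector x itself and not only Q(x), because the choice of \<psi> depends on x.
\<close>

definition joint_laws :: "'a measure \<Rightarrow> 'b measure \<Rightarrow> ('a \<times> 'b) measure set" where
  "joint_laws \<mu> \<nu> = {\<pi>. sets \<pi> = sets (\<mu> \<Otimes>\<^sub>M \<nu>) \<and> distr \<pi> \<mu> fst = \<mu> \<and> distr \<pi> \<nu> snd = \<nu>}"

lemma joint_law_nn_integral:
  assumes "\<pi> \<in> joint_laws \<mu> \<nu>"
  shows "f \<in> borel_measurable \<mu> \<Longrightarrow> (\<integral>\<^sup>+p. f (fst p) \<partial>\<pi>) = (\<integral>\<^sup>+x. f x \<partial>\<mu>)"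
    and "g \<in> borel_measurable \<nu> \<Longrightarrow> (\<integral>\<^sup>+p. g (snd p) \<partial>\<pi>) = (\<integral>\<^sup>+y. g y \<partial>\<nu>)"
proof -
  have s [measurable_cong]: "sets \<pi> = sets (\<mu> \<Otimes>\<^sub>M \<nu>)" and 1: "distr \<pi> \<mu> fst = \<mu>" and 2: "distr \<pi> \<nu> snd = \<nu>"
    using assms by (auto simp: joint_laws_def)
  show "f \<in> borel_measurable \<mu> \<Longrightarrow> (\<integral>\<^sup>+p. f (fst p) \<partial>\<pi>) = (\<integral>\<^sup>+x. f x \<partial>\<mu>)"
    using nn_integral_distr[of fst \<pi> \<mu> f] by (simp add: 1)
  show "g \<in> borel_measurable \<nu> \<Longrightarrow> (\<integral>\<^sup>+p. g (snd p) \<partial>\<pi>) = (\<integral>\<^sup>+y. g y \<partial>\<nu>)"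
    using nn_integral_distr[of snd \<pi> \<nu> g] by (simp add: 2)
qed

lemma joint_law_prob_space:
  assumes "\<pi> \<in> joint_laws \<mu> \<nu>" "prob_space \<mu>" shows "prob_space \<pi>"
proof
  interpret prob_space \<mu> by fact
  show "emeasure \<pi> (space \<pi>) = 1"
    using joint_law_nn_integral(1)[OF assms(1), of "\<lambda>_. 1"] by (simp add: emeasure_space_1)
qed

lemma distr_eqI_nn_integral:
  assumes [measurable]: "h \<in> M \<rightarrow>\<^sub>M N"
    and "\<And>f. f \<in> borel_measurable N \<Longrightarrow> (\<integral>\<^sup>+x. f (h x) \<partial>M) = (\<integral>\<^sup>+y. f y \<partial>N)"
  shows "distr M N h = N"
proof (rule measure_eqI)
  fix A assume "A \<in> sets (distr M N h)"
  then have [measurable]: "A \<in> sets N" by simp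
  have "emeasure (distr M N h) A = (\<integral>\<^sup>+y. indicator A y \<partial>distr M N h)" by simp
  also have "\<dots> = (\<integral>\<^sup>+x. indicator A (h x) \<partial>M)" by (rule nn_integral_distr) auto
  also have "\<dots> = (\<integral>\<^sup>+y. indicator A y \<partial>N)" by (rule assms(2)) simp
  finally show "emeasure (distr M N h) A = emeasure N A" by simp
qed simp

lemma cayley_coupling_measurable:
  assumes a [measurable]: "\<And>k i. k < d \<Longrightarrow> i \<in> I \<Longrightarrow> (\<lambda>w. a w k i) \<in> borel_measurable M"
    and [measurable]: "\<And>i. i \<in> I \<Longrightarrow> (\<lambda>w. g w i) \<in> borel_measurable M"
    and [measurable]: "\<And>k. k < d \<Longrightarrow> (\<lambda>w. h w k) \<in> borel_measurable M"
    and j: "j < d"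
  shows "(\<lambda>w. cayley_coupling I d (a w) (g w) (h w) j) \<in> borel_measurable M"
proof -
  have [measurable]: "(\<lambda>w. resolvent d (gram I (a w)) j k) \<in> borel_measurable M" if "k < d" for k
    by (rule resolvent_measurable[OF _ j that]) (unfold gram_def, measurable)
  have "cayley_coupling I d (a w) (g w) (h w) j
      = 2 * (\<Sum>k<d. resolvent d (gram I (a w)) j k * (inner_on I (a w k) (g w) + h w k)) - h w j" for w
    using j by (simp add: cayley_coupling_def)
  then show ?thesis using j by simp
qed

lemma square_coordinate_gauss: "j < d \<Longrightarrow> square_integrable (gauss_vec {..<d}) (\<lambda>y::nat \<Rightarrow> real. y j)"
  using square_inner_component_gauss[of "{..<d}" j "1::real"] by simp

lemma mean_coordinate_gauss:
  fixes j d :: nat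
  assumes j: "j < d" shows "(\<integral>y. y j \<partial>gauss_vec {..<d}) = (0::real)"
  using mean_inner_on_gauss[of "{..<d}" "\<lambda>k. kdelta j k :: real"] j by (simp add: inner_on_def mult.commute)

lemma covariance_coordinates_gauss:
  fixes j d :: nat
  shows
  "j < d \<Longrightarrow> k < d \<Longrightarrow> (\<integral>y. y j * y k \<partial>gauss_vec {..<d}) = kdelta j k"
  using covariance_components_gauss[of "{..<d}" j k "1::real" 1] by (simp add: kdelta_def)

text \<open>
  Forms Q_j(x) = <x, T_j x> / 2 with symmetric T_j, of mean 0 and variance 1. The gradient of Q_j is
  T_j x.
\<close>

locale quadratic_forms =
  fixes I :: "'i set" and d :: nat and T :: "nat \<Rightarrow> ('i \<Rightarrow> 'a::euclidean_space) \<Rightarrow> 'i \<Rightarrow> 'a"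
  assumes finite_I: "finite I"
    and T_linear: "\<And>j b c x y i. j < d \<Longrightarrow> i \<in> I \<Longrightarrow>
          T j (\<lambda>i\<in>I. b *\<^sub>R x i + c *\<^sub>R y i) i = b *\<^sub>R T j x i + c *\<^sub>R T j y i"
    and T_symmetric: "\<And>j x y. j < d \<Longrightarrow> inner_on I (T j x) y = inner_on I x (T j y)"
    and T_measurable: "\<And>j. j < d \<Longrightarrow> T j \<in> PiM I (\<lambda>_. borel) \<rightarrow>\<^sub>M PiM I (\<lambda>_. borel)"
    and square_quadratic: "\<And>j. j < d \<Longrightarrow> square_integrable (gauss_vec I) (\<lambda>x. inner_on I x (T j x) / 2)"
    and mean_quadratic: "\<And>j. j < d \<Longrightarrow> (\<integral>x. inner_on I x (T j x) / 2 \<partial>gauss_vec I) = 0"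
    and variance_quadratic: "\<And>j. j < d \<Longrightarrow> (\<integral>x. (inner_on I x (T j x) / 2)\<^sup>2 \<partial>gauss_vec I) = 1"
    and square_gradient: "\<And>j k. j < d \<Longrightarrow> k < d \<Longrightarrow>
          square_integrable (gauss_vec I) (\<lambda>x. inner_on I (T j x) (T k x) / 2)"
begin

definition Q :: "nat \<Rightarrow> ('i \<Rightarrow> 'a) \<Rightarrow> real" where
  "Q j x = inner_on I x (T j x) / 2"

text \<open>
  The forms Q_j belong to the second Gaussian chaos, for which half of the Gram matrix of the
  gradients is a Stein kernel; its expected value is the covariance matrix of Q.
\<close>

definition stein_kernel :: "nat \<Rightarrow> nat \<Rightarrow> ('i \<Rightarrow> 'a) \<Rightarrow> real" where
  "stein_kernel j k x = inner_on I (T j x) (T k x) / 2"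

text \<open>
  The mean squared Hilbert-Schmidt distance of the Stein kernel from the identity.
\<close>

definition stein_discrepancy :: real where
  "stein_discrepancy =
     (\<Sum>j<d. \<Sum>k<d. \<integral>x. (stein_kernel j k x - kdelta j k)\<^sup>2 \<partial>gauss_vec I)"

definition cost :: "('i \<Rightarrow> 'a) \<times> (nat \<Rightarrow> real) \<Rightarrow> real" where
  "cost p = (\<Sum>j<d. (Q j (fst p) - snd p j)\<^sup>2)"

abbreviation "gauss_couplings \<equiv> joint_laws (gauss_vec I :: ('i \<Rightarrow> 'a) measure) (gauss_vec {..<d} :: (nat \<Rightarrow> real) measure)"

lemma stein_discrepancy_nonneg: "0 \<le> stein_discrepancy"
  unfolding stein_discrepancy_def by (intro sum_nonneg Bochner_Integration.integral_nonneg) auto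

lemma T_component_measurable:
  assumes "j < d" "i \<in> I" "g \<in> M \<rightarrow>\<^sub>M PiM I (\<lambda>_. borel)"
  shows "(\<lambda>w. T j (g w) i) \<in> borel_measurable M"
  using measurable_compose[OF measurable_compose[OF assms(3) T_measurable[OF assms(1)]] measurable_component_singleton[OF assms(2)]] .

lemma Q_measurable:
  assumes j: "j < d" and [measurable]: "g \<in> M \<rightarrow>\<^sub>M PiM I (\<lambda>_. borel)"
  shows "(\<lambda>w. Q j (g w)) \<in> borel_measurable M"
proof -
  note T_component_measurable[OF j, measurable (raw)]
  show ?thesis unfolding Q_def by measurable
qed

lemma cost_measurable [measurable]: "cost \<in> borel_measurable (PiM I (\<lambda>_. borel) \<Otimes>\<^sub>M PiM {..<d} (\<lambda>_. borel))"
  unfolding cost_def[abs_def]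
  by (intro borel_measurable_sum borel_measurable_power borel_measurable_diff Q_measurable) measurable

lemma cost_nonneg: "0 \<le> cost p" by (simp add: cost_def sum_nonneg)

lemma Q_rotate:
  assumes j: "j < d"
  shows "Q j (\<lambda>i\<in>I. c *\<^sub>R x i + s *\<^sub>R y i) = c\<^sup>2 * Q j x + c * s * inner_on I (T j x) y + s\<^sup>2 * Q j y"
proof -
  have "inner_on I (\<lambda>i. c *\<^sub>R x i + s *\<^sub>R y i) (T j (\<lambda>i\<in>I. c *\<^sub>R x i + s *\<^sub>R y i))
      = inner_on I (\<lambda>i. c *\<^sub>R x i + s *\<^sub>R y i) (\<lambda>i. c *\<^sub>R T j x i + s *\<^sub>R T j y i)"
    by (rule inner_on_cong) (simp_all add: T_linear[OF j])
  also have "\<dots> = c\<^sup>2 * inner_on I x (T j x) + 2 * c * s * inner_on I (T j x) y + s\<^sup>2 * inner_on I y (T j y)"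
    using T_symmetric[OF j, of x y] inner_on_commute[of I y "T j x"]
    by (simp add: inner_on_linear power2_eq_square algebra_simps)
  finally show ?thesis by (simp add: Q_def add_divide_distrib)
qed

lemma gauss_pair: "prob_pair (gauss_vec I :: ('i \<Rightarrow> 'a) measure) (gauss_vec {..<d} :: (nat \<Rightarrow> real) measure)"
  by (intro prob_pair.intro prob_space_gauss_vec)

lemma product_coupling:
  "(gauss_vec I \<Otimes>\<^sub>M gauss_vec {..<d}) \<in> gauss_couplings"
  by (simp add: joint_laws_def marginal_fst marginal_snd prob_space_gauss_vec)

lemma product_cost_finite:
  "(\<integral>\<^sup>+p. ennreal (cost p) \<partial>(gauss_vec I \<Otimes>\<^sub>M gauss_vec {..<d})) < \<infinity>"
proof -
  interpret GY: prob_pair "gauss_vec I :: ('i \<Rightarrow> 'a) measure" "gauss_vec {..<d} :: (nat \<Rightarrow> real) measure"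
    by (rule gauss_pair)
  have "integrable (gauss_vec I \<Otimes>\<^sub>M gauss_vec {..<d}) cost"
    unfolding cost_def[abs_def]
  proof (intro Bochner_Integration.integrable_sum)
    fix j assume "j \<in> {..<d}"
    then have "square_integrable (gauss_vec I \<Otimes>\<^sub>M gauss_vec {..<d}) (\<lambda>p. Q j (fst p) - snd p j)"
      using GY.square_fst[OF square_quadratic[folded Q_def]] GY.square_snd[OF square_coordinate_gauss]
      by (intro square_integrable_diff) auto
    then show "integrable (gauss_vec I \<Otimes>\<^sub>M gauss_vec {..<d}) (\<lambda>p. (Q j (fst p) - snd p j)\<^sup>2)"
      by (simp add: square_integrable_def)
  qed
  then show ?thesis
    by (simp add: nn_integral_eq_integral cost_nonneg)
qed

text \<open>
  Conditionally on the present state, the new discrepancy is a constant plus a multiple of the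
  displacement Z, which is linear in the fresh noise, plus a multiple of Q_j of the fresh noise. All
  cross terms vanish: Z and Q_j have mean 0, and their product has mean 0 because Z is odd and Q_j is
  even.
\<close>

lemma displacement_moment:
  fixes a :: "nat \<Rightarrow> 'i \<Rightarrow> 'a"
  assumes j: "j < d"
  defines "Z \<equiv> \<lambda>p. cayley_coupling I d a (fst p) (snd p) j - inner_on I (a j) (fst p)"
  shows "(\<integral>\<^sup>+p. ennreal ((u + q * Z p + r * Q j (fst p))\<^sup>2) \<partial>(gauss_vec I \<Otimes>\<^sub>M gauss_vec {..<d}))
    = ennreal (u\<^sup>2 + q\<^sup>2 * (\<Sum>k<d. \<Sum>l<d. cayley d (gram I a) j k * cayley d (gram I a) j l * (kdelta k l + gram I a k l)) + r\<^sup>2)"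
proof -
  interpret GY: prob_pair "gauss_vec I :: ('i \<Rightarrow> 'a) measure" "gauss_vec {..<d} :: (nat \<Rightarrow> real) measure"
    by (rule gauss_pair)
  let ?GY = "gauss_vec I \<Otimes>\<^sub>M gauss_vec {..<d} :: (('i \<Rightarrow> 'a) \<times> (nat \<Rightarrow> real)) measure"
  define W where "W = cayley d (gram I a)"
  define U where "U k p = inner_on I (a k) (fst p) + snd p k" for k and p :: "('i \<Rightarrow> 'a) \<times> (nat \<Rightarrow> real)"
  have Z: "Z = (\<lambda>p. \<Sum>k<d. W j k * U k p)"
    unfolding Z_def W_def U_def using cayley_coupling_diff[OF j] by blast
  note sqI = square_inner_on_gauss[OF finite_I] and sqY = square_coordinate_gauss
  note sq1 = GY.square_fst[OF sqI] and sq2 = GY.square_snd[OF sqY]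
  have sqU: "square_integrable ?GY (U k)" if "k < d" for k
    unfolding U_def[abs_def] using that by (intro square_integrable_add sq1 sq2)
  have sqQ0: "square_integrable (gauss_vec I) (Q j)"
    using square_quadratic[OF j] by (simp add: Q_def[abs_def])
  have sqQ: "square_integrable ?GY (\<lambda>p. Q j (fst p))" by (rule GY.square_fst[OF sqQ0])
  have EU: "(\<integral>p. U k p \<partial>?GY) = 0" if "k < d" for k
    unfolding U_def using that sq1 sq2
    by (subst Bochner_Integration.integral_add)
       (auto simp: GY.square_integrable_integrable GY.expectation_fst[OF square_integrable_measurable[OF sqI]]
          GY.expectation_snd[OF square_integrable_measurable[OF sqY]] mean_inner_on_gauss[OF finite_I] mean_coordinate_gauss)
  have cross: "(\<integral>p. f (fst p) * snd p k \<partial>?GY) = 0" if "square_integrable (gauss_vec I) f" "k < d" for f k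
    using GY.expectation_mult[OF that(1) sqY[OF that(2)]] mean_coordinate_gauss[OF that(2)] by simp
  have EUU: "(\<integral>p. U k p * U l p \<partial>?GY) = kdelta k l + gram I a k l" if "k < d" "l < d" for k l
  proof -
    have "(\<integral>p. U k p * U l p \<partial>?GY) = (\<integral>p. inner_on I (a k) (fst p) * inner_on I (a l) (fst p)
        + inner_on I (a k) (fst p) * snd p l + inner_on I (a l) (fst p) * snd p k + snd p k * snd p l \<partial>?GY)"
      by (simp add: U_def algebra_simps)
    also have "\<dots> = (\<integral>p. inner_on I (a k) (fst p) * inner_on I (a l) (fst p) \<partial>?GY)
        + (\<integral>p. inner_on I (a k) (fst p) * snd p l \<partial>?GY)
        + (\<integral>p. inner_on I (a l) (fst p) * snd p k \<partial>?GY) + (\<integral>p. snd p k * snd p l \<partial>?GY)"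
      using that sq1 sq2 by (simp add: square_integrable_mult)
    also have "\<dots> = gram I a k l + 0 + 0 + kdelta k l"
      unfolding cross[OF sqI that(2)] cross[OF sqI that(1)]
      using that sqI sqY
      by (simp add: GY.expectation_fst[of "\<lambda>x. inner_on I (a k) x * inner_on I (a l) x"]
          GY.expectation_snd[of "\<lambda>y. y k * y l"] square_integrable_measurable
          covariance_inner_on_gauss[OF finite_I] covariance_coordinates_gauss gram_def)
    finally show ?thesis by simp
  qed
  have EUQ: "(\<integral>p. U k p * Q j (fst p) \<partial>?GY) = 0" if "k < d" for k
  proof -
    have odd: "(\<integral>x. inner_on I (a k) x * Q j x \<partial>gauss_vec I) = 0"
    proof (rule integral_gauss_vec_odd[OF finite_I])
      have "(\<lambda>x. Q j x) \<in> borel_measurable (PiM I (\<lambda>_. borel))" by (rule Q_measurable[OF j]) measurable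
      then show "(\<lambda>x. inner_on I (a k) x * Q j x) \<in> borel_measurable (PiM I (\<lambda>_. borel))"
        by measurable
      fix x
      have "Q j (\<lambda>i\<in>I. - x i) = Q j x" using Q_rotate[OF j, of "-1" x 0 x] by simp
      moreover have "inner_on I (a k) (\<lambda>i\<in>I. - x i) = - inner_on I (a k) x"
        by (simp add: inner_on_def sum_negf)
      ultimately show "inner_on I (a k) (\<lambda>i\<in>I. - x i) * Q j (\<lambda>i\<in>I. - x i) = - (inner_on I (a k) x * Q j x)" by simp
    qed
    have "(\<integral>p. U k p * Q j (fst p) \<partial>?GY)
       = (\<integral>p. inner_on I (a k) (fst p) * Q j (fst p) + Q j (fst p) * snd p k \<partial>?GY)"
      by (simp add: U_def algebra_simps)
    also have "\<dots> = (\<integral>p. inner_on I (a k) (fst p) * Q j (fst p) \<partial>?GY) + (\<integral>p. Q j (fst p) * snd p k \<partial>?GY)"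
      using that sq1 sq2 sqQ by (simp add: square_integrable_mult)
    also have "\<dots> = 0"
      unfolding cross[OF sqQ0 that]
      using GY.expectation_fst[of "\<lambda>x. inner_on I (a k) x * Q j x"] odd
        square_integrable_measurable[OF sqI] square_integrable_measurable[OF sqQ0]
      by (simp add: borel_measurable_times)
    finally show ?thesis .
  qed
  have sqZ: "square_integrable ?GY Z"
    unfolding Z by (intro square_integrable_sum square_integrable_cmult sqU) auto
  have EZ: "(\<integral>p. Z p \<partial>?GY) = 0"
    unfolding Z by (subst Bochner_Integration.integral_sum) (auto simp: EU sqU GY.square_integrable_integrable)
  have EZQ: "(\<integral>p. Z p * Q j (fst p) \<partial>?GY) = 0"
    unfolding Z sum_distrib_right mult.assoc
    by (subst Bochner_Integration.integral_sum) (auto simp: EUQ sqU sqQ square_integrable_mult)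
  have EZZ: "(\<integral>p. (Z p)\<^sup>2 \<partial>?GY) = (\<Sum>k<d. \<Sum>l<d. W j k * W j l * (kdelta k l + gram I a k l))"
  proof -
    have "(\<integral>p. (Z p)\<^sup>2 \<partial>?GY) = (\<integral>p. (\<Sum>k<d. \<Sum>l<d. W j k * W j l * (U k p * U l p)) \<partial>?GY)"
      unfolding Z power2_eq_square sum_product by (simp add: mult_ac)
    also have "\<dots> = (\<Sum>k<d. \<Sum>l<d. W j k * W j l * (\<integral>p. U k p * U l p \<partial>?GY))"
    proof -
      have int: "integrable ?GY (\<lambda>p. W j k * W j l * (U k p * U l p))" if "k < d" "l < d" for k l
        using square_integrable_mult[OF sqU sqU, OF that] by simp
      have "(\<integral>p. (\<Sum>k<d. \<Sum>l<d. W j k * W j l * (U k p * U l p)) \<partial>?GY)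
          = (\<Sum>k<d. \<integral>p. (\<Sum>l<d. W j k * W j l * (U k p * U l p)) \<partial>?GY)"
        by (rule Bochner_Integration.integral_sum, rule Bochner_Integration.integrable_sum, rule int) auto
      also have "\<dots> = (\<Sum>k<d. \<Sum>l<d. \<integral>p. W j k * W j l * (U k p * U l p) \<partial>?GY)"
        by (intro sum.cong refl Bochner_Integration.integral_sum int) auto
      finally show ?thesis by simp
    qed
    finally show ?thesis by (simp add: EUU)
  qed
  have EQ: "(\<integral>p. Q j (fst p) \<partial>?GY) = 0" "(\<integral>p. (Q j (fst p))\<^sup>2 \<partial>?GY) = 1"
  proof -
    have "(\<integral>x. Q j x \<partial>gauss_vec I) = 0" "(\<integral>x. (Q j x)\<^sup>2 \<partial>gauss_vec I) = 1"
      using mean_quadratic[OF j] variance_quadratic[OF j] by (auto simp: Q_def)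
    moreover have "Q j \<in> borel_measurable (gauss_vec I)" by (rule square_integrable_measurable[OF sqQ0])
    ultimately show "(\<integral>p. Q j (fst p) \<partial>?GY) = 0" "(\<integral>p. (Q j (fst p))\<^sup>2 \<partial>?GY) = 1"
      using GY.expectation_fst[of "Q j"] GY.expectation_fst[OF borel_measurable_power[of "Q j" _ 2]] by auto
  qed
  have "(\<integral>\<^sup>+p. ennreal ((u + q * Z p + r * Q j (fst p))\<^sup>2) \<partial>?GY)
     = ennreal (\<integral>p. (u + q * Z p + r * Q j (fst p))\<^sup>2 \<partial>?GY)"
    by (rule nn_integral_square)
       (intro square_integrable_add square_integrable_cmult sqZ sqQ GY.square_integrable_const)
  also have "\<dots> = ennreal (u\<^sup>2 + q\<^sup>2 * (\<integral>p. (Z p)\<^sup>2 \<partial>?GY) + r\<^sup>2 * 1)"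
    by (subst GY.expectation_square_three[OF sqZ sqQ EZ EQ(1) EZQ]) (simp add: EQ)
  finally show ?thesis by (simp add: EZZ W_def)
qed


text \<open>
  One rotation step. The linear term c s <T_j x, \<xi>> of Q_j(x') is written as e <a_j, \<xi>> with
  e = sqrt (1 - c^4), so that \<psi> may replace <a_j, \<xi>>; then y' has variance c^4 + e^2 = 1. The Gram
  matrix of the a_j is \<beta> = 2 c^2 / (1 + c^2) times the Stein kernel, and as \<beta> is within s^2 of 1,
  convexity of the square bounds its distance from the identity by that of the Stein kernel up to
  s^2 d.
\<close>

lemma coupling_step:
  assumes \<pi>: "\<pi> \<in> gauss_couplings" and c: "0 < c" and s: "0 < s" and cs: "c\<^sup>2 + s\<^sup>2 = 1"
  shows "\<exists>\<pi>'\<in>gauss_couplings. (\<integral>\<^sup>+p. ennreal (cost p) \<partial>\<pi>')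
      \<le> ennreal (c ^ 4) * (\<integral>\<^sup>+p. ennreal (cost p) \<partial>\<pi>)
        + ennreal ((1 - c ^ 4) * (stein_discrepancy + s\<^sup>2 * d) + s ^ 4 * d)"
proof -
  have c1: "c\<^sup>2 < 1" using s cs by (smt (verit) zero_less_power)
  have c4: "c ^ 4 < 1" using c1 c power_strict_mono[of "c\<^sup>2" 1 2] by (simp flip: power_mult)
  \<comment> \<open>chosen such that c^2 y + e \<psi> has unit variance\<close>
  define e where "e = sqrt (1 - c ^ 4)"
  have e: "0 < e" and e2: "e\<^sup>2 = 1 - c ^ 4" using c4 by (auto simp: e_def)
  have e2': "e\<^sup>2 = s\<^sup>2 * (1 + c\<^sup>2)"
  proof -
    have "1 - c ^ 4 = (1 - c\<^sup>2) * (1 + c\<^sup>2)" by (simp add: algebra_simps power2_eq_square power4_eq_xxxx)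
    moreover have "1 - c\<^sup>2 = s\<^sup>2" using cs by simp
    ultimately show ?thesis by (simp add: e2)
  qed
  define \<alpha> where "\<alpha> = c * s / e"
  have \<alpha>: "e * \<alpha> = c * s" using e by (simp add: \<alpha>_def)
  \<comment> \<open>the Gram matrix of the vectors A x j below is \<beta> times the Stein kernel\<close>
  define \<beta> where "\<beta> = 2 * \<alpha>\<^sup>2"
  have \<beta>_eq: "\<beta> * (1 + c\<^sup>2) = 2 * c\<^sup>2"
  proof -
    have cancel: "2 * (u * v / (v * t)) * t = 2 * u" if "v \<noteq> 0" "t \<noteq> 0" for u v t :: real
      using that by simp
    have "1 + c\<^sup>2 \<noteq> 0" by (smt (verit) zero_le_power2)
    then show ?thesis
      unfolding \<beta>_def \<alpha>_def power_divide power_mult_distrib e2' using s by (intro cancel) auto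
  qed
  have \<beta>_le: "\<beta> \<le> 1" and \<beta>_nonneg: "0 \<le> \<beta>" and \<beta>_ge: "1 - \<beta> \<le> s\<^sup>2"
  proof -
    show "0 \<le> \<beta>" by (simp add: \<beta>_def)
    have *: "(1 - \<beta>) * (1 + c\<^sup>2) = s\<^sup>2" using \<beta>_eq cs by (simp add: algebra_simps)
    have "0 \<le> 1 - \<beta>"
    proof -
      have "0 < 1 + c\<^sup>2" by (smt (verit) zero_le_power2)
      then have "1 - \<beta> = s\<^sup>2 / (1 + c\<^sup>2)" using * by (simp add: eq_divide_eq)
      then show ?thesis using \<open>0 < 1 + c\<^sup>2\<close> by simp
    qed
    then show "\<beta> \<le> 1" by simp
    have "(1 - \<beta>) * 1 \<le> (1 - \<beta>) * (1 + c\<^sup>2)" using \<open>0 \<le> 1 - \<beta>\<close> by (intro mult_left_mono) auto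
    then show "1 - \<beta> \<le> s\<^sup>2" using * by simp
  qed
  interpret GY: prob_pair "gauss_vec I :: ('i \<Rightarrow> 'a) measure" "gauss_vec {..<d} :: (nat \<Rightarrow> real) measure"
    by (rule gauss_pair)
  let ?G = "gauss_vec I :: ('i \<Rightarrow> 'a) measure" and ?Y = "gauss_vec {..<d} :: (nat \<Rightarrow> real) measure"
  let ?GY = "?G \<Otimes>\<^sub>M ?Y"
  let ?B = "PiM I (\<lambda>_. borel) :: ('i \<Rightarrow> 'a) measure" and ?R = "PiM {..<d} (\<lambda>_. borel) :: (nat \<Rightarrow> real) measure"
  have sets_\<pi> [measurable_cong]: "sets \<pi> = sets (?B \<Otimes>\<^sub>M ?R)"
    using \<pi> by (simp add: joint_laws_def cong: sets_pair_measure_cong)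
  have sets_GY [measurable_cong]: "sets ?GY = sets (?B \<Otimes>\<^sub>M ?R)"
    by (intro sets_pair_measure_cong) simp_all
  have space_\<pi>: "fst p \<in> space ?B" "snd p \<in> space ?R" if "p \<in> space \<pi>" for p
    using that unfolding sets_eq_imp_space_eq[OF sets_\<pi>] space_pair_measure by (simp_all only: mem_Times_iff)
  have to_GY: "h \<in> borel_measurable ?GY" if "h \<in> borel_measurable (?B \<Otimes>\<^sub>M ?R)" for h :: "_ \<Rightarrow> ennreal"
    using that by (simp only: measurable_cong_sets[OF sets_GY refl])
  define A where "A x k i = \<alpha> *\<^sub>R T k x i" for x :: "'i \<Rightarrow> 'a" and k i
  \<comment> \<open>the two components of the update (x, y) \<mapsto> (x', y')\<close>
  define step1 where "step1 x \<xi> = (\<lambda>i\<in>I. c *\<^sub>R x i + s *\<^sub>R \<xi> i)" for x \<xi> :: "'i \<Rightarrow> 'a"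
  define step2 where "step2 y \<psi> = (\<lambda>j\<in>{..<d}. c\<^sup>2 *\<^sub>R y j + e *\<^sub>R \<psi> j)" for y \<psi> :: "nat \<Rightarrow> real"
  define C where "C x q = cayley_coupling I d (A x) (fst q) (snd q)" for x q
  define step where "step w = (step1 (fst (fst w)) (fst (snd w)), step2 (snd (fst w)) (C (fst (fst w)) (snd w)))"
    for w :: "(('i \<Rightarrow> 'a) \<times> (nat \<Rightarrow> real)) \<times> (('i \<Rightarrow> 'a) \<times> (nat \<Rightarrow> real))"
  have C_meas [measurable (raw)]: "(\<lambda>w. C (f w) (g w)) \<in> M \<rightarrow>\<^sub>M ?R"
    if [measurable]: "f \<in> M \<rightarrow>\<^sub>M ?B" "g \<in> M \<rightarrow>\<^sub>M ?B \<Otimes>\<^sub>M ?R" for f g and M :: "'z measure"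
  proof (rule measurable_PiM_single')
    fix j assume j: "j \<in> {..<d}"
    show "(\<lambda>w. C (f w) (g w) j) \<in> borel_measurable M"
      unfolding C_def
    proof (rule cayley_coupling_measurable)
      show "(\<lambda>w. A (f w) k i) \<in> borel_measurable M" if "k < d" "i \<in> I" for k i
        unfolding A_def using T_component_measurable[OF that, of f M] by measurable
    qed (measurable, use j in simp)
  next
    show "(\<lambda>w. C (f w) (g w)) \<in> space M \<rightarrow> (\<Pi>\<^sub>E i\<in>{..<d}. space borel)"
      by (auto simp: C_def cayley_coupling_def)
  qed
  have [measurable]: "(\<lambda>w. step1 (f w) (g w)) \<in> M \<rightarrow>\<^sub>M ?B"
    if [measurable]: "f \<in> M \<rightarrow>\<^sub>M ?B" "g \<in> M \<rightarrow>\<^sub>M ?B" for f g and M :: "'z measure"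
    unfolding step1_def by measurable
  have [measurable]: "(\<lambda>w. step2 (f w) (g w)) \<in> M \<rightarrow>\<^sub>M ?R"
    if [measurable]: "f \<in> M \<rightarrow>\<^sub>M ?R" "g \<in> M \<rightarrow>\<^sub>M ?R" for f g and M :: "'z measure"
    unfolding step2_def by measurable
  have step_meas [measurable]: "step \<in> (?B \<Otimes>\<^sub>M ?R) \<Otimes>\<^sub>M (?B \<Otimes>\<^sub>M ?R) \<rightarrow>\<^sub>M ?B \<Otimes>\<^sub>M ?R"
    unfolding step_def[abs_def] by measurable
  have step_meas': "step \<in> \<pi> \<Otimes>\<^sub>M ?GY \<rightarrow>\<^sub>M ?GY"
    using step_meas by (simp add: measurable_cong_sets[OF sets_pair_measure_cong[OF sets_\<pi> sets_GY] sets_GY])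
  define \<pi>' where "\<pi>' = distr (\<pi> \<Otimes>\<^sub>M ?GY) ?GY step"
  have sets_\<pi>' [measurable_cong]: "sets \<pi>' = sets (?B \<Otimes>\<^sub>M ?R)"
    by (simp add: \<pi>'_def sets_GY)
  have int\<pi>': "(\<integral>\<^sup>+w. h w \<partial>\<pi>') = (\<integral>\<^sup>+p. \<integral>\<^sup>+q. h (step (p, q)) \<partial>?GY \<partial>\<pi>)"
    if h: "h \<in> borel_measurable (?B \<Otimes>\<^sub>M ?R)" for h
  proof -
    have h': "h \<in> borel_measurable ?GY" using h by (simp add: measurable_cong_sets[OF sets_GY refl])
    have "(\<integral>\<^sup>+w. h w \<partial>\<pi>') = (\<integral>\<^sup>+w. h (step w) \<partial>(\<pi> \<Otimes>\<^sub>M ?GY))"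
      unfolding \<pi>'_def by (rule nn_integral_distr[OF step_meas']) (use h' in simp)
    also have "\<dots> = (\<integral>\<^sup>+p. \<integral>\<^sup>+q. h (step (p, q)) \<partial>?GY \<partial>\<pi>)"
      by (rule GY.nn_integral_fst[symmetric]) (rule measurable_compose[OF step_meas' h'])
    finally show ?thesis .
  qed
  \<comment> \<open>The first marginal is preserved by rotation invariance. The second one is preserved because C x is
    a standard Gaussian vector for every fixed x.\<close>
  have m1: "distr \<pi>' ?G fst = ?G"
  proof (rule distr_eqI_nn_integral)
    fix f :: "_ \<Rightarrow> ennreal" assume "f \<in> borel_measurable ?G"
    then have f [measurable]: "f \<in> borel_measurable ?B" by (simp add: measurable_cong_sets[OF sets_gauss_vec refl])
    have "(\<integral>\<^sup>+w. f (fst w) \<partial>\<pi>') = (\<integral>\<^sup>+p. \<integral>\<^sup>+q. f (step1 (fst p) (fst q)) \<partial>?GY \<partial>\<pi>)"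
      by (subst int\<pi>') (auto simp: step_def)
    also have "\<dots> = (\<integral>\<^sup>+p. \<integral>\<^sup>+\<xi>. f (step1 (fst p) \<xi>) \<partial>?G \<partial>\<pi>)"
    proof (rule nn_integral_cong)
      fix p assume p: "p \<in> space \<pi>"
      have [measurable]: "fst p \<in> space ?B" by (rule space_\<pi>[OF p])
      have "(\<integral>\<^sup>+q. f (step1 (fst p) (fst q)) \<partial>?GY) = (\<integral>\<^sup>+\<xi>. f (step1 (fst p) \<xi>) \<partial>distr ?GY ?G fst)"
        by (subst nn_integral_distr) auto
      then show "(\<integral>\<^sup>+q. f (step1 (fst p) (fst q)) \<partial>?GY) = (\<integral>\<^sup>+\<xi>. f (step1 (fst p) \<xi>) \<partial>?G)"
        by (simp add: marginal_fst prob_space_gauss_vec)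
    qed
    also have "\<dots> = (\<integral>\<^sup>+x. \<integral>\<^sup>+\<xi>. f (step1 x \<xi>) \<partial>?G \<partial>?G)"
      by (rule joint_law_nn_integral(1)[OF \<pi>]) measurable
    also have "\<dots> = (\<integral>\<^sup>+x. f x \<partial>?G)"
      unfolding step1_def by (rule nn_integral_gauss_vec_rotate[OF finite_I c cs f])
    finally show "(\<integral>\<^sup>+w. f (fst w) \<partial>\<pi>') = (\<integral>\<^sup>+x. f x \<partial>?G)" .
  qed measurable
  have m2: "distr \<pi>' ?Y snd = ?Y"
  proof (rule distr_eqI_nn_integral)
    fix f :: "_ \<Rightarrow> ennreal" assume "f \<in> borel_measurable ?Y"
    then have f [measurable]: "f \<in> borel_measurable ?R" by (simp add: measurable_cong_sets[OF sets_gauss_vec refl])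
    have "(\<integral>\<^sup>+w. f (snd w) \<partial>\<pi>') = (\<integral>\<^sup>+p. \<integral>\<^sup>+q. f (step2 (snd p) (C (fst p) q)) \<partial>?GY \<partial>\<pi>)"
      by (subst int\<pi>') (auto simp: step_def)
    also have "\<dots> = (\<integral>\<^sup>+p. \<integral>\<^sup>+\<psi>. f (step2 (snd p) \<psi>) \<partial>?Y \<partial>\<pi>)"
    proof (rule nn_integral_cong)
      fix p assume p: "p \<in> space \<pi>"
      note space_\<pi>[OF p, measurable]
      have "(\<integral>\<^sup>+q. f (step2 (snd p) (C (fst p) q)) \<partial>?GY) = (\<integral>\<^sup>+\<xi>. \<integral>\<^sup>+\<eta>. f (step2 (snd p) (C (fst p) (\<xi>, \<eta>))) \<partial>?Y \<partial>?G)"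
        by (rule GY.N.nn_integral_fst[symmetric], rule to_GY) measurable
      also have "\<dots> = (\<integral>\<^sup>+\<psi>. f (step2 (snd p) \<psi>) \<partial>?Y)"
        unfolding C_def fst_conv snd_conv by (rule nn_integral_cayley_coupling[OF finite_I]) simp
      finally show "(\<integral>\<^sup>+q. f (step2 (snd p) (C (fst p) q)) \<partial>?GY) = (\<integral>\<^sup>+\<psi>. f (step2 (snd p) \<psi>) \<partial>?Y)" .
    qed
    also have "\<dots> = (\<integral>\<^sup>+y. \<integral>\<^sup>+\<psi>. f (step2 y \<psi>) \<partial>?Y \<partial>?Y)"
      by (rule joint_law_nn_integral(2)[OF \<pi>]) measurable
    also have "\<dots> = (\<integral>\<^sup>+y. f y \<partial>?Y)"
      unfolding step2_def
      by (rule nn_integral_gauss_vec_rotate[OF finite_lessThan _ _ f]) (use c e2 in \<open>auto simp flip: power_mult\<close>)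
    finally show "(\<integral>\<^sup>+w. f (snd w) \<partial>\<pi>') = (\<integral>\<^sup>+y. f y \<partial>?Y)" .
  qed measurable
  have \<pi>'_in: "\<pi>' \<in> gauss_couplings"
    using m1 m2 by (simp add: joint_laws_def \<pi>'_def)
  define F where "F x = (\<Sum>j<d. \<Sum>k<d. (stein_kernel j k x - kdelta j k)\<^sup>2)" for x
  have F_nonneg: "0 \<le> F x" for x by (simp add: F_def sum_nonneg)
  have sqF: "square_integrable ?G (\<lambda>x. stein_kernel j k x - kdelta j k)" if "j < d" "k < d" for j k
    by (intro square_integrable_diff square_gradient[folded stein_kernel_def] that GY.M.square_integrable_const)
  have intF: "(\<integral>\<^sup>+x. ennreal (F x) \<partial>?G) = ennreal stein_discrepancy"
  proof -
    have int: "integrable ?G (\<lambda>x. (stein_kernel j k x - kdelta j k)\<^sup>2)" if "j < d" "k < d" for j k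
      using sqF[OF that] by (simp add: square_integrable_def)
    have intg: "integrable ?G F"
      unfolding F_def[abs_def] by (intro Bochner_Integration.integrable_sum int) auto
    have "(\<integral>x. F x \<partial>?G) = (\<Sum>j<d. \<integral>x. (\<Sum>k<d. (stein_kernel j k x - kdelta j k)\<^sup>2) \<partial>?G)"
      unfolding F_def by (intro Bochner_Integration.integral_sum Bochner_Integration.integrable_sum int) auto
    also have "\<dots> = stein_discrepancy"
      unfolding stein_discrepancy_def by (intro sum.cong refl Bochner_Integration.integral_sum int) auto
    finally show ?thesis using nn_integral_eq_integral[OF intg] F_nonneg by simp
  qed
  have F_meas [measurable]: "F \<in> borel_measurable ?B"
    unfolding F_def[abs_def]
  proof (intro borel_measurable_sum borel_measurable_power)
    fix j k assume "j \<in> {..<d}" "k \<in> {..<d}"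
    then have "(\<lambda>x. stein_kernel j k x - kdelta j k) \<in> borel_measurable ?G"
      by (intro square_integrable_measurable[OF sqF]) auto
    then show "(\<lambda>x. stein_kernel j k x - kdelta j k) \<in> borel_measurable ?B"
      by (simp only: measurable_cong_sets[OF sets_gauss_vec refl])
  qed
  have gram_bound: "(\<Sum>j<d. \<Sum>k<d. (kdelta j k - gram I (A x) j k)\<^sup>2) \<le> F x + s\<^sup>2 * d" for x
  proof -
    have "(kdelta j k - gram I (A x) j k)\<^sup>2 \<le> (stein_kernel j k x - kdelta j k)\<^sup>2 + s\<^sup>2 * kdelta j k" for j k
    proof -
      define t where "t = stein_kernel j k x"
      have g: "gram I (A x) j k = \<beta> * t"
        unfolding gram_def A_def inner_on_linear t_def \<beta>_def stein_kernel_def by (simp add: power2_eq_square)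
      have k: "(kdelta j k)\<^sup>2 = kdelta j k" by (simp add: kdelta_def)
      have "(kdelta j k - \<beta> * t)\<^sup>2 = \<beta> * (t - kdelta j k)\<^sup>2 + (1 - \<beta>) * (kdelta j k)\<^sup>2 - \<beta> * (1 - \<beta>) * t\<^sup>2"
        by (simp add: power2_eq_square algebra_simps)
      also have "\<dots> \<le> 1 * (t - kdelta j k)\<^sup>2 + s\<^sup>2 * (kdelta j k)\<^sup>2 - 0"
        by (intro diff_mono add_mono mult_right_mono mult_nonneg_nonneg \<beta>_le \<beta>_ge \<beta>_nonneg) (use \<beta>_le in auto)
      finally show ?thesis unfolding g t_def[symmetric] by (simp add: k)
    qed
    then have "(\<Sum>j<d. \<Sum>k<d. (kdelta j k - gram I (A x) j k)\<^sup>2)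
      \<le> (\<Sum>j<d. \<Sum>k<d. (stein_kernel j k x - kdelta j k)\<^sup>2 + s\<^sup>2 * kdelta j k)"
      by (intro sum_mono)
    also have "\<dots> = F x + s\<^sup>2 * (\<Sum>j<d. \<Sum>k<d. kdelta j k * 1)"
      by (simp add: F_def sum.distrib sum_distrib_left)
    also have "(\<Sum>j<d. \<Sum>k<d. kdelta j k * 1) = (\<Sum>j<d. 1)"
      by (intro sum.cong refl sum_kdelta(1)) simp
    finally show ?thesis by simp
  qed
  have step_cost: "(\<integral>\<^sup>+q. ennreal (cost (step (p, q))) \<partial>?GY)
      \<le> ennreal (c ^ 4 * cost p + e\<^sup>2 * (F (fst p) + s\<^sup>2 * d) + s ^ 4 * d)"
    if p: "p \<in> space \<pi>" for p
  proof -
    note space_\<pi>[OF p, measurable]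
    define Z where "Z j q = cayley_coupling I d (A (fst p)) (fst q) (snd q) j - inner_on I (A (fst p) j) (fst q)" for j q
    \<comment> \<open>the three parts of the new discrepancy between Q_j(x') and y'_j\<close>
    define D where "D j q = c\<^sup>2 * (Q j (fst p) - snd p j) + (- e) * Z j q + s\<^sup>2 * Q j (fst q)" for j q
    define W where "W = cayley d (gram I (A (fst p)))"
    define K where "K j = (\<Sum>k<d. \<Sum>l<d. W j k * W j l * (kdelta k l + gram I (A (fst p)) k l))" for j
    have D: "Q j (fst (step (p, q))) - snd (step (p, q)) j = D j q" if j: "j < d" for j q
    proof -
      have "c * s * inner_on I (T j (fst p)) (fst q) = e * inner_on I (A (fst p) j) (fst q)"
        unfolding A_def inner_on_linear using \<alpha> by (simp add: mult.assoc[symmetric])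
      then show ?thesis
        using j unfolding step_def step1_def step2_def D_def Z_def C_def
        by (simp add: Q_rotate[OF j] algebra_simps)
    qed
    have D_meas: "(\<lambda>q. ennreal ((D j q)\<^sup>2)) \<in> borel_measurable ?GY" if j: "j < d" for j
    proof -
      have [measurable]: "(\<lambda>q. Q j (fst q)) \<in> borel_measurable (?B \<Otimes>\<^sub>M ?R)"
        by (rule Q_measurable[OF j]) measurable
      have C: "(\<lambda>q. C (fst p) q) \<in> ?B \<Otimes>\<^sub>M ?R \<rightarrow>\<^sub>M ?R" by measurable
      have "(\<lambda>q. C (fst p) q j) \<in> borel_measurable (?B \<Otimes>\<^sub>M ?R)"
        using measurable_compose[OF C measurable_component_singleton[of j "{..<d}"]] j by simp
      then have [measurable]: "(\<lambda>q. cayley_coupling I d (A (fst p)) (fst q) (snd q) j) \<in> borel_measurable (?B \<Otimes>\<^sub>M ?R)"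
        by (simp add: C_def)
      show ?thesis unfolding D_def Z_def by measurable
    qed
    have "(\<integral>\<^sup>+q. ennreal (cost (step (p, q))) \<partial>?GY) = (\<integral>\<^sup>+q. (\<Sum>j<d. ennreal ((D j q)\<^sup>2)) \<partial>?GY)"
      by (simp add: cost_def D)
    also have "\<dots> = (\<Sum>j<d. \<integral>\<^sup>+q. ennreal ((D j q)\<^sup>2) \<partial>?GY)"
      using D_meas by (intro nn_integral_sum) auto
    also have "\<dots> = (\<Sum>j<d. ennreal ((c\<^sup>2 * (Q j (fst p) - snd p j))\<^sup>2 + (- e)\<^sup>2 * K j + (s\<^sup>2)\<^sup>2))"
      unfolding D_def Z_def K_def W_def by (intro sum.cong refl displacement_moment) auto
    also have "\<dots> = ennreal (\<Sum>j<d. (c\<^sup>2 * (Q j (fst p) - snd p j))\<^sup>2 + (- e)\<^sup>2 * K j + (s\<^sup>2)\<^sup>2)"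
    proof (rule sum_ennreal)
      fix j
      have "0 \<le> K j"
      proof -
        have "K j = (\<Sum>k<d. (W j k)\<^sup>2) + (\<Sum>k<d. \<Sum>l<d. W j k * gram I (A (fst p)) k l * W j l)"
          by (simp add: K_def distrib_left sum.distrib power2_eq_square mult_ac flip: sum_distrib_left)
        then show ?thesis using gram_psd_nonneg[of "W j" I "A (fst p)" d] by (simp add: sum_nonneg)
      qed
      then show "0 \<le> (c\<^sup>2 * (Q j (fst p) - snd p j))\<^sup>2 + (- e)\<^sup>2 * K j + (s\<^sup>2)\<^sup>2" by simp
    qed
    also have "\<dots> \<le> ennreal (c ^ 4 * cost p + e\<^sup>2 * (F (fst p) + s\<^sup>2 * d) + s ^ 4 * d)"
    proof (rule ennreal_leI)
      have "(\<Sum>j<d. K j) \<le> F (fst p) + s\<^sup>2 * d"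
        unfolding K_def W_def
        using cayley_cost[OF gram_psd_nonneg[of _ I "A (fst p)" d]] gram_bound[of "fst p"] by (rule order_trans)
      then have "e\<^sup>2 * (\<Sum>j<d. K j) \<le> e\<^sup>2 * (F (fst p) + s\<^sup>2 * d)" by (intro mult_left_mono) auto
      moreover have "(\<Sum>j<d. (c\<^sup>2 * (Q j (fst p) - snd p j))\<^sup>2) = c ^ 4 * cost p"
        by (simp add: cost_def power_mult_distrib sum_distrib_left flip: power_mult)
      ultimately show "(\<Sum>j<d. (c\<^sup>2 * (Q j (fst p) - snd p j))\<^sup>2 + (- e)\<^sup>2 * K j + (s\<^sup>2)\<^sup>2)
         \<le> c ^ 4 * cost p + e\<^sup>2 * (F (fst p) + s\<^sup>2 * d) + s ^ 4 * d"
        by (simp add: sum.distrib sum_distrib_left flip: power_mult)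
    qed
    finally show ?thesis .
  qed
  have "(\<integral>\<^sup>+p. ennreal (cost p) \<partial>\<pi>') \<le> (\<integral>\<^sup>+p. ennreal (c ^ 4 * cost p + e\<^sup>2 * (F (fst p) + s\<^sup>2 * d) + s ^ 4 * d) \<partial>\<pi>)"
    by (subst int\<pi>') (auto intro!: nn_integral_mono step_cost)
  also have "\<dots> = (\<integral>\<^sup>+p. ennreal (c ^ 4) * ennreal (cost p) + (ennreal (e\<^sup>2) * ennreal (F (fst p)) + ennreal (e\<^sup>2 * (s\<^sup>2 * d) + s ^ 4 * d)) \<partial>\<pi>)"
    using c by (intro nn_integral_cong)
      (simp add: cost_nonneg F_nonneg algebra_simps flip: ennreal_mult ennreal_plus)
  also have "\<dots> = ennreal (c ^ 4) * (\<integral>\<^sup>+p. ennreal (cost p) \<partial>\<pi>)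
     + (ennreal (e\<^sup>2) * (\<integral>\<^sup>+p. ennreal (F (fst p)) \<partial>\<pi>) + ennreal (e\<^sup>2 * (s\<^sup>2 * d) + s ^ 4 * d))"
  proof -
    interpret P: prob_space \<pi> by (rule joint_law_prob_space[OF \<pi> prob_space_gauss_vec])
    show ?thesis
      by (simp add: nn_integral_add nn_integral_cmult P.emeasure_space_1)
  qed
  also have "(\<integral>\<^sup>+p. ennreal (F (fst p)) \<partial>\<pi>) = ennreal stein_discrepancy"
    using joint_law_nn_integral(1)[OF \<pi>, of "\<lambda>x. ennreal (F x)"] intF by simp
  also have "ennreal (e\<^sup>2) * ennreal stein_discrepancy + ennreal (e\<^sup>2 * (s\<^sup>2 * d) + s ^ 4 * d)
      = ennreal ((1 - c ^ 4) * (stein_discrepancy + s\<^sup>2 * d) + s ^ 4 * d)"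
  proof -
    have "ennreal (e\<^sup>2) * ennreal stein_discrepancy + ennreal (e\<^sup>2 * (s\<^sup>2 * d) + s ^ 4 * d)
      = ennreal (e\<^sup>2 * stein_discrepancy + (e\<^sup>2 * (s\<^sup>2 * d) + s ^ 4 * d))"
      using stein_discrepancy_nonneg by (simp flip: ennreal_mult)
    then show ?thesis by (simp add: e2 algebra_simps)
  qed
  finally show ?thesis using \<pi>'_in by blast
qed

text \<open>
  Let r be the infimal cost, which is finite because of the product law. Applying the step to a
  coupling of cost at most r + s^4 gives
  (1 - c^4) r \<le> (1 - c^4) (V + s^2 d) + O(s^4), and 1 - c^4 \<ge> s^2, so r \<le> V + O(s^2).
\<close>

theorem near_optimal_coupling:
  assumes \<epsilon>: "0 < \<epsilon>"
  shows "\<exists>\<pi>\<in>gauss_couplings. (\<integral>\<^sup>+p. ennreal (cost p) \<partial>\<pi>) \<le> ennreal (stein_discrepancy + \<epsilon>)"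
proof -
  define w where "w = (INF \<pi>\<in>gauss_couplings. \<integral>\<^sup>+p. ennreal (cost p) \<partial>\<pi>)"
  have "w < \<infinity>"
    unfolding w_def using product_coupling product_cost_finite by (meson INF_lower le_less_trans)
  then obtain r where r: "w = ennreal r" "0 \<le> r" by (cases w) auto
  have bound: "r \<le> stein_discrepancy + s\<^sup>2 * (2 * d + 1)" if s: "0 < s" "s < 1" for s :: real
  proof -
    define c where "c = sqrt (1 - s\<^sup>2)"
    have s2: "s\<^sup>2 < 1" "0 < s\<^sup>2" using s by (auto simp: power_less_one_iff)
    then have c: "0 < c" and c2: "c\<^sup>2 = 1 - s\<^sup>2" by (auto simp: c_def)
    have c4: "1 - c ^ 4 = s\<^sup>2 * (1 + c\<^sup>2)"
    proof -
      have "1 - c ^ 4 = (1 - c\<^sup>2) * (1 + c\<^sup>2)" by (simp add: algebra_simps power2_eq_square power4_eq_xxxx)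
      then show ?thesis by (simp add: c2)
    qed
    let ?K = "(1 - c ^ 4) * (stein_discrepancy + s\<^sup>2 * d) + s ^ 4 * d"
    \<comment> \<open>slack of order s^4, negligible against the gain 1 - c^4 of order s^2\<close>
    have "ennreal r < ennreal (r + s ^ 4)" using r(2) s by (simp add: ennreal_less_iff)
    then obtain \<pi> where \<pi>: "\<pi> \<in> gauss_couplings" "(\<integral>\<^sup>+p. ennreal (cost p) \<partial>\<pi>) < ennreal (r + s ^ 4)"
      unfolding r(1)[symmetric] w_def by (subst (asm) INF_less_iff) auto
    from coupling_step[OF \<pi>(1) c s(1)] c2 obtain \<pi>' where \<pi>': "\<pi>' \<in> gauss_couplings"
      "(\<integral>\<^sup>+p. ennreal (cost p) \<partial>\<pi>') \<le> ennreal (c ^ 4) * (\<integral>\<^sup>+p. ennreal (cost p) \<partial>\<pi>)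
        + ennreal ?K" by auto
    have nonneg: "0 \<le> ?K"
      unfolding c4 using stein_discrepancy_nonneg by simp
    have "ennreal r \<le> (\<integral>\<^sup>+p. ennreal (cost p) \<partial>\<pi>')"
      unfolding r(1)[symmetric] w_def using \<pi>'(1) by (rule INF_lower)
    also note \<pi>'(2)
    also have "ennreal (c ^ 4) * (\<integral>\<^sup>+p. ennreal (cost p) \<partial>\<pi>)
        + ennreal ?K
      \<le> ennreal (c ^ 4) * ennreal (r + s ^ 4)
        + ennreal ?K"
      using \<pi>(2) by (intro add_right_mono mult_left_mono) auto
    also have "ennreal (c ^ 4) * ennreal (r + s ^ 4) + ennreal ?K
      = ennreal (c ^ 4 * (r + s ^ 4) + ?K)"
    proof -
      have "ennreal (c ^ 4) * ennreal (r + s ^ 4) = ennreal (c ^ 4 * (r + s ^ 4))"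
        using r(2) by (intro ennreal_mult[symmetric]) auto
      moreover have "0 \<le> c ^ 4 * (r + s ^ 4)" using r(2) by simp
      ultimately show ?thesis using nonneg by (simp only: ennreal_plus)
    qed
    finally have "r \<le> c ^ 4 * (r + s ^ 4) + ?K"
      using r(2) s nonneg by (subst (asm) ennreal_le_iff) auto
    then have main: "(1 - c ^ 4) * r \<le> c ^ 4 * s ^ 4 + (1 - c ^ 4) * (stein_discrepancy + s\<^sup>2 * d) + s ^ 4 * d"
      by (simp add: algebra_simps)
    have "c ^ 4 * s ^ 4 + s ^ 4 * d \<le> (1 - c ^ 4) * (s\<^sup>2 * (1 + d))"
    proof -
      have "c ^ 4 \<le> 1" using c4 s2 by (smt (verit) mult_nonneg_nonneg zero_le_power2)
      then have "c ^ 4 * s ^ 4 + s ^ 4 * d \<le> 1 * s ^ 4 + s ^ 4 * d" by (intro add_right_mono mult_right_mono) auto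
      also have "\<dots> = s\<^sup>2 * 1 * (s\<^sup>2 * (1 + d))" by (simp add: algebra_simps power2_eq_square power4_eq_xxxx)
      also have "\<dots> \<le> s\<^sup>2 * (1 + c\<^sup>2) * (s\<^sup>2 * (1 + d))" by (intro mult_right_mono mult_left_mono) auto
      finally show ?thesis unfolding c4 .
    qed
    moreover have "(1 - c ^ 4) * (stein_discrepancy + s\<^sup>2 * d) + (1 - c ^ 4) * (s\<^sup>2 * (1 + d))
        = (1 - c ^ 4) * (stein_discrepancy + s\<^sup>2 * (2 * d + 1))"
      by (simp add: algebra_simps)
    ultimately have "(1 - c ^ 4) * r \<le> (1 - c ^ 4) * (stein_discrepancy + s\<^sup>2 * (2 * d + 1))"
      using main by linarith
    moreover have "0 < 1 - c ^ 4" unfolding c4 using s2 by (intro mult_pos_pos) (auto simp: add_pos_nonneg)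
    ultimately show ?thesis by (simp add: mult_le_cancel_left_pos)
  qed
  have "r \<le> stein_discrepancy + \<epsilon> / 2"
  proof -
    define t where "t = min (\<epsilon> / 2) (1 / 2) / (2 * real d + 1)"
    define s where "s = sqrt t"
    have d: "0 < 2 * real d + 1" by simp
    have q: "0 < t" "t < 1"
      using \<epsilon> by (auto simp: t_def divide_less_eq min_def)
    have "0 < s" "s < 1" using q by (auto simp: s_def)
    then have "r \<le> stein_discrepancy + s\<^sup>2 * (2 * real d + 1)"
      using bound[of s] by (simp add: algebra_simps)
    also have "s\<^sup>2 = t" using q by (simp add: s_def)
    also have "t * (2 * real d + 1) = min (\<epsilon> / 2) (1 / 2)"
      unfolding t_def times_divide_eq_left using d by (intro nonzero_mult_div_cancel_right) simp
    finally show ?thesis by simp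
  qed
  then have "w < ennreal (stein_discrepancy + \<epsilon>)"
    using r \<epsilon> stein_discrepancy_nonneg by (simp add: ennreal_less_iff del: ennreal_plus)
  then obtain \<pi> where "\<pi> \<in> gauss_couplings" "(\<integral>\<^sup>+p. ennreal (cost p) \<partial>\<pi>) < ennreal (stein_discrepancy + \<epsilon>)"
    unfolding w_def INF_less_iff by blast
  then show ?thesis by (auto intro: less_imp_le)
qed

end

section \<open>Hermitian forms in complex Gaussian vectors\<close>

definition kernel_map :: "nat \<Rightarrow> (nat \<Rightarrow> nat \<Rightarrow> complex) \<Rightarrow> (nat \<Rightarrow> complex) \<Rightarrow> nat \<Rightarrow> complex" where
  "kernel_map N K x = (\<lambda>a\<in>{..<N}. \<Sum>b<N. K a b * x b)"

definition hermitian_kernel :: "nat \<Rightarrow> (nat \<Rightarrow> nat \<Rightarrow> complex) \<Rightarrow> bool" where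
  "hermitian_kernel N K \<longleftrightarrow> (\<forall>a<N. \<forall>b<N. K a b = cnj (K b a))"

lemma hermitian_kernelD: "hermitian_kernel N K \<Longrightarrow> a < N \<Longrightarrow> b < N \<Longrightarrow> cnj (K b a) = K a b"
  unfolding hermitian_kernel_def by metis

definition kernel_mult :: "nat \<Rightarrow> (nat \<Rightarrow> nat \<Rightarrow> complex) \<Rightarrow> (nat \<Rightarrow> nat \<Rightarrow> complex) \<Rightarrow> nat \<Rightarrow> nat \<Rightarrow> complex" where
  "kernel_mult N H K a b = (\<Sum>c<N. H a c * K c b)"

definition hs_norm2 :: "nat \<Rightarrow> (nat \<Rightarrow> nat \<Rightarrow> complex) \<Rightarrow> real" where
  "hs_norm2 N K = (\<Sum>a<N. \<Sum>b<N. (cmod (K a b))\<^sup>2)"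

abbreviation gaussC :: "nat \<Rightarrow> (nat \<Rightarrow> complex) measure" where
  "gaussC N \<equiv> gauss_vec {..<N}"

lemma kernel_map_measurable [measurable]:
  "kernel_map N K \<in> PiM {..<N} (\<lambda>_. borel) \<rightarrow>\<^sub>M PiM {..<N} (\<lambda>_. borel)"
  unfolding kernel_map_def[abs_def] by measurable

text \<open>
  Reduces products of complex multiples of coordinates to real linear functionals of the coordinates,
  whose covariances are known.
\<close>

lemma inner_complex_mult_split:
  "inner (k * z) (l * w) = inner z (cnj k) * inner w (cnj l) + inner z (\<i> * cnj k) * inner w (\<i> * cnj l)" for z w k l :: complex
  by (simp add: inner_complex_def algebra_simps)

lemma coordinate_measurable: "b < N \<Longrightarrow> (\<lambda>x. x b) \<in> borel_measurable (gaussC N)"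
  unfolding measurable_cong_sets[OF sets_gauss_vec refl] by (rule measurable_component_singleton) simp

lemma square_inner_complex:
  assumes "b < N" "c < N"
  shows "square_integrable (gaussC N) (\<lambda>x. inner (k * x b) (l * x c))"
proof (rule square_bilinear_gauss[of "{..<N}" b c _ "cmod k * cmod l"])
  show "(\<lambda>x. inner (k * x b) (l * x c)) \<in> borel_measurable (gaussC N)"
    using assms by (intro borel_measurable_inner borel_measurable_times borel_measurable_const coordinate_measurable)
  show "\<bar>inner (k * x b) (l * x c)\<bar> \<le> cmod k * cmod l * (cmod (x b) * cmod (x c))" for x :: "nat \<Rightarrow> complex"
    using Cauchy_Schwarz_ineq2[of "k * x b" "l * x c"] by (simp add: norm_mult mult_ac)
qed (use assms in auto)

lemma mean_inner_complex:
  assumes "b < N" "c < N"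
  shows "(\<integral>x. inner (k * x b) (l * x c) \<partial>gaussC N) = (if b = c then 2 * Re (cnj k * l) else 0)"
proof -
  have int: "integrable (gaussC N) (\<lambda>x. inner (x b) u * inner (x c) v)" for u v :: complex
    using assms by (intro square_integrable_mult square_inner_component_gauss) auto
  have "(\<integral>x. inner (k * x b) (l * x c) \<partial>gaussC N)
      = (\<integral>x. inner (x b) (cnj k) * inner (x c) (cnj l) \<partial>gaussC N)
      + (\<integral>x. inner (x b) (\<i> * cnj k) * inner (x c) (\<i> * cnj l) \<partial>gaussC N)"
    unfolding inner_complex_mult_split by (intro Bochner_Integration.integral_add int)
  also have "\<dots> = (if b = c then 2 * Re (cnj k * l) else 0)"
    using assms by (simp add: covariance_components_gauss) (simp add: inner_complex_def)
  finally show ?thesis .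
qed

lemma square_kernel_forms:
  "square_integrable (gaussC N) (\<lambda>x. inner_on {..<N} (kernel_map N H x) (kernel_map N K x))"
  "square_integrable (gaussC N) (\<lambda>x. inner_on {..<N} x (kernel_map N K x))"
proof -
  have "square_integrable (gaussC N) (\<lambda>x. \<Sum>a<N. \<Sum>b<N. \<Sum>c<N. inner (H a c * x c) (K a b * x b))"
    by (intro square_integrable_sum square_inner_complex) auto
  then show "square_integrable (gaussC N) (\<lambda>x. inner_on {..<N} (kernel_map N H x) (kernel_map N K x))"
    by (simp add: inner_on_def kernel_map_def inner_sum_left inner_sum_right)
  have "square_integrable (gaussC N) (\<lambda>x. \<Sum>a<N. \<Sum>b<N. inner (1 * x a) (K a b * x b))"
    by (intro square_integrable_sum square_inner_complex) auto
  then show "square_integrable (gaussC N) (\<lambda>x. inner_on {..<N} x (kernel_map N K x))"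
    by (simp add: inner_on_def kernel_map_def inner_sum_right)
qed

lemma mean_kernel_form:
  "(\<integral>x. inner_on {..<N} x (kernel_map N K x) \<partial>gaussC N) = 2 * (\<Sum>a<N. Re (K a a))"
proof -
  interpret G: prob_space "gaussC N" by (rule prob_space_gauss_vec)
  have "(\<integral>x. inner_on {..<N} x (kernel_map N K x) \<partial>gaussC N)
    = (\<integral>x. (\<Sum>a<N. \<Sum>b<N. inner (1 * x a) (K a b * x b)) \<partial>gaussC N)"
    by (simp add: inner_on_def kernel_map_def inner_sum_right)
  also have "\<dots> = (\<Sum>a<N. \<integral>x. (\<Sum>b<N. inner (1 * x a) (K a b * x b)) \<partial>gaussC N)"
    by (rule Bochner_Integration.integral_sum)
       (intro G.square_integrable_integrable square_integrable_sum square_inner_complex, auto)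
  also have "\<dots> = (\<Sum>a<N. \<Sum>b<N. \<integral>x. inner (1 * x a) (K a b * x b) \<partial>gaussC N)"
    by (intro sum.cong refl Bochner_Integration.integral_sum G.square_integrable_integrable square_inner_complex) auto
  also have "\<dots> = (\<Sum>a<N. \<Sum>b<N. if a = b then 2 * Re (K a b) else 0)"
    by (intro sum.cong refl) (subst mean_inner_complex, auto)
  also have "\<dots> = 2 * (\<Sum>a<N. Re (K a a))" by (simp add: sum_distrib_left)
  finally show ?thesis .
qed

lemma mean_kernel_square:
  "(\<integral>x. inner_on {..<N} (kernel_map N K x) (kernel_map N K x) \<partial>gaussC N) = 2 * hs_norm2 N K"
proof -
  interpret G: prob_space "gaussC N" by (rule prob_space_gauss_vec)
  have "(\<integral>x. inner_on {..<N} (kernel_map N K x) (kernel_map N K x) \<partial>gaussC N)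
    = (\<integral>x. (\<Sum>a<N. \<Sum>b<N. \<Sum>c<N. inner (K a c * x c) (K a b * x b)) \<partial>gaussC N)"
    by (simp add: inner_on_def kernel_map_def inner_sum_left inner_sum_right)
  also have "\<dots> = (\<Sum>a<N. \<integral>x. (\<Sum>b<N. \<Sum>c<N. inner (K a c * x c) (K a b * x b)) \<partial>gaussC N)"
    by (rule Bochner_Integration.integral_sum)
       (intro G.square_integrable_integrable square_integrable_sum square_inner_complex, auto)
  also have "\<dots> = (\<Sum>a<N. \<Sum>b<N. \<integral>x. (\<Sum>c<N. inner (K a c * x c) (K a b * x b)) \<partial>gaussC N)"
    by (rule sum.cong[OF refl], rule Bochner_Integration.integral_sum)
       (intro G.square_integrable_integrable square_integrable_sum square_inner_complex, auto)
  also have "\<dots> = (\<Sum>a<N. \<Sum>b<N. \<Sum>c<N. \<integral>x. inner (K a c * x c) (K a b * x b) \<partial>gaussC N)"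
    by (intro sum.cong refl Bochner_Integration.integral_sum G.square_integrable_integrable square_inner_complex) auto
  also have "\<dots> = (\<Sum>a<N. \<Sum>b<N. \<Sum>c<N. if c = b then 2 * (cmod (K a b))\<^sup>2 else 0)"
  proof (intro sum.cong refl)
    have "Re (cnj k * k) = (cmod k)\<^sup>2" for k by (simp add: cmod_power2 flip: power2_eq_square)
    then show "(\<integral>x. inner (K a c * x c) (K a b * x b) \<partial>gaussC N) = (if c = b then 2 * (cmod (K a b))\<^sup>2 else 0)"
      if "b \<in> {..<N}" "c \<in> {..<N}" for a b c
      using that by (subst mean_inner_complex) auto
  qed
  also have "\<dots> = 2 * hs_norm2 N K" by (simp add: sum_distrib_left hs_norm2_def)
  finally show ?thesis .
qed

lemma kernel_map_linear:
  "a \<in> {..<N} \<Longrightarrow> kernel_map N K (\<lambda>i\<in>{..<N}. u *\<^sub>R x i + v *\<^sub>R y i) a = u *\<^sub>R kernel_map N K x a + v *\<^sub>R kernel_map N K y a"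
  by (simp add: kernel_map_def distrib_left sum.distrib scaleR_sum_right mult_scaleR_right)

lemma kernel_map_symmetric:
  assumes "hermitian_kernel N K"
  shows "inner_on {..<N} (kernel_map N K x) y = inner_on {..<N} x (kernel_map N K y)"
proof -
  have herm: "inner (K a b * x b) (y a) = inner (x b) (K b a * y a)" if "a < N" "b < N" for a b
  proof -
    have "inner (cnj k * z) w = inner z (k * w)" for k z w :: complex
      by (simp add: inner_complex_def algebra_simps)
    from this[of "K b a"] show ?thesis by (simp only: hermitian_kernelD[OF assms that])
  qed
  have "inner_on {..<N} (kernel_map N K x) y = (\<Sum>a<N. \<Sum>b<N. inner (K a b * x b) (y a))"
    by (simp add: inner_on_def kernel_map_def inner_sum_left)
  also have "\<dots> = (\<Sum>a<N. \<Sum>b<N. inner (x b) (K b a * y a))"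
    by (intro sum.cong refl herm) auto
  also have "\<dots> = inner_on {..<N} x (kernel_map N K y)"
    by (subst sum.swap) (simp add: inner_on_def kernel_map_def inner_sum_right)
  finally show ?thesis .
qed

lemma kernel_map_mult:
  "inner_on {..<N} x (kernel_map N H (kernel_map N K y)) = inner_on {..<N} x (kernel_map N (kernel_mult N H K) y)"
proof (rule inner_on_cong[OF refl])
  fix a assume a: "a \<in> {..<N}"
  then have "kernel_map N H (kernel_map N K y) a = (\<Sum>b<N. \<Sum>c<N. H a b * K b c * y c)"
    by (simp add: kernel_map_def sum_distrib_left mult.assoc)
  also have "\<dots> = kernel_map N (kernel_mult N H K) y a"
    using a by (subst sum.swap) (simp add: kernel_map_def kernel_mult_def sum_distrib_right)
  finally show "kernel_map N H (kernel_map N K y) a = kernel_map N (kernel_mult N H K) y a" .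
qed

text \<open>
  Let F be the centred form and v its variance. For independent x and y the vector
  (x + y) / sqrt 2 has the same law as x, and F of it is F(x) / 2 + F(y) / 2 + <K x, y>. The three
  summands are uncorrelated, so v = v / 4 + v / 4 + E |K x|^2, where E |K x|^2 is twice the squared
  Hilbert-Schmidt norm. This obtains fourth moments of x from second
  moments.
\<close>

lemma variance_kernel_form:
  assumes K: "hermitian_kernel N K"
  shows "(\<integral>x. (inner_on {..<N} x (kernel_map N K x) - 2 * (\<Sum>a<N. Re (K a a)))\<^sup>2 \<partial>gaussC N) = 4 * hs_norm2 N K"
proof -
  interpret GG: prob_pair "gaussC N" "gaussC N" by (intro prob_pair.intro prob_space_gauss_vec)
  let ?G = "gaussC N"
  define \<tau> where "\<tau> = 2 * (\<Sum>a<N. Re (K a a))"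
  define F where "F x = inner_on {..<N} x (kernel_map N K x) - \<tau>" for x
  define B where "B p = inner_on {..<N} (kernel_map N K (fst p)) (snd p)" for p
  have sqF: "square_integrable ?G F"
    unfolding F_def[abs_def] by (intro square_integrable_diff square_kernel_forms GG.M.square_integrable_const)
  have F_meas: "F \<in> borel_measurable ?G" by (rule square_integrable_measurable[OF sqF])
  have EF: "(\<integral>x. F x \<partial>?G) = 0"
    unfolding F_def using mean_kernel_form[of N K] GG.M.square_integrable_integrable[OF square_kernel_forms(2)]
      GG.M.prob_space
    by (subst Bochner_Integration.integral_diff) (auto simp: \<tau>_def)
  note sqF1 = GG.square_fst[OF sqF] and sqF2 = GG.square_snd[OF sqF]
  have sqB: "square_integrable (?G \<Otimes>\<^sub>M ?G) B"
  proof -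
    have sq: "square_integrable ?G (\<lambda>x. (cmod (x b))\<^sup>2)" if "b < N" for b
      by (rule square_bilinear_gauss[of "{..<N}" b b _ 1]) (use that in \<open>auto simp: power2_eq_square\<close>)
    have "square_integrable (?G \<Otimes>\<^sub>M ?G) (\<lambda>p. \<Sum>a<N. \<Sum>b<N. inner (K a b * fst p b) (snd p a))"
    proof (intro square_integrable_sum)
      fix a b assume ab: "a \<in> {..<N}" "b \<in> {..<N}"
      show "square_integrable (?G \<Otimes>\<^sub>M ?G) (\<lambda>p. inner (K a b * fst p b) (snd p a))"
      proof (rule square_integrable_bound)
        show "square_integrable (?G \<Otimes>\<^sub>M ?G) (\<lambda>p. cmod (K a b) * ((cmod (fst p b))\<^sup>2 + (cmod (snd p a))\<^sup>2))"
          using ab by (intro square_integrable_cmult square_integrable_add GG.square_fst GG.square_snd sq) auto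
        show "(\<lambda>p. inner (K a b * fst p b) (snd p a)) \<in> borel_measurable (?G \<Otimes>\<^sub>M ?G)"
          using ab by measurable
        fix p :: "(nat \<Rightarrow> complex) \<times> (nat \<Rightarrow> complex)"
        have "\<bar>inner (K a b * fst p b) (snd p a)\<bar> \<le> cmod (K a b) * (cmod (fst p b) * cmod (snd p a))"
          using Cauchy_Schwarz_ineq2[of "K a b * fst p b" "snd p a"] by (simp add: norm_mult mult_ac)
        also have "\<dots> \<le> cmod (K a b) * ((cmod (fst p b))\<^sup>2 + (cmod (snd p a))\<^sup>2)"
        proof (intro mult_left_mono)
          have "0 \<le> (cmod (fst p b) - cmod (snd p a))\<^sup>2 + (cmod (fst p b))\<^sup>2 + (cmod (snd p a))\<^sup>2" by simp
          then show "cmod (fst p b) * cmod (snd p a) \<le> (cmod (fst p b))\<^sup>2 + (cmod (snd p a))\<^sup>2"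
            by (simp add: power2_eq_square algebra_simps)
        qed auto
        finally show "\<bar>inner (K a b * fst p b) (snd p a)\<bar> \<le> \<bar>cmod (K a b) * ((cmod (fst p b))\<^sup>2 + (cmod (snd p a))\<^sup>2)\<bar>"
          by linarith
      qed
    qed
    then show ?thesis by (simp add: B_def[abs_def] inner_on_def kernel_map_def inner_sum_left)
  qed
  have F_rot: "F (\<lambda>i\<in>{..<N}. sqrt (1/2) *\<^sub>R x i + sqrt (1/2) *\<^sub>R y i) = 1/2 * F x + 1/2 * F y + B (x, y)" for x y
  proof -
    let ?v = "\<lambda>i. sqrt (1/2) *\<^sub>R x i + sqrt (1/2) *\<^sub>R y i"
    have "inner_on {..<N} ?v (kernel_map N K (\<lambda>i\<in>{..<N}. ?v i))
      = inner_on {..<N} ?v (\<lambda>i. sqrt (1/2) *\<^sub>R kernel_map N K x i + sqrt (1/2) *\<^sub>R kernel_map N K y i)"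
      by (rule inner_on_cong) (simp_all add: kernel_map_linear)
    also have "\<dots> = 1/2 * inner_on {..<N} x (kernel_map N K x) + 1/2 * inner_on {..<N} y (kernel_map N K y) + B (x, y)"
      using kernel_map_symmetric[OF K, of x y] inner_on_commute[of "{..<N}" y "kernel_map N K x"]
      unfolding inner_on_linear by (simp add: B_def algebra_simps flip: mult.assoc)
    finally show ?thesis by (simp add: F_def diff_divide_distrib)
  qed
  have inner0: "(\<integral>y. B (x, y) \<partial>?G) = 0" for x
    by (simp add: B_def mean_inner_on_gauss)
  have EFB1: "(\<integral>p. F (fst p) * B p \<partial>(?G \<Otimes>\<^sub>M ?G)) = 0"
    using GG.integral_fst'[OF square_integrable_mult[OF sqF1 sqB]] inner0 by simp
  have EFB2: "(\<integral>p. F (snd p) * B p \<partial>(?G \<Otimes>\<^sub>M ?G)) = 0"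
  proof -
    have "(\<integral>x. B (x, y) \<partial>?G) = 0" for y
      unfolding B_def using kernel_map_symmetric[OF K, of _ y]
      by (simp add: mean_inner_on_gauss inner_on_commute[of "{..<N}" _ "kernel_map N K y"])
    then show ?thesis
      using GG.integral_snd[of "\<lambda>x y. F y * B (x, y)"] square_integrable_mult[OF sqF2 sqB]
      by (simp add: case_prod_beta')
  qed
  have EFF: "(\<integral>p. F (fst p) * F (snd p) \<partial>(?G \<Otimes>\<^sub>M ?G)) = 0"
    using GG.expectation_mult[OF sqF sqF] EF by simp
  have EBB: "(\<integral>p. (B p)\<^sup>2 \<partial>(?G \<Otimes>\<^sub>M ?G)) = 2 * hs_norm2 N K"
  proof -
    have "(\<integral>p. (B p)\<^sup>2 \<partial>(?G \<Otimes>\<^sub>M ?G)) = (\<integral>x. \<integral>y. B (x, y) * B (x, y) \<partial>?G \<partial>?G)"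
      using GG.integral_fst'[OF square_integrable_mult[OF sqB sqB]] by (simp add: power2_eq_square)
    then show ?thesis
      by (simp add: B_def covariance_inner_on_gauss mean_kernel_square)
  qed
  define v where "v = (\<integral>x. (F x)\<^sup>2 \<partial>?G)"
  have EF1: "(\<integral>p. (F (fst p))\<^sup>2 \<partial>(?G \<Otimes>\<^sub>M ?G)) = v" "(\<integral>p. (F (snd p))\<^sup>2 \<partial>(?G \<Otimes>\<^sub>M ?G)) = v"
    unfolding v_def using GG.expectation_fst[of "\<lambda>x. (F x)\<^sup>2"] GG.expectation_snd[of "\<lambda>x. (F x)\<^sup>2"] F_meas by auto
  have F_B: "F \<in> borel_measurable (PiM {..<N} (\<lambda>_. borel))"
    using F_meas by (simp only: measurable_cong_sets[OF sets_gauss_vec refl])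
  have sqS: "square_integrable (?G \<Otimes>\<^sub>M ?G) (\<lambda>p. 1/2 * F (fst p) + 1/2 * F (snd p) + B p)"
    by (intro square_integrable_add square_integrable_cmult sqF1 sqF2 sqB)
  have v_nonneg: "0 \<le> v" unfolding v_def by simp
  have "ennreal v = (\<integral>\<^sup>+x. ennreal ((F x)\<^sup>2) \<partial>?G)"
    using nn_integral_square[OF sqF] by (simp add: v_def)
  also have "\<dots> = (\<integral>\<^sup>+x. \<integral>\<^sup>+y. ennreal ((F (\<lambda>i\<in>{..<N}. sqrt (1/2) *\<^sub>R x i + sqrt (1/2) *\<^sub>R y i))\<^sup>2) \<partial>?G \<partial>?G)"
    by (rule nn_integral_gauss_vec_rotate[symmetric]) (use F_B in auto)
  also have "\<dots> = (\<integral>\<^sup>+x. \<integral>\<^sup>+y. ennreal ((1/2 * F x + 1/2 * F y + B (x, y))\<^sup>2) \<partial>?G \<partial>?G)"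
    by (simp only: F_rot)
  also have "\<dots> = (\<integral>\<^sup>+p. ennreal ((1/2 * F (fst p) + 1/2 * F (snd p) + B p)\<^sup>2) \<partial>(?G \<Otimes>\<^sub>M ?G))"
    using GG.M.nn_integral_fst[of "\<lambda>p. ennreal ((1/2 * F (fst p) + 1/2 * F (snd p) + B p)\<^sup>2)" ?G]
      square_integrable_measurable[OF sqS] by simp
  also have "\<dots> = ennreal (\<integral>p. (1/2 * F (fst p) + 1/2 * F (snd p) + B p)\<^sup>2 \<partial>(?G \<Otimes>\<^sub>M ?G))"
    by (rule nn_integral_square[OF sqS])
  also have "(\<integral>p. (1/2 * F (fst p) + 1/2 * F (snd p) + B p)\<^sup>2 \<partial>(?G \<Otimes>\<^sub>M ?G))
     = (\<integral>p. 1/4 * (F (fst p))\<^sup>2 + 1/4 * (F (snd p))\<^sup>2 + (B p)\<^sup>2 + 1/2 * (F (fst p) * F (snd p))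
         + F (fst p) * B p + F (snd p) * B p \<partial>(?G \<Otimes>\<^sub>M ?G))"
  proof (intro Bochner_Integration.integral_cong refl)
    have expand: "(1/2 * u + 1/2 * w + z)\<^sup>2 = 1/4 * u\<^sup>2 + 1/4 * w\<^sup>2 + z\<^sup>2 + 1/2 * (u * w) + u * z + w * z" for u w z :: real
      by (simp add: power2_eq_square algebra_simps)
    show "(1/2 * F (fst p) + 1/2 * F (snd p) + B p)\<^sup>2 = 1/4 * (F (fst p))\<^sup>2 + 1/4 * (F (snd p))\<^sup>2 + (B p)\<^sup>2
         + 1/2 * (F (fst p) * F (snd p)) + F (fst p) * B p + F (snd p) * B p" for p
      by (rule expand)
  qed
  also have "\<dots> = 1/4 * v + 1/4 * v + 2 * hs_norm2 N K + 1/2 * 0 + 0 + 0"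
    using sqF1 sqF2 sqB square_integrable_mult[OF sqF1 sqF2] square_integrable_mult[OF sqF1 sqB] square_integrable_mult[OF sqF2 sqB]
    by (simp add: EF1 EFF EFB1 EFB2 EBB square_integrable_def)
  finally have "ennreal v = ennreal (1/4 * v + 1/4 * v + 2 * hs_norm2 N K + 1/2 * 0 + 0 + 0)" .
  moreover have "0 \<le> hs_norm2 N K" by (simp add: hs_norm2_def sum_nonneg)
  ultimately have "v = 4 * hs_norm2 N K"
    using v_nonneg by (subst (asm) ennreal_inj) auto
  then show ?thesis by (simp add: v_def F_def \<tau>_def)
qed

locale kernel_family =
  fixes N d :: nat and H :: "nat \<Rightarrow> nat \<Rightarrow> nat \<Rightarrow> complex"
  assumes hermitian: "\<And>j. j < d \<Longrightarrow> hermitian_kernel N (H j)"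
    and traceless: "\<And>j. j < d \<Longrightarrow> (\<Sum>a<N. Re (H j a a)) = 0"
    and orthonormal: "\<And>j k. j < d \<Longrightarrow> k < d \<Longrightarrow> (\<Sum>a<N. Re (kernel_mult N (H j) (H k) a a)) = kdelta j k"
begin

lemma hs_norm2_one: "j < d \<Longrightarrow> hs_norm2 N (H j) = 1"
proof -
  assume j: "j < d"
  have "hs_norm2 N (H j) = (\<Sum>a<N. Re (kernel_mult N (H j) (H j) a a))"
    unfolding hs_norm2_def kernel_mult_def Re_sum
  proof (intro sum.cong refl)
    fix a b assume "a \<in> {..<N}" "b \<in> {..<N}"
    then have "cnj (H j a b) = H j b a" using hermitian_kernelD[OF hermitian[OF j]] by simp
    then have "H j a b * H j b a = complex_of_real ((cmod (H j a b))\<^sup>2)"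
      unfolding complex_norm_square by (simp only:)
    then show "(cmod (H j a b))\<^sup>2 = Re (H j a b * H j b a)" by simp
  qed
  then show ?thesis using orthonormal[OF j j] by (simp add: kdelta_def)
qed

sublocale quadratic_forms "{..<N}" d "\<lambda>j. kernel_map N (H j)"
proof
  fix j assume j: "j < d"
  interpret G: prob_space "gaussC N" by (rule prob_space_gauss_vec)
  show "inner_on {..<N} (kernel_map N (H j) x) y = inner_on {..<N} x (kernel_map N (H j) y)" for x y
    by (rule kernel_map_symmetric[OF hermitian[OF j]])
  show "square_integrable (gaussC N) (\<lambda>x. inner_on {..<N} x (kernel_map N (H j) x) / 2)"
    using square_integrable_cmult[OF square_kernel_forms(2), of N "1/2" "H j"] by simp
  show "(\<integral>x. inner_on {..<N} x (kernel_map N (H j) x) / 2 \<partial>gaussC N) = 0"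
    using mean_kernel_form[of N "H j"] traceless[OF j] by simp
  show "(\<integral>x. (inner_on {..<N} x (kernel_map N (H j) x) / 2)\<^sup>2 \<partial>gaussC N) = 1"
    using variance_kernel_form[OF hermitian[OF j]] traceless[OF j] hs_norm2_one[OF j]
    by (simp add: power_divide)
  show "square_integrable (gaussC N) (\<lambda>x. inner_on {..<N} (kernel_map N (H j) x) (kernel_map N (H k) x) / 2)" for k
    using square_integrable_cmult[OF square_kernel_forms(1), of N "1/2" "H j" "H k"] by simp
qed (auto simp: kernel_map_linear)

lemma kernel_mult_cnj:
  "j < d \<Longrightarrow> k < d \<Longrightarrow> a < N \<Longrightarrow> b < N \<Longrightarrow> cnj (kernel_mult N (H j) (H k) a b) = kernel_mult N (H k) (H j) b a"
  unfolding kernel_mult_def cnj_sum complex_cnj_mult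
  by (intro sum.cong refl) (simp add: hermitian_kernelD[OF hermitian] mult.commute)

text \<open>
  The entries of the Stein kernel are themselves Hermitian forms, with matrices
  (H_j H_k + H_k H_j) / 2 whose trace is the expected value. So the discrepancy is a sum of variances.
\<close>

lemma stein_discrepancy_le:
  "stein_discrepancy \<le> (\<Sum>j<d. \<Sum>k<d. hs_norm2 N (kernel_mult N (H j) (H k)))"
  unfolding stein_discrepancy_def
proof (intro sum_mono)
  fix j k assume "j \<in> {..<d}" "k \<in> {..<d}"
  then have j: "j < d" and k: "k < d" by auto
  define P where "P = kernel_mult N (H j) (H k)"
  define P' where "P' = kernel_mult N (H k) (H j)"
  define S where "S a b = (P a b + P' a b) / 2" for a b
  have cnjP: "cnj (P a b) = P' b a" if "a < N" "b < N" for a b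
    unfolding P_def P'_def by (rule kernel_mult_cnj[OF j k that])
  have S: "hermitian_kernel N S"
    unfolding hermitian_kernel_def
  proof (intro allI impI)
    fix a b assume ab: "a < N" "b < N"
    show "S a b = cnj (S b a)"
      unfolding S_def using cnjP[OF ab] cnjP[OF ab(2,1)] complex_cnj_cnj[of "P a b"] by (simp add: add.commute)
  qed
  have form: "inner_on {..<N} (kernel_map N (H j) x) (kernel_map N (H k) x) = inner_on {..<N} x (kernel_map N S x)" for x
  proof -
    have 1: "inner_on {..<N} (kernel_map N (H j) x) (kernel_map N (H k) x) = inner_on {..<N} x (kernel_map N P x)"
      unfolding P_def by (simp add: T_symmetric[OF j] kernel_map_mult)
    have 2: "inner_on {..<N} (kernel_map N (H j) x) (kernel_map N (H k) x) = inner_on {..<N} x (kernel_map N P' x)"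
      unfolding P'_def by (subst inner_on_commute) (simp add: T_symmetric[OF k] kernel_map_mult)
    have "inner_on {..<N} x (kernel_map N S x)
       = inner_on {..<N} x (\<lambda>a. (1/2) *\<^sub>R kernel_map N P x a + (1/2) *\<^sub>R kernel_map N P' x a)"
    proof (rule inner_on_cong[OF refl])
      fix a assume a: "a \<in> {..<N}"
      have "(p + q) / 2 * z = (1/2) *\<^sub>R (p * z) + (1/2) *\<^sub>R (q * z)" for p q z :: complex
        by (simp add: scaleR_conv_of_real field_simps)
      then show "kernel_map N S x a = (1/2) *\<^sub>R kernel_map N P x a + (1/2) *\<^sub>R kernel_map N P' x a"
        using a by (simp only: S_def kernel_map_def restrict_apply' sum.distrib scaleR_sum_right)
    qed
    also have "\<dots> = 1/2 * inner_on {..<N} x (kernel_map N P x) + 1/2 * inner_on {..<N} x (kernel_map N P' x)"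
      unfolding inner_on_linear ..
    finally show ?thesis using 1 2 by simp
  qed
  have tr: "(\<Sum>a<N. Re (S a a)) = kdelta j k"
    using orthonormal[OF j k] orthonormal[OF k j]
    by (simp add: S_def P_def P'_def add_divide_distrib sum.distrib kdelta_def flip: sum_divide_distrib split: if_splits)
  have "(\<integral>x. (stein_kernel j k x - kdelta j k)\<^sup>2 \<partial>gaussC N)
    = (\<integral>x. 1/4 * (inner_on {..<N} x (kernel_map N S x) - 2 * (\<Sum>a<N. Re (S a a)))\<^sup>2 \<partial>gaussC N)"
    unfolding stein_kernel_def form tr by (intro Bochner_Integration.integral_cong refl) (simp add: power2_eq_square field_simps)
  also have "\<dots> = hs_norm2 N S"
    using variance_kernel_form[OF S] by simp
  also have "\<dots> \<le> (\<Sum>a<N. \<Sum>b<N. (cmod (P a b))\<^sup>2 / 2 + (cmod (P b a))\<^sup>2 / 2)"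
    unfolding hs_norm2_def
  proof (intro sum_mono)
    fix a b assume "a \<in> {..<N}" "b \<in> {..<N}"
    then have "P' a b = cnj (P b a)" using cnjP[of b a] by simp
    then have "cmod (S a b) \<le> (cmod (P a b) + cmod (P b a)) / 2"
      unfolding S_def using norm_triangle_ineq[of "P a b" "P' a b"] by (simp add: norm_divide)
    then have "(cmod (S a b))\<^sup>2 \<le> ((cmod (P a b) + cmod (P b a)) / 2)\<^sup>2" by (intro power_mono) auto
    also have "\<dots> \<le> (cmod (P a b))\<^sup>2 / 2 + (cmod (P b a))\<^sup>2 / 2"
      using zero_le_power2[of "cmod (P a b) - cmod (P b a)"] by (simp add: power2_eq_square field_simps)
    finally show "(cmod (S a b))\<^sup>2 \<le> (cmod (P a b))\<^sup>2 / 2 + (cmod (P b a))\<^sup>2 / 2" .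
  qed
  also have "\<dots> = hs_norm2 N P"
  proof -
    have "(\<Sum>a<N. \<Sum>b<N. (cmod (P b a))\<^sup>2 / 2) = (\<Sum>a<N. \<Sum>b<N. (cmod (P a b))\<^sup>2 / 2)"
      by (rule sum.swap)
    then show ?thesis by (simp add: hs_norm2_def sum.distrib flip: sum_divide_distrib)
  qed
  finally show "(\<integral>x. (stein_kernel j k x - kdelta j k)\<^sup>2 \<partial>gaussC N)
      \<le> hs_norm2 N (kernel_mult N (H j) (H k))" unfolding P_def .
qed

text \<open>
  |H_j H_k|_HS^2 = tr (H_j^2 H_k^2), to which the Cauchy-Schwarz inequality applies.
\<close>

lemma hs_norm2_mult_le:
  assumes j: "j < d" and k: "k < d"
  shows "hs_norm2 N (kernel_mult N (H j) (H k))
    \<le> sqrt (hs_norm2 N (kernel_mult N (H j) (H j))) * sqrt (hs_norm2 N (kernel_mult N (H k) (H k)))"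
proof -
  let ?J = "kernel_mult N (H j) (H j)" and ?K = "kernel_mult N (H k) (H k)"
  have herm: "cnj (H j a b) = H j b a" "cnj (H k a b) = H k b a" if "a < N" "b < N" for a b
    using hermitian_kernelD[OF hermitian[OF j]] hermitian_kernelD[OF hermitian[OF k]] that by auto
  have "complex_of_real (hs_norm2 N (kernel_mult N (H j) (H k)))
      = (\<Sum>a<N. \<Sum>b<N. (\<Sum>c<N. H j a c * H k c b) * (\<Sum>e<N. H k b e * H j e a))"
    unfolding hs_norm2_def of_real_sum
  proof (intro sum.cong refl)
    fix a b assume "a \<in> {..<N}" "b \<in> {..<N}"
    then have "cnj (kernel_mult N (H j) (H k) a b) = kernel_mult N (H k) (H j) b a"
      by (intro kernel_mult_cnj[OF j k]) auto
    then show "complex_of_real ((cmod (kernel_mult N (H j) (H k) a b))\<^sup>2)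
        = (\<Sum>c<N. H j a c * H k c b) * (\<Sum>e<N. H k b e * H j e a)"
      unfolding complex_norm_square by (simp add: kernel_mult_def)
  qed
  also have "\<dots> = (\<Sum>a<N. \<Sum>b<N. \<Sum>c<N. \<Sum>e<N. (H j e a * H j a c) * (H k c b * H k b e))"
    unfolding sum_product by (intro sum.cong refl) (simp add: mult_ac)
  also have "\<dots> = (\<Sum>c<N. \<Sum>e<N. \<Sum>a<N. \<Sum>b<N. (H j e a * H j a c) * (H k c b * H k b e))"
  proof -
    have "(\<Sum>a<N. \<Sum>b<N. \<Sum>c<N. \<Sum>e<N. (H j e a * H j a c) * (H k c b * H k b e))
      = (\<Sum>a<N. \<Sum>c<N. \<Sum>b<N. \<Sum>e<N. (H j e a * H j a c) * (H k c b * H k b e))"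
      by (rule sum.cong[OF refl], rule sum.swap)
    also have "\<dots> = (\<Sum>c<N. \<Sum>a<N. \<Sum>b<N. \<Sum>e<N. (H j e a * H j a c) * (H k c b * H k b e))"
      by (rule sum.swap)
    also have "\<dots> = (\<Sum>c<N. \<Sum>a<N. \<Sum>e<N. \<Sum>b<N. (H j e a * H j a c) * (H k c b * H k b e))"
      by (rule sum.cong[OF refl], rule sum.cong[OF refl], rule sum.swap)
    also have "\<dots> = (\<Sum>c<N. \<Sum>e<N. \<Sum>a<N. \<Sum>b<N. (H j e a * H j a c) * (H k c b * H k b e))"
      by (rule sum.cong[OF refl], rule sum.swap)
    finally show ?thesis .
  qed
  also have "\<dots> = (\<Sum>c<N. \<Sum>e<N. ?J e c * ?K c e)"
    unfolding kernel_mult_def sum_product ..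
  finally have "hs_norm2 N (kernel_mult N (H j) (H k)) \<le> cmod (\<Sum>c<N. \<Sum>e<N. ?J e c * ?K c e)"
    by (metis abs_ge_self norm_of_real)
  also have "\<dots> \<le> (\<Sum>c<N. \<Sum>e<N. cmod (?J e c) * cmod (?K c e))"
    by (intro order_trans[OF norm_sum] sum_mono order_trans[OF norm_sum]) (simp add: norm_mult)
  also have "\<dots> = (\<Sum>p\<in>{..<N}\<times>{..<N}. cmod (?J (snd p) (fst p)) * cmod (?K (fst p) (snd p)))"
    by (simp add: sum.cartesian_product case_prod_beta')
  also have "\<dots> \<le> L2_set (\<lambda>p. cmod (?J (snd p) (fst p))) ({..<N}\<times>{..<N}) * L2_set (\<lambda>p. cmod (?K (fst p) (snd p))) ({..<N}\<times>{..<N})"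
    using L2_set_mult_ineq[of "\<lambda>p. cmod (?J (snd p) (fst p))" "\<lambda>p. cmod (?K (fst p) (snd p))" "{..<N}\<times>{..<N}"] by simp
  also have "L2_set (\<lambda>p. cmod (?K (fst p) (snd p))) ({..<N}\<times>{..<N}) = sqrt (hs_norm2 N ?K)"
    by (simp add: L2_set_def hs_norm2_def sum.cartesian_product case_prod_beta')
  also have "L2_set (\<lambda>p. cmod (?J (snd p) (fst p))) ({..<N}\<times>{..<N}) = sqrt (hs_norm2 N ?J)"
    unfolding L2_set_def hs_norm2_def
    by (subst sum.swap) (simp add: sum.cartesian_product case_prod_beta')
  finally show ?thesis .
qed

lemma stein_discrepancy_le_square:
  "stein_discrepancy \<le> (\<Sum>j<d. sqrt (hs_norm2 N (kernel_mult N (H j) (H j))))\<^sup>2"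
proof -
  have "stein_discrepancy \<le> (\<Sum>j<d. \<Sum>k<d. sqrt (hs_norm2 N (kernel_mult N (H j) (H j)))
      * sqrt (hs_norm2 N (kernel_mult N (H k) (H k))))"
    by (rule order_trans[OF stein_discrepancy_le]) (intro sum_mono hs_norm2_mult_le, auto)
  then show ?thesis by (simp add: power2_eq_square sum_product)
qed

end

section \<open>Schatten norms, ampliations and the reduced density matrix\<close>

lemma mtrace_mult:
  assumes "A \<in> carrier_mat n m" "B \<in> carrier_mat m n"
  shows "mtrace (A * B) = (\<Sum>i<n. \<Sum>j<m. A $$ (i, j) * B $$ (j, i))"
  using assms by (auto simp: mtrace_def scalar_prod_def lessThan_atLeast0 intro!: sum.cong)

lemma mtrace_commute:
  assumes "A \<in> carrier_mat n m" "B \<in> carrier_mat m n"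
  shows "mtrace (A * B) = mtrace (B * (A :: complex mat))"
  unfolding mtrace_mult[OF assms] mtrace_mult[OF assms(2,1)] by (subst sum.swap) (simp add: mult.commute)

lemma hermitian_entry:
  assumes "B \<in> carrier_mat n n" "hermitian_mat B" "i < n" "j < n"
  shows "cnj (B $$ (j, i)) = B $$ (i, j)"
proof -
  have "B $$ (i, j) = mat_adjoint B $$ (i, j)" using assms(2) by (simp add: hermitian_mat_def)
  also have "\<dots> = cnj (B $$ (j, i))"
    using assms by (simp add: mat_adjoint_def mat_of_rows_def)
  finally show ?thesis by simp
qed

lemma hermitian_square_eigenvalue:
  assumes B: "B \<in> carrier_mat n n" and herm: "hermitian_mat B" and e: "eigenvalue (B * B) e"
  shows "0 \<le> Re e" "Im e = 0"
proof -
  from e obtain v where v: "v \<in> carrier_vec n" "v \<noteq> 0\<^sub>v n" and Av: "(B * B) *\<^sub>v v = e \<cdot>\<^sub>v v"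
    using B by (auto simp: eigenvalue_def eigenvector_def)
  define x where "x i = vec_index v i" for i
  define y where "y i = (\<Sum>j<n. B $$ (i, j) * x j)" for i
  have y: "vec_index (B *\<^sub>v v) i = y i" if "i < n" for i
    using that B v by (auto simp: y_def x_def scalar_prod_def lessThan_atLeast0 intro!: sum.cong)
  have By: "(\<Sum>j<n. B $$ (i, j) * y j) = e * x i" if i: "i < n" for i
  proof -
    have "(B * B) *\<^sub>v v = B *\<^sub>v (B *\<^sub>v v)" using B v by (simp add: assoc_mult_mat_vec[of _ n n _ n])
    then have "vec_index (B *\<^sub>v (B *\<^sub>v v)) i = vec_index (e \<cdot>\<^sub>v v) i" using Av by simp
    also have "\<dots> = e * x i" using i v by (simp add: x_def)
    finally have "vec_index (B *\<^sub>v (B *\<^sub>v v)) i = e * x i" .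
    then show ?thesis
      using i B v y by (simp add: scalar_prod_def lessThan_atLeast0)
  qed
  have "e * of_real (\<Sum>i<n. (cmod (x i))\<^sup>2) = (\<Sum>i<n. (e * x i) * cnj (x i))"
    unfolding of_real_sum complex_norm_square by (simp add: sum_distrib_left mult.assoc)
  also have "\<dots> = (\<Sum>i<n. \<Sum>j<n. B $$ (i, j) * y j * cnj (x i))"
    by (intro sum.cong refl) (simp add: By[symmetric] sum_distrib_right)
  also have "\<dots> = (\<Sum>j<n. \<Sum>i<n. y j * (B $$ (i, j) * cnj (x i)))"
    by (subst sum.swap) (simp add: mult_ac)
  also have "\<dots> = (\<Sum>j<n. y j * cnj (y j))"
  proof (intro sum.cong refl)
    fix j assume j: "j \<in> {..<n}"
    have "(\<Sum>i<n. y j * (B $$ (i, j) * cnj (x i))) = y j * (\<Sum>i<n. B $$ (i, j) * cnj (x i))"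
      by (simp add: sum_distrib_left)
    also have "(\<Sum>i<n. B $$ (i, j) * cnj (x i)) = cnj (y j)"
      unfolding y_def cnj_sum complex_cnj_mult
      using j by (intro sum.cong refl) (simp add: hermitian_entry[OF B herm])
    finally show "(\<Sum>i<n. y j * (B $$ (i, j) * cnj (x i))) = y j * cnj (y j)" .
  qed
  also have "\<dots> = of_real (\<Sum>j<n. (cmod (y j))\<^sup>2)"
    unfolding of_real_sum complex_norm_square ..
  finally have eq: "e * of_real (\<Sum>i<n. (cmod (x i))\<^sup>2) = of_real (\<Sum>j<n. (cmod (y j))\<^sup>2)" .
  obtain i where i: "i < n" "x i \<noteq> 0" using v by (auto simp: vec_eq_iff x_def)
  have pos: "0 < (\<Sum>i<n. (cmod (x i))\<^sup>2)"
    using i by (intro sum_pos2[of _ i]) auto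
  have "complex_of_real (\<Sum>i<n. (cmod (x i))\<^sup>2) \<noteq> 0" using pos by (simp only: of_real_eq_0_iff)
  then have "e = of_real (\<Sum>j<n. (cmod (y j))\<^sup>2) / of_real (\<Sum>i<n. (cmod (x i))\<^sup>2)"
    using eq by (metis nonzero_mult_div_cancel_right)
  then have "e = of_real ((\<Sum>j<n. (cmod (y j))\<^sup>2) / (\<Sum>i<n. (cmod (x i))\<^sup>2))"
    by (simp only: of_real_divide)
  moreover have "0 \<le> (\<Sum>j<n. (cmod (y j))\<^sup>2) / (\<Sum>i<n. (cmod (x i))\<^sup>2)"
    using pos by (intro divide_nonneg_pos sum_nonneg) auto
  ultimately show "0 \<le> Re e" "Im e = 0" by simp_all
qed

text \<open>
  By Schur's decomposition A is similar to an upper triangular matrix with the eigenvalues on its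
  diagonal, and squaring keeps the matrix triangular.
\<close>

lemma mtrace_square_eigenvalues:
  fixes A :: "complex mat"
  assumes A: "A \<in> carrier_mat n n" and cp: "char_poly A = (\<Prod>e\<leftarrow>es. [:- e, 1:])"
  shows "mtrace (A * A) = (\<Sum>e\<leftarrow>es. e\<^sup>2)"
proof -
  obtain T P Q where "schur_decomposition A es = (T, P, Q)" by (metis prod_cases3)
  from schur_decomposition[OF A cp this] have sim: "similar_mat_wit A T P Q"
    and ut: "upper_triangular T" and diag: "diag_mat T = es" by auto
  from similar_mat_witD2[OF A sim] have QP: "Q * P = 1\<^sub>m n" and A_eq: "A = P * T * Q"
    and T: "T \<in> carrier_mat n n" and P: "P \<in> carrier_mat n n" and Q: "Q \<in> carrier_mat n n" by auto
  have "A * A = P * T * Q * (P * T * Q)" unfolding A_eq ..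
  also have "\<dots> = P * T * (Q * P) * (T * Q)" using P Q T by (simp add: assoc_mult_mat[of _ n n _ n _ n])
  also have "\<dots> = P * (T * T * Q)" unfolding QP using P Q T by (simp add: assoc_mult_mat[of _ n n _ n _ n])
  finally have "mtrace (A * A) = mtrace (P * (T * T * Q))" by simp
  also have "\<dots> = mtrace (T * T * Q * P)" using P Q T by (intro mtrace_commute) auto
  also have "T * T * Q * P = T * T" using P Q T QP by (simp add: assoc_mult_mat[of _ n n _ n _ n])
  also have "mtrace (T * T) = (\<Sum>i<n. \<Sum>j<n. T $$ (i, j) * T $$ (j, i))" by (rule mtrace_mult[OF T T])
  also have "\<dots> = (\<Sum>i<n. \<Sum>j<n. if j = i then (T $$ (i, i))\<^sup>2 else 0)"
  proof (intro sum.cong refl)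
    fix i j assume ij: "i \<in> {..<n}" "j \<in> {..<n}"
    have "T $$ (i, j) = 0" if "j < i" using upper_triangularD[OF ut that] ij T by simp
    moreover have "T $$ (j, i) = 0" if "i < j" using upper_triangularD[OF ut that] ij T by simp
    ultimately show "T $$ (i, j) * T $$ (j, i) = (if j = i then (T $$ (i, i))\<^sup>2 else 0)"
      by (cases i j rule: linorder_cases) (auto simp: power2_eq_square)
  qed
  also have "\<dots> = (\<Sum>i<n. (T $$ (i, i))\<^sup>2)" by simp
  also have "\<dots> = (\<Sum>e\<leftarrow>es. e\<^sup>2)"
    unfolding diag[symmetric] diag_mat_def using T
    by (simp add: comp_def interv_sum_list_conv_sum_set_nat atLeast0LessThan)
  finally show ?thesis .
qed

lemma proots_linear_factors: "proots (\<Prod>e\<leftarrow>es. [:- e, 1 :: complex:]) = mset es"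
proof (induction es)
  case (Cons e es)
  have "(\<Prod>e\<leftarrow>es. [:- e, 1 :: complex:]) \<noteq> 0" by (auto simp: prod_list_zero_iff)
  moreover have "proots [:- e, 1:] = {#e#}"
    by (rule multiset_eqI) (use order_linear_power'[of e 1] in \<open>auto simp: order_0I\<close>)
  ultimately show ?case using Cons by (simp add: proots_mult del: mult_pCons_left)
qed simp

text \<open>
  The fourth powers of the singular values are the squares of the eigenvalues of B^2, so they add up
  to tr (B^4) = |B^2|_HS^2.
\<close>

lemma schatten_norm_4_hermitian:
  assumes B: "B \<in> carrier_mat n n" and herm: "hermitian_mat B"
  shows "(schatten_norm 4 B)\<^sup>2 = sqrt (\<Sum>i<n. \<Sum>j<n. (cmod ((B * B) $$ (i, j)))\<^sup>2)"
proof -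
  let ?A = "B * B"
  have A: "?A \<in> carrier_mat n n" using B by simp
  from char_poly_factorized[OF A] obtain es where cp: "char_poly ?A = (\<Prod>e\<leftarrow>es. [:- e, 1:])" by auto
  have ev: "0 \<le> Re e \<and> Im e = 0" if "e \<in> set es" for e
  proof -
    have "poly (char_poly ?A) e = 0" unfolding cp poly_prod_list using that by (auto simp: prod_list_zero_iff)
    then have "eigenvalue ?A e" by (simp add: eigenvalue_root_char_poly[OF A])
    then show ?thesis using hermitian_square_eigenvalue[OF B herm] by blast
  qed
  have "(\<Sum>\<sigma>\<in>#singular_values B. \<sigma> powr 4) = (\<Sum>e\<leftarrow>es. sqrt (Re e) powr 4)"
    using herm by (simp add: singular_values_def hermitian_mat_def cp proots_linear_factors sum_mset_sum_list comp_def
        flip: mset_map)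
  also have "\<dots> = (\<Sum>e\<leftarrow>es. Re (e\<^sup>2))"
  proof (intro arg_cong[where f=sum_list] map_cong refl)
    fix e assume "e \<in> set es"
    then have e: "0 \<le> Re e" "Im e = 0" using ev by auto
    then have "sqrt (Re e) powr 4 = sqrt (Re e) ^ 4"
      by (cases "Re e = 0") (auto simp: powr_numeral)
    also have "\<dots> = ((sqrt (Re e))\<^sup>2)\<^sup>2" by (simp flip: power_mult)
    also have "\<dots> = Re (e\<^sup>2)" using e by (simp add: power2_eq_square)
    finally show "sqrt (Re e) powr 4 = Re (e\<^sup>2)" .
  qed
  also have "\<dots> = Re (\<Sum>e\<leftarrow>es. e\<^sup>2)" by (induction es) auto
  also have "\<dots> = Re (mtrace (?A * ?A))" by (simp add: mtrace_square_eigenvalues[OF A cp])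
  also have "\<dots> = (\<Sum>i<n. \<Sum>j<n. Re (?A $$ (i, j) * ?A $$ (j, i)))" by (simp add: mtrace_mult[OF A A])
  also have "\<dots> = (\<Sum>i<n. \<Sum>j<n. (cmod (?A $$ (i, j)))\<^sup>2)"
  proof (intro sum.cong refl)
    fix i j assume ij: "i \<in> {..<n}" "j \<in> {..<n}"
    have "cnj (?A $$ (i, j)) = ?A $$ (j, i)"
      using ij B by (simp add: scalar_prod_def hermitian_entry[OF B herm] mult.commute)
    then have "?A $$ (i, j) * ?A $$ (j, i) = of_real ((cmod (?A $$ (i, j)))\<^sup>2)"
      unfolding complex_norm_square by (simp only:)
    then show "Re (?A $$ (i, j) * ?A $$ (j, i)) = (cmod (?A $$ (i, j)))\<^sup>2" by simp
  qed
  finally have S: "(\<Sum>\<sigma>\<in>#singular_values B. \<sigma> powr 4) = (\<Sum>i<n. \<Sum>j<n. (cmod (?A $$ (i, j)))\<^sup>2)" (is "_ = ?S") .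
  have "0 \<le> ?S" by (intro sum_nonneg) auto
  then have "(?S powr (1 / 4))\<^sup>2 = sqrt ?S"
    by (cases "?S = 0") (auto simp: powr_half_sqrt[symmetric] powr_powr powr_realpow[symmetric] simp flip: powr_numeral)
  then show ?thesis by (simp add: schatten_norm_def S)
qed

text \<open>
  1 = tr (B^2) is a sum of n diagonal entries of B^2; this is Cauchy-Schwarz against the vector of
  ones.
\<close>

lemma schatten_norm_4_lower:
  assumes B: "B \<in> carrier_mat n n" and herm: "hermitian_mat B" and one: "mtrace (B * B) = 1"
  shows "1 \<le> sqrt n * (schatten_norm 4 B)\<^sup>2"
proof -
  let ?A = "B * B"
  have "1 = cmod (\<Sum>i<n. ?A $$ (i, i))" using one B by (simp add: mtrace_def)
  also have "\<dots> \<le> (\<Sum>i<n. 1 * cmod (?A $$ (i, i)))" by (simp add: norm_sum)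
  also have "\<dots> \<le> L2_set (\<lambda>i. 1) {..<n} * L2_set (\<lambda>i. cmod (?A $$ (i, i))) {..<n}"
    using L2_set_mult_ineq[of "\<lambda>i. 1" "\<lambda>i. cmod (?A $$ (i, i))" "{..<n}"] by simp
  also have "\<dots> = sqrt n * sqrt (\<Sum>i<n. (cmod (?A $$ (i, i)))\<^sup>2)" by (simp add: L2_set_def)
  also have "\<dots> \<le> sqrt n * sqrt (\<Sum>i<n. \<Sum>j<n. (cmod (?A $$ (i, j)))\<^sup>2)"
    by (intro mult_left_mono real_sqrt_le_mono sum_mono member_le_sum) auto
  finally show ?thesis by (simp add: schatten_norm_4_hermitian[OF B herm])
qed

text \<open>
  The matrix X \<otimes> I of size n s, in the indexing by i * s + k.
\<close>

definition ampliation :: "nat \<Rightarrow> complex mat \<Rightarrow> nat \<Rightarrow> nat \<Rightarrow> complex" where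
  "ampliation s X a b = (if a mod s = b mod s then X $$ (a div s, b div s) else 0)"

lemma sum_blocks:
  fixes f :: "nat \<Rightarrow> 'b::comm_monoid_add"
  shows "(\<Sum>a<n * s. f a) = (\<Sum>i<n. \<Sum>k<s. f (i * s + k))"
proof -
  have shift: "sum f {c..<c + s} = (\<Sum>k<s. f (c + k))" for c
    by (induction s) (auto simp: sum.atLeastLessThan_Suc)
  show ?thesis by (simp add: sum.nat_group[symmetric] shift)
qed

lemma kernel_mult_ampliation:
  assumes s: "0 < s" and X: "X \<in> carrier_mat n n" and Y: "Y \<in> carrier_mat n n" and ab: "a < n * s" "b < n * s"
  shows "kernel_mult (n * s) (ampliation s X) (ampliation s Y) a b = ampliation s (X * Y) a b"
proof -
  have d: "a div s < n" "b div s < n" using ab s by (auto simp: less_mult_imp_div_less)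
  have "kernel_mult (n * s) (ampliation s X) (ampliation s Y) a b
    = (\<Sum>i<n. \<Sum>k<s. if a mod s = k then (if k = b mod s then X $$ (a div s, i) * Y $$ (i, b div s) else 0) else 0)"
    unfolding kernel_mult_def sum_blocks by (intro sum.cong refl) (auto simp: ampliation_def)
  also have "\<dots> = ampliation s (X * Y) a b"
    using s d X Y by (auto simp: ampliation_def scalar_prod_def lessThan_atLeast0 intro!: sum.cong)
  finally show ?thesis .
qed

lemma hs_norm2_ampliation:
  assumes s: "0 < s"
  shows "hs_norm2 (n * s) (ampliation s X) = s * (\<Sum>i<n. \<Sum>j<n. (cmod (X $$ (i, j)))\<^sup>2)"
proof -
  have "hs_norm2 (n * s) (ampliation s X)
    = (\<Sum>i<n. \<Sum>k<s. \<Sum>j<n. \<Sum>l<s. if k = l then (cmod (X $$ (i, j)))\<^sup>2 else 0)"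
    unfolding hs_norm2_def sum_blocks by (intro sum.cong refl) (auto simp: ampliation_def)
  also have "\<dots> = (\<Sum>i<n. \<Sum>k<s. \<Sum>j<n. (cmod (X $$ (i, j)))\<^sup>2)"
    by (intro sum.cong refl) simp
  finally show ?thesis by (simp add: sum_distrib_left)
qed

lemma trace_ampliation:
  assumes "0 < s" "X \<in> carrier_mat n n"
  shows "(\<Sum>a<n * s. Re (ampliation s X a a)) = s * Re (mtrace X)"
  using assms by (simp add: sum_blocks ampliation_def mtrace_def sum_distrib_left)

lemma density_coords_eq:
  assumes s: "0 < s" and B: "B j \<in> carrier_mat n n" and j: "j < d"
  shows "density_coords n s d B z j = inner_on {..<n * s} z (kernel_map (n * s) (ampliation s (B j)) z)"
proof -
  have R: "reduced_density n s z \<in> carrier_mat n n" by (simp add: reduced_density_def partial_trace2_def)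
  have "mtrace (reduced_density n s z * B j)
     = (\<Sum>i<n. \<Sum>i'<n. (\<Sum>k<s. z (i * s + k) * cnj (z (i' * s + k))) * B j $$ (i', i))"
    unfolding mtrace_mult[OF R B]
    by (intro sum.cong refl) (auto simp: reduced_density_def partial_trace2_def rank_one_def mult_add_less)
  also have "\<dots> = (\<Sum>i'<n. \<Sum>i<n. \<Sum>k<s. cnj (z (i' * s + k)) * (B j $$ (i', i) * z (i * s + k)))"
    by (subst sum.swap) (simp add: sum_distrib_left sum_distrib_right mult_ac)
  also have "\<dots> = (\<Sum>i'<n. \<Sum>k<s. \<Sum>i<n. cnj (z (i' * s + k)) * (B j $$ (i', i) * z (i * s + k)))"
    by (rule sum.cong[OF refl], rule sum.swap)
  also have "\<dots> = (\<Sum>i'<n. \<Sum>k<s. \<Sum>i<n. \<Sum>l<s. cnj (z (i' * s + k)) * (ampliation s (B j) (i' * s + k) (i * s + l) * z (i * s + l)))"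
  proof (intro sum.cong refl)
    fix i' k i assume k: "k \<in> {..<s}"
    have "(\<Sum>l<s. cnj (z (i' * s + k)) * (ampliation s (B j) (i' * s + k) (i * s + l) * z (i * s + l)))
       = (\<Sum>l<s. if k = l then cnj (z (i' * s + k)) * (B j $$ (i', i) * z (i * s + k)) else 0)"
      using k by (intro sum.cong refl) (auto simp: ampliation_def)
    then show "cnj (z (i' * s + k)) * (B j $$ (i', i) * z (i * s + k))
      = (\<Sum>l<s. cnj (z (i' * s + k)) * (ampliation s (B j) (i' * s + k) (i * s + l) * z (i * s + l)))"
      using k by simp
  qed
  also have "\<dots> = (\<Sum>a<n * s. cnj (z a) * (\<Sum>b<n * s. ampliation s (B j) a b * z b))"
    unfolding sum_blocks sum_distrib_left ..
  finally show ?thesis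
    using j by (simp add: density_coords_def inner_on_def kernel_map_def inner_complex_def)
qed

lemma kernel_map_scale: "kernel_map N (\<lambda>a b. of_real c * K a b) x = (\<lambda>a\<in>{..<N}. c *\<^sub>R kernel_map N K x a)"
  by (auto simp: kernel_map_def scaleR_conv_of_real sum_distrib_left mult.assoc)

locale hermitian_family =
  fixes n s d :: nat and B :: "nat \<Rightarrow> complex mat"
  assumes s_pos: "0 < s"
    and B_carrier: "\<And>j. j < d \<Longrightarrow> B j \<in> carrier_mat n n" and B_hermitian: "\<And>j. j < d \<Longrightarrow> hermitian_mat (B j)"
    and B_traceless: "\<And>j. j < d \<Longrightarrow> mtrace (B j) = 0"
    and B_orthonormal: "\<And>j k. j < d \<Longrightarrow> k < d \<Longrightarrow> mtrace (B j * B k) = (if j = k then 1 else 0)"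
begin

definition H :: "nat \<Rightarrow> nat \<Rightarrow> nat \<Rightarrow> complex" where
  "H j a b = of_real (1 / sqrt s) * ampliation s (B j) a b"

lemma kernel_mult_H:
  assumes "j < d" "k < d" "a < n * s" "b < n * s"
  shows "kernel_mult (n * s) (H j) (H k) a b = of_real (1 / s) * ampliation s (B j * B k) a b"
proof -
  have "kernel_mult (n * s) (H j) (H k) a b
    = of_real (1 / sqrt s) * of_real (1 / sqrt s) * kernel_mult (n * s) (ampliation s (B j)) (ampliation s (B k)) a b"
    unfolding kernel_mult_def H_def sum_distrib_left by (intro sum.cong refl) (simp add: mult_ac)
  also have "of_real (1 / sqrt s) * of_real (1 / sqrt s) = (of_real (1 / s) :: complex)"
    using s_pos by (simp flip: of_real_mult)
  finally show ?thesis using assms by (simp add: kernel_mult_ampliation[OF s_pos B_carrier B_carrier])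
qed

sublocale kernel_family "n * s" d H
proof
  fix j assume j: "j < d"
  show "hermitian_kernel (n * s) (H j)"
    unfolding hermitian_kernel_def
  proof (intro allI impI)
    fix a b assume "a < n * s" "b < n * s"
    then have "a div s < n" "b div s < n" using s_pos by (auto simp: less_mult_imp_div_less)
    then show "H j a b = cnj (H j b a)"
      by (simp add: H_def ampliation_def hermitian_entry[OF B_carrier[OF j] B_hermitian[OF j]])
  qed
  show "(\<Sum>a<n * s. Re (H j a a)) = 0"
    using trace_ampliation[OF s_pos B_carrier[OF j]] B_traceless[OF j] by (simp add: H_def flip: sum_divide_distrib)
  fix k assume k: "k < d"
  have "(\<Sum>a<n * s. Re (kernel_mult (n * s) (H j) (H k) a a)) = (\<Sum>a<n * s. 1 / s * Re (ampliation s (B j * B k) a a))"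
    by (intro sum.cong refl) (simp add: kernel_mult_H[OF j k])
  also have "\<dots> = 1 / s * (s * Re (mtrace (B j * B k)))"
    unfolding sum_distrib_left[symmetric]
    using trace_ampliation[OF s_pos, of "B j * B k" n] B_carrier[OF j] B_carrier[OF k] by simp
  finally show "(\<Sum>a<n * s. Re (kernel_mult (n * s) (H j) (H k) a a)) = kdelta j k"
    using s_pos B_orthonormal[OF j k] by (simp add: kdelta_def)
qed

lemma hs_norm2_H: 
  assumes j: "j < d"
  shows "sqrt (hs_norm2 (n * s) (kernel_mult (n * s) (H j) (H j))) = (schatten_norm 4 (B j))\<^sup>2 / sqrt s"
proof -
  have "hs_norm2 (n * s) (kernel_mult (n * s) (H j) (H j)) = (1 / s)\<^sup>2 * hs_norm2 (n * s) (ampliation s (B j * B j))"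
    unfolding hs_norm2_def sum_distrib_left
    by (intro sum.cong refl) (simp add: kernel_mult_H[OF j j] norm_mult norm_divide power_mult_distrib power_divide)
  also have "\<dots> = (\<Sum>i<n. \<Sum>k<n. (cmod ((B j * B j) $$ (i, k)))\<^sup>2) / s"
    using s_pos by (simp add: hs_norm2_ampliation[OF s_pos] power2_eq_square)
  finally show ?thesis
    by (simp add: schatten_norm_4_hermitian[OF B_carrier[OF j] B_hermitian[OF j]] real_sqrt_divide)
qed

lemma stein_discrepancy_schatten:
  "stein_discrepancy \<le> ((\<Sum>j<d. (schatten_norm 4 (B j))\<^sup>2) / sqrt s)\<^sup>2"
proof -
  have "(\<Sum>j<d. sqrt (hs_norm2 (n * s) (kernel_mult (n * s) (H j) (H j)))) = (\<Sum>j<d. (schatten_norm 4 (B j))\<^sup>2 / sqrt s)"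
    by (intro sum.cong refl hs_norm2_H) simp
  then show ?thesis using stein_discrepancy_le_square by (simp add: sum_divide_distrib)
qed

lemma Q_eq_density_coords:
  assumes j: "j < d"
  shows "Q j z = density_coords n s d B z j / (2 * sqrt s)"
proof -
  have "inner_on {..<n * s} z (kernel_map (n * s) (H j) z)
    = inner_on {..<n * s} z (\<lambda>a. (1 / sqrt s) *\<^sub>R kernel_map (n * s) (ampliation s (B j)) z a)"
    unfolding H_def[abs_def] kernel_map_scale by simp
  also have "\<dots> = density_coords n s d B z j / sqrt s"
    unfolding inner_on_linear by (simp add: density_coords_eq[where B = B and j = j, OF s_pos B_carrier[OF j] j])
  finally show ?thesis by (simp add: Q_def)
qed

end

section \<open>Direction and length of a complex Gaussian vector\<close>

lemma emeasure_lborel_scale: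
  fixes r :: real
  assumes r: "0 < r" and A: "A \<in> sets (lborel :: 'a::euclidean_space measure)"
  shows "emeasure lborel A = ennreal (r ^ DIM('a)) * emeasure lborel ((\<lambda>x. r *\<^sub>R x) -` A)"
proof -
  have "emeasure lborel A = emeasure (density (distr lborel borel (\<lambda>x. 0 + r *\<^sub>R x)) (\<lambda>_. ennreal (\<bar>r\<bar> ^ DIM('a)))) A"
    by (subst lborel_affine[of r 0]) (use r in auto)
  also have "\<dots> = ennreal (r ^ DIM('a)) * emeasure (distr lborel borel (\<lambda>x. r *\<^sub>R x)) A"
    using r A by (subst emeasure_density_const) auto
  also have "emeasure (distr lborel borel (\<lambda>x. r *\<^sub>R x)) A = emeasure lborel ((\<lambda>x. r *\<^sub>R x) -` A)"
    using A by (subst emeasure_distr) auto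
  finally show ?thesis .
qed

lemma nn_integral_lborel_vec_scale:
  fixes f :: "('i \<Rightarrow> 'a::euclidean_space) \<Rightarrow> ennreal"
  assumes I: "finite I" and r: "0 < r" and f [measurable]: "f \<in> borel_measurable (PiM I (\<lambda>_. borel))"
  shows "(\<integral>\<^sup>+x. f x \<partial>lborel_vec I) = ennreal (r ^ (DIM('a) * card I)) * (\<integral>\<^sup>+x. f (\<lambda>i\<in>I. r *\<^sub>R x i) \<partial>lborel_vec I)"
proof -
  interpret product_sigma_finite "\<lambda>_. lborel :: 'a measure" by standard
  let ?D = "distr (lborel_vec I) (lborel_vec I) (\<lambda>x. \<lambda>i\<in>I. r *\<^sub>R x i) :: ('i \<Rightarrow> 'a) measure"
  let ?c = "ennreal (r ^ (DIM('a) * card I))"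
  have "density ?D (\<lambda>_. ?c) = lborel_vec I"
  proof (rule PiM_eqI[OF I])
    fix A :: "'i \<Rightarrow> 'a set" assume A: "\<And>i. i \<in> I \<Longrightarrow> A i \<in> sets lborel"
    have B: "(\<lambda>x. r *\<^sub>R x) -` A i \<in> sets lborel" if "i \<in> I" for i
      using measurable_sets[of "\<lambda>x. r *\<^sub>R x" lborel lborel "A i"] A[OF that] by simp
    have Pi: "Pi\<^sub>E I A \<in> sets (lborel_vec I)" using A I by (intro sets_PiM_I_finite) auto
    have "emeasure (density ?D (\<lambda>_. ?c)) (Pi\<^sub>E I A) = ?c * emeasure ?D (Pi\<^sub>E I A)"
      using Pi by (subst emeasure_density_const) auto
    also have "emeasure ?D (Pi\<^sub>E I A) = emeasure (lborel_vec I) (Pi\<^sub>E I (\<lambda>i. (\<lambda>x. r *\<^sub>R x) -` A i))"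
      using Pi A I
      by (subst emeasure_distr)
         (auto simp: space_PiM PiE_iff extensional_def intro!: arg_cong[where f="emeasure (lborel_vec I)"])
    also have "\<dots> = (\<Prod>i\<in>I. emeasure lborel ((\<lambda>x. r *\<^sub>R x) -` A i))"
      using I B by (subst emeasure_PiM) auto
    also have "?c * \<dots> = (\<Prod>i\<in>I. ennreal (r ^ DIM('a)) * emeasure lborel ((\<lambda>x. r *\<^sub>R x) -` A i))"
      using r by (simp add: prod.distrib power_mult flip: ennreal_power)
    also have "\<dots> = (\<Prod>i\<in>I. emeasure lborel (A i))"
      using emeasure_lborel_scale[OF r A] by (intro prod.cong) auto
    finally show "emeasure (density ?D (\<lambda>_. ?c)) (Pi\<^sub>E I A) = (\<Prod>i\<in>I. emeasure lborel (A i))" .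
  qed simp
  then have "(\<integral>\<^sup>+x. f x \<partial>lborel_vec I) = (\<integral>\<^sup>+x. f x \<partial>density ?D (\<lambda>_. ?c))" by simp
  also have "\<dots> = ?c * (\<integral>\<^sup>+x. f (\<lambda>i\<in>I. r *\<^sub>R x i) \<partial>lborel_vec I)"
    by (subst nn_integral_density) (auto simp: nn_integral_distr nn_integral_cmult)
  finally show ?thesis .
qed

definition sqnorm :: "nat \<Rightarrow> (nat \<Rightarrow> complex) \<Rightarrow> real" where
  "sqnorm N z = inner_on {..<N} z z"

definition direction :: "nat \<Rightarrow> (nat \<Rightarrow> complex) \<Rightarrow> nat \<Rightarrow> complex" where
  "direction N z = (\<lambda>a\<in>{..<N}. z a / complex_of_real (L2_set (\<lambda>a. cmod (z a)) {..<N}))"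

lemma L2_set_sqnorm: "L2_set (\<lambda>a. cmod (z a)) {..<N} = sqrt (sqnorm N z)"
  by (simp add: L2_set_def sqnorm_def inner_on_def power2_norm_eq_inner)

lemma sqnorm_nonneg: "0 \<le> sqnorm N z" by (simp add: sqnorm_def inner_on_nonneg)

lemma sqnorm_measurable [measurable]: "sqnorm N \<in> borel_measurable (PiM {..<N} (\<lambda>_. borel))"
  unfolding sqnorm_def[abs_def] by measurable

lemma direction_measurable [measurable]: "direction N \<in> PiM {..<N} (\<lambda>_. borel) \<rightarrow>\<^sub>M PiM {..<N} (\<lambda>_. borel)"
  unfolding direction_def[abs_def] L2_set_sqnorm by measurable

lemma sqnorm_scale: "sqnorm N (\<lambda>i\<in>{..<N}. r *\<^sub>R z i) = r\<^sup>2 * sqnorm N z"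
  by (simp add: sqnorm_def inner_on_linear power2_eq_square)

lemma direction_scale:
  assumes "0 < r" shows "direction N (\<lambda>i\<in>{..<N}. r *\<^sub>R z i) = direction N z"
  unfolding direction_def L2_set_sqnorm sqnorm_scale
  using assms by (intro restrict_ext) (simp add: real_sqrt_mult scaleR_conv_of_real)

lemma direction_eq: "a < N \<Longrightarrow> direction N z a = (1 / sqrt (sqnorm N z)) *\<^sub>R z a"
  by (simp add: direction_def L2_set_sqnorm scaleR_conv_of_real divide_inverse mult.commute)

abbreviation all_vectors :: "nat \<Rightarrow> (nat \<Rightarrow> complex) set" where
  "all_vectors N \<equiv> space (PiM {..<N} (\<lambda>_. borel))"

lemma indicator_direction: "indicator (all_vectors N) (direction N z) = (1 :: ennreal)"
  by (auto simp: direction_def space_PiM indicator_def)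

text \<open>
  The volume of the part of the open unit ball with direction in A.
\<close>

definition cone_volume :: "nat \<Rightarrow> (nat \<Rightarrow> complex) set \<Rightarrow> ennreal" where
  "cone_volume N A = (\<integral>\<^sup>+z. indicator A (direction N z) * indicator {..<1} (sqnorm N z) \<partial>lborel_vec {..<N})"

lemma cone_volume_scale:
  assumes A [measurable]: "A \<in> sets (PiM {..<N} (\<lambda>_. borel))"
  shows "(\<integral>\<^sup>+z. indicator A (direction N z) * indicator {..<u} (sqnorm N z) \<partial>lborel_vec {..<N})
    = ennreal (if 0 < u then u ^ N else 0) * cone_volume N A"
proof (cases "0 < u")
  case True
  define r where "r = sqrt u"
  have r: "0 < r" "r\<^sup>2 = u" using True by (auto simp: r_def)
  have "(\<integral>\<^sup>+z. indicator A (direction N z) * indicator {..<u} (sqnorm N z) \<partial>lborel_vec {..<N})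
    = ennreal (r ^ (DIM(complex) * card {..<N})) * (\<integral>\<^sup>+z. indicator A (direction N (\<lambda>i\<in>{..<N}. r *\<^sub>R z i))
        * indicator {..<u} (sqnorm N (\<lambda>i\<in>{..<N}. r *\<^sub>R z i)) \<partial>lborel_vec {..<N})"
    by (rule nn_integral_lborel_vec_scale[OF _ r(1)]) auto
  also have "r ^ (DIM(complex) * card {..<N}) = u ^ N" by (simp add: power_mult r(2))
  also have "(\<integral>\<^sup>+z. indicator A (direction N (\<lambda>i\<in>{..<N}. r *\<^sub>R z i))
        * indicator {..<u} (sqnorm N (\<lambda>i\<in>{..<N}. r *\<^sub>R z i)) \<partial>lborel_vec {..<N}) = cone_volume N A"
    unfolding cone_volume_def direction_scale[OF r(1)] sqnorm_scale r(2)
    using True by (intro nn_integral_cong) (auto simp: indicator_def)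
  finally show ?thesis using True by simp
next
  case False
  have "indicator {..<u} (sqnorm N z) = (0 :: ennreal)" for z
    using False sqnorm_nonneg[of N z] by (auto simp: indicator_def)
  then show ?thesis using False by simp
qed

lemma cone_volume_finite: "cone_volume N A < \<infinity>"
proof -
  interpret product_sigma_finite "\<lambda>_. lborel :: complex measure" by standard
  have "cone_volume N A \<le> (\<integral>\<^sup>+z. indicator (Pi\<^sub>E {..<N} (\<lambda>_. ball (0::complex) 1)) z \<partial>lborel_vec {..<N})"
    unfolding cone_volume_def
  proof (rule nn_integral_mono)
    fix z :: "nat \<Rightarrow> complex" assume z: "z \<in> space (lborel_vec {..<N})"
    have "z \<in> Pi\<^sub>E {..<N} (\<lambda>_. ball (0::complex) 1)" if "sqnorm N z < 1"
    proof -
      have "cmod (z a) < 1" if a: "a < N" for a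
      proof -
        have "inner (z a) (z a) \<le> sqnorm N z"
          unfolding sqnorm_def inner_on_def using a by (intro member_le_sum) auto
        then have "(cmod (z a))\<^sup>2 < 1" using \<open>sqnorm N z < 1\<close> by (simp add: power2_norm_eq_inner)
        then show ?thesis by (simp add: power_less_one_iff abs_square_less_1)
      qed
      then show ?thesis using z by (auto simp: space_PiM PiE_iff)
    qed
    then show "indicator A (direction N z) * indicator {..<1} (sqnorm N z)
        \<le> (indicator (Pi\<^sub>E {..<N} (\<lambda>_. ball (0::complex) 1)) z :: ennreal)"
      by (auto simp: indicator_def)
  qed
  also have "\<dots> = emeasure (lborel_vec {..<N}) (Pi\<^sub>E {..<N} (\<lambda>_. ball (0::complex) 1))"
    by (rule nn_integral_indicator) (auto intro!: sets_PiM_I_finite)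
  also have "\<dots> = (\<Prod>a<N. emeasure lborel (ball (0::complex) 1))"
    by (subst emeasure_PiM) auto
  also have "\<dots> < \<infinity>"
    using emeasure_bounded_finite[of "ball (0::complex) 1"] by (simp add: power_less_top_ennreal)
  finally show ?thesis .
qed

text \<open>
  By scaling, the part of a ball of radius sqrt u with direction in A has volume u^N times the cone
  volume of A. So the image under the squared norm of Lebesgue measure restricted to directions in A
  is a multiple of a measure that does not depend on A. The measures are compared after the
  substitution t = - |z|^2, under which balls become the half-lines that determine a measure.
\<close>

lemma direction_radius_lebesgue:
  assumes A [measurable]: "A \<in> sets (PiM {..<N} (\<lambda>_. borel))" and k [measurable]: "k \<in> borel_measurable borel"
  shows "cone_volume N (all_vectors N) * (\<integral>\<^sup>+z. indicator A (direction N z) * k (sqnorm N z) \<partial>lborel_vec {..<N})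
    = cone_volume N A * (\<integral>\<^sup>+z. k (sqnorm N z) \<partial>lborel_vec {..<N})"
proof -
  let ?L = "lborel_vec {..<N} :: (nat \<Rightarrow> complex) measure"
  \<comment> \<open>the image of Lebesgue measure on the cone over S under z \<mapsto> - |z|^2, weighted by c\<close>
  define M where "M c S = distr (density ?L (\<lambda>z. c * indicator S (direction N z))) borel (\<lambda>z. - sqnorm N z)" for c S
  have int: "(\<integral>\<^sup>+t. g t \<partial>M c S) = c * (\<integral>\<^sup>+z. indicator S (direction N z) * g (- sqnorm N z) \<partial>?L)"
    if [measurable]: "S \<in> sets (PiM {..<N} (\<lambda>_. borel))" "g \<in> borel_measurable borel" for c S and g :: "real \<Rightarrow> ennreal"
    unfolding M_def by (subst nn_integral_distr, simp, simp, subst nn_integral_density)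
       (auto simp: mult.assoc nn_integral_cmult)
  have em: "emeasure (M c S) {x<..} = c * (ennreal (if 0 < - x then (- x) ^ N else 0) * cone_volume N S)"
    if S: "S \<in> sets (PiM {..<N} (\<lambda>_. borel))" for c S x
  proof -
    have "emeasure (M c S) {x<..} = (\<integral>\<^sup>+t. indicator {x<..} t \<partial>M c S)"
      by (rule nn_integral_indicator[symmetric]) (simp add: M_def)
    also have "\<dots> = c * (\<integral>\<^sup>+z. indicator S (direction N z) * indicator {..<- x} (sqnorm N z) \<partial>?L)"
      by (subst int[OF S]) (auto intro!: arg_cong[where f="\<lambda>y. c * y"] nn_integral_cong simp: indicator_def)
    also have "\<dots> = c * (ennreal (if 0 < - x then (- x) ^ N else 0) * cone_volume N S)"
      unfolding cone_volume_scale[OF S] ..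
    finally show ?thesis .
  qed
  have "M (cone_volume N (all_vectors N)) A = M (cone_volume N A) (all_vectors N)"
  proof (rule measure_eqI_lessThan)
    fix x
    show "emeasure (M (cone_volume N (all_vectors N)) A) {x<..} < \<infinity>"
      unfolding em[OF A] using cone_volume_finite[of N A] cone_volume_finite[of N "all_vectors N"]
      by (simp add: ennreal_mult_less_top)
    show "emeasure (M (cone_volume N (all_vectors N)) A) {x<..} = emeasure (M (cone_volume N A) (all_vectors N)) {x<..}"
      unfolding em[OF A] em[OF sets.top] by (simp add: mult_ac)
  qed (simp_all add: M_def)
  then have "(\<integral>\<^sup>+t. k (- t) \<partial>M (cone_volume N (all_vectors N)) A) = (\<integral>\<^sup>+t. k (- t) \<partial>M (cone_volume N A) (all_vectors N))" by simp
  then show ?thesis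
    by (simp add: int[OF A] int[OF sets.top] indicator_direction)
qed

lemma gauss_vec_density_sqnorm:
  "gauss_vec_density {..<N} z = exp (- sqnorm N z / 2) / sqrt (2 * pi) ^ (2 * N)"
  by (simp add: gauss_vec_density_def sqnorm_def)

text \<open>
  Otherwise every ball is a null set by scaling, so Lebesgue measure is zero and the Gaussian measure
  cannot have mass 1.
\<close>

lemma cone_volume_pos: "cone_volume N (all_vectors N) \<noteq> 0"
proof
  assume 0: "cone_volume N (all_vectors N) = 0"
  let ?L = "lborel_vec {..<N} :: (nat \<Rightarrow> complex) measure"
  interpret G: prob_space "gaussC N" by (rule prob_space_gauss_vec)
  have "AE z in ?L. \<not> sqnorm N z < u" for u
  proof -
    have "(\<integral>\<^sup>+z. indicator {..<u} (sqnorm N z) \<partial>?L) = 0"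
      using cone_volume_scale[OF sets.top, of N u] 0 indicator_direction by simp
    then have "AE z in ?L. indicator {..<u} (sqnorm N z) = (0::ennreal)"
      by (subst (asm) nn_integral_0_iff_AE) auto
    then show ?thesis by eventually_elim (auto simp: indicator_def split: if_splits)
  qed
  then have "AE z in ?L. \<forall>u::nat. \<not> sqnorm N z < real u" by (simp add: AE_all_countable)
  then have "AE z in ?L. False" by eventually_elim (use reals_Archimedean2 in blast)
  then have "(\<integral>\<^sup>+z. ennreal (gauss_vec_density {..<N} z) * 1 \<partial>?L) = 0"
    by (intro nn_integral_zero') (auto elim: eventually_mono)
  moreover have "(\<integral>\<^sup>+z. ennreal (gauss_vec_density {..<N} z) * 1 \<partial>?L) = 1"
    using nn_integral_gauss_vec[of "{..<N}" "\<lambda>_::nat \<Rightarrow> complex. 1"] G.emeasure_space_1 by simp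
  ultimately show False by simp
qed

text \<open>
  The sphere measure is defined by means of the closed unit ball, the cone volume by means of the open
  one. Their ratios agree by direction_radius_lebesgue applied to the indicator function of t \<le> 1.
\<close>

lemma emeasure_sphere_measure:
  assumes A [measurable]: "A \<in> sets (PiM {..<N} (\<lambda>_. borel))"
  shows "cone_volume N (all_vectors N) * emeasure (sphere_measure N) A = cone_volume N A"
proof -
  let ?L = "lborel_vec {..<N} :: (nat \<Rightarrow> complex) measure"
  let ?ball = "{z \<in> space ?L. L2_set (\<lambda>a. cmod (z a)) {..<N} \<le> 1}"
  have ball: "?ball = {z \<in> space ?L. sqnorm N z \<le> 1}"
    unfolding L2_set_sqnorm by auto
  have ball_sets [measurable]: "?ball \<in> sets ?L" unfolding ball by measurable
  define V where "V = emeasure ?L ?ball"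
  have "direction N \<in> ?L \<rightarrow>\<^sub>M PiM {..<N} (\<lambda>_. borel)" by measurable
  then have pre [measurable]: "direction N -` A \<inter> space ?L \<in> sets ?L" by (rule measurable_sets[OF _ A])
  have ind: "indicator ?ball z = (indicator {..1} (sqnorm N z) :: ennreal)" if "z \<in> space ?L" for z
    using that unfolding ball by (auto simp: indicator_def)
  have V: "V = (\<integral>\<^sup>+z. indicator {..1} (sqnorm N z) \<partial>?L)"
  proof -
    have "V = (\<integral>\<^sup>+z. indicator ?ball z \<partial>?L)"
      unfolding V_def by (rule nn_integral_indicator[OF ball_sets, symmetric])
    also have "\<dots> = (\<integral>\<^sup>+z. indicator {..1} (sqnorm N z) \<partial>?L)"
      by (rule nn_integral_cong) (rule ind)
    finally show ?thesis .
  qed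
  have "emeasure (sphere_measure N) A = emeasure (uniform_measure ?L ?ball) (direction N -` A \<inter> space ?L)"
    unfolding sphere_measure_def Let_def direction_def[symmetric]
    by (subst emeasure_distr) (auto simp: uniform_measure_def)
  also have "\<dots> = emeasure ?L (?ball \<inter> (direction N -` A \<inter> space ?L)) / V"
    unfolding V_def by (rule emeasure_uniform_measure[OF ball_sets pre])
  also have "emeasure ?L (?ball \<inter> (direction N -` A \<inter> space ?L))
      = (\<integral>\<^sup>+z. indicator A (direction N z) * indicator {..1} (sqnorm N z) \<partial>?L)"
    unfolding nn_integral_indicator[OF sets.Int[OF ball_sets pre], symmetric]
    by (intro nn_integral_cong) (auto simp: L2_set_sqnorm indicator_def)
  finally have *: "cone_volume N (all_vectors N) * emeasure (sphere_measure N) A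
      = cone_volume N (all_vectors N) * (\<integral>\<^sup>+z. indicator A (direction N z) * indicator {..1} (sqnorm N z) \<partial>?L) / V"
    by (simp add: ennreal_times_divide)
  also have "\<dots> = cone_volume N A * V / V"
    unfolding V by (subst direction_radius_lebesgue[OF A]) auto
  also have "\<dots> = cone_volume N A"
  proof -
    have "cone_volume N (all_vectors N) \<le> V"
      unfolding V cone_volume_def by (intro nn_integral_mono) (auto simp: indicator_def)
    then have "V \<noteq> 0" using cone_volume_pos[of N] by auto
    moreover have "V < \<infinity>"
    proof -
      have "V \<le> (\<integral>\<^sup>+z. indicator (all_vectors N) (direction N z) * indicator {..<2} (sqnorm N z) \<partial>?L)"
        unfolding V indicator_direction by (intro nn_integral_mono) (auto simp: indicator_def)
      also have "\<dots> < \<infinity>"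
        unfolding cone_volume_scale[OF sets.top] using cone_volume_finite by (simp add: ennreal_mult_less_top)
      finally show ?thesis .
    qed
    ultimately show ?thesis by (simp add: ennreal_mult_divide_eq)
  qed
  finally show ?thesis .
qed

text \<open>
  The Gaussian density is a function of the norm, so it can be absorbed into the test function k of
  the Lebesgue version.
\<close>

lemma direction_radius_independent:
  assumes f [measurable]: "f \<in> borel_measurable (PiM {..<N} (\<lambda>_. borel))"
    and h [measurable]: "h \<in> borel_measurable borel"
  shows "(\<integral>\<^sup>+z. f (direction N z) * h (sqnorm N z) \<partial>gaussC N)
    = (\<integral>\<^sup>+z. f z \<partial>sphere_measure N) * (\<integral>\<^sup>+z. h (sqnorm N z) \<partial>gaussC N)"
proof -
  let ?B = "PiM {..<N} (\<lambda>_. borel) :: (nat \<Rightarrow> complex) measure"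
  define c where "c = (\<integral>\<^sup>+z. h (sqnorm N z) \<partial>gaussC N)"
  define D where "D = distr (density (gaussC N) (\<lambda>z. h (sqnorm N z))) ?B (direction N)"
  have sets_sphere [measurable_cong]: "sets (sphere_measure N) = sets ?B"
    by (simp add: sphere_measure_def Let_def)
  have set_eq: "emeasure D A = c * emeasure (sphere_measure N) A" if A [measurable]: "A \<in> sets ?B" for A
  proof -
    define k where "k t = ennreal (exp (- t / 2) / sqrt (2 * pi) ^ (2 * N)) * h t" for t
    have [measurable]: "k \<in> borel_measurable borel" unfolding k_def[abs_def] by measurable
    have kint: "(\<integral>\<^sup>+z. g z * h (sqnorm N z) \<partial>gaussC N) = (\<integral>\<^sup>+z. g z * k (sqnorm N z) \<partial>lborel_vec {..<N})"
      if [measurable]: "g \<in> borel_measurable ?B" for g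
      by (subst nn_integral_gauss_vec) (auto simp: k_def gauss_vec_density_sqnorm mult_ac)
    have "emeasure D A = (\<integral>\<^sup>+z. indicator A z \<partial>D)"
      by (rule nn_integral_indicator[symmetric]) (simp add: D_def)
    also have "\<dots> = (\<integral>\<^sup>+z. indicator A (direction N z) * h (sqnorm N z) \<partial>gaussC N)"
      unfolding D_def by (subst nn_integral_distr, measurable, subst nn_integral_density) (auto simp: mult.commute)
    also have "\<dots> = (\<integral>\<^sup>+z. indicator A (direction N z) * k (sqnorm N z) \<partial>lborel_vec {..<N})"
      by (rule kint) measurable
    finally have "cone_volume N (all_vectors N) * emeasure D A
      = cone_volume N A * (\<integral>\<^sup>+z. k (sqnorm N z) \<partial>lborel_vec {..<N})"
      using direction_radius_lebesgue[OF A, of k] by simp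
    also have "(\<integral>\<^sup>+z. k (sqnorm N z) \<partial>lborel_vec {..<N}) = c"
      using kint[of "\<lambda>_. 1"] by (simp add: c_def)
    also have "cone_volume N A * c = cone_volume N (all_vectors N) * (c * emeasure (sphere_measure N) A)"
      unfolding emeasure_sphere_measure[OF A, symmetric] by (simp add: mult_ac)
    finally show ?thesis
      using cone_volume_pos[of N] cone_volume_finite[of N "all_vectors N"]
      by (metis ennreal_mult_cancel_left infinity_ennreal_def less_irrefl)
  qed
  have "D = scale_measure c (sphere_measure N)"
    by (rule measure_eqI) (auto simp: D_def[THEN arg_cong[where f=sets]] sets_sphere set_eq)
  then have "(\<integral>\<^sup>+z. f z \<partial>D) = c * (\<integral>\<^sup>+z. f z \<partial>sphere_measure N)"
    by (simp add: nn_integral_scale_measure)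
  moreover have "(\<integral>\<^sup>+z. f z \<partial>D) = (\<integral>\<^sup>+z. f (direction N z) * h (sqnorm N z) \<partial>gaussC N)"
    unfolding D_def by (subst nn_integral_distr, measurable, subst nn_integral_density) (auto simp: mult.commute)
  ultimately show ?thesis by (simp add: c_def mult.commute)
qed

lemma sets_sphere_measure [measurable_cong]: "sets (sphere_measure N) = sets (PiM {..<N} (\<lambda>_. borel))"
  by (simp add: sphere_measure_def Let_def)

lemma sphere_measure_eq_distr: "sphere_measure N = distr (gaussC N) (PiM {..<N} (\<lambda>_. borel)) (direction N)"
proof (rule measure_eqI)
  interpret G: prob_space "gaussC N" by (rule prob_space_gauss_vec)
  fix A assume "A \<in> sets (sphere_measure N)"
  then have A [measurable]: "A \<in> sets (PiM {..<N} (\<lambda>_. borel))" by (simp add: sets_sphere_measure)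
  have "emeasure (distr (gaussC N) (PiM {..<N} (\<lambda>_. borel)) (direction N)) A
      = (\<integral>\<^sup>+z. indicator A z \<partial>distr (gaussC N) (PiM {..<N} (\<lambda>_. borel)) (direction N))"
    by (rule nn_integral_indicator[symmetric]) simp
  also have "\<dots> = (\<integral>\<^sup>+z. indicator A (direction N z) * 1 \<partial>gaussC N)"
    by (subst nn_integral_distr) auto
  also have "\<dots> = (\<integral>\<^sup>+z. indicator A z \<partial>sphere_measure N)"
    by (subst direction_radius_independent[of _ N "\<lambda>_. 1"]) (use G.emeasure_space_1 in auto)
  also have "\<dots> = emeasure (sphere_measure N) A" by (rule nn_integral_indicator) simp
  finally show "emeasure (sphere_measure N) A = emeasure (distr (gaussC N) (PiM {..<N} (\<lambda>_. borel)) (direction N)) A" ..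
qed (simp add: sets_sphere_measure)

section \<open>The Wasserstein bound\<close>

text \<open>
  The squared norm is the form with matrix I, of trace N and squared Hilbert-Schmidt norm N.
\<close>

lemma gauss_radius_moments:
  "square_integrable (gaussC N) (sqnorm N)" "(\<integral>z. sqnorm N z \<partial>gaussC N) = 2 * N"
  "(\<integral>z. (sqnorm N z)\<^sup>2 \<partial>gaussC N) = 4 * N * (N + 1)"
proof -
  interpret G: prob_space "gaussC N" by (rule prob_space_gauss_vec)
  define K where "K a b = (if a = b then 1 else 0 :: complex)" for a b :: nat
  have form: "inner_on {..<N} z (kernel_map N K z) = sqnorm N z" for z
  proof -
    have "K a b * z b = (if b = a then z b else 0)" for a b by (simp add: K_def)
    then show ?thesis unfolding sqnorm_def by (intro inner_on_cong) (simp_all add: kernel_map_def)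
  qed
  have herm: "hermitian_kernel N K" by (simp add: hermitian_kernel_def K_def)
  have tr: "(\<Sum>a<N. Re (K a a)) = N" by (simp add: K_def)
  have hs: "hs_norm2 N K = N"
  proof -
    have "(cmod (K a b))\<^sup>2 = (if a = b then 1 else 0)" for a b by (simp add: K_def)
    then show ?thesis by (simp add: hs_norm2_def)
  qed
  show sq: "square_integrable (gaussC N) (sqnorm N)"
    using square_kernel_forms(2)[of N K] by (simp add: form)
  show m: "(\<integral>z. sqnorm N z \<partial>gaussC N) = 2 * N"
    using mean_kernel_form[of N K] by (simp add: form tr)
  have int: "integrable (gaussC N) (sqnorm N)" "integrable (gaussC N) (\<lambda>z. (sqnorm N z)\<^sup>2)"
    using G.square_integrable_integrable[OF sq] sq by (auto simp: square_integrable_def)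
  have "4 * real N = (\<integral>z. (sqnorm N z - 2 * N)\<^sup>2 \<partial>gaussC N)"
    using variance_kernel_form[OF herm] by (simp add: form tr hs)
  also have "\<dots> = (\<integral>z. (sqnorm N z)\<^sup>2 - 4 * N * sqnorm N z + 4 * (real N)\<^sup>2 \<partial>gaussC N)"
    by (intro Bochner_Integration.integral_cong refl) (simp add: power2_eq_square algebra_simps)
  also have "\<dots> = (\<integral>z. (sqnorm N z)\<^sup>2 \<partial>gaussC N) - 4 * N * (2 * N) + 4 * (real N)\<^sup>2"
    using int m G.prob_space by simp
  finally show "(\<integral>z. (sqnorm N z)\<^sup>2 \<partial>gaussC N) = 4 * N * (N + 1)"
    by (simp add: power2_eq_square algebra_simps)
qed

lemma (in prob_space) nn_integral_le_sqrt:
  fixes f :: "'a \<Rightarrow> real"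
  assumes f [measurable]: "f \<in> borel_measurable M" and nonneg: "\<And>x. 0 \<le> f x" and k: "0 \<le> k"
    and le: "(\<integral>\<^sup>+x. ennreal ((f x)\<^sup>2) \<partial>M) \<le> ennreal k"
  shows "(\<integral>\<^sup>+x. ennreal (f x) \<partial>M) \<le> ennreal (sqrt k)"
proof -
  have fin: "(\<integral>\<^sup>+x. ennreal ((f x)\<^sup>2) \<partial>M) < \<infinity>" using le by (simp add: le_less_trans)
  then have int2: "integrable M (\<lambda>x. (f x)\<^sup>2)" by (intro integrableI_nonneg) auto
  then have sq: "square_integrable M f" by (simp add: square_integrable_def)
  have int: "integrable M f" by (rule square_integrable_integrable[OF sq])
  have "(expectation f)\<^sup>2 \<le> expectation (\<lambda>x. (f x)\<^sup>2)"
  proof -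
    have "0 \<le> variance f" by simp
    then show ?thesis using variance_eq[OF int int2] by simp
  qed
  also have "\<dots> \<le> k"
    using le k nn_integral_eq_integral[OF int2] by simp
  finally have "expectation f \<le> sqrt k" by (simp add: real_le_rsqrt)
  then show ?thesis
    using nn_integral_eq_integral[OF int] nonneg by (simp add: ennreal_leI)
qed

context hermitian_family
begin

definition X :: "(nat \<Rightarrow> complex) \<Rightarrow> nat \<Rightarrow> real" where
  "X z = (\<lambda>j\<in>{..<d}. sqrt (real n * (real n * real s + 1)) * density_coords n s d B z j)"

abbreviation "ns \<equiv> n * s"

lemma X_measurable [measurable]: "X \<in> PiM {..<ns} (\<lambda>_. borel) \<rightarrow>\<^sub>M borel_vec d"
proof -
  have [measurable]: "(\<lambda>z. density_coords n s d B z j) \<in> borel_measurable (PiM {..<ns} (\<lambda>_. borel))" if j: "j < d" for j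
  proof -
    have "density_coords n s d B z j = 2 * sqrt s * Q j z" for z
      using s_pos Q_eq_density_coords[OF j] by simp
    moreover have "(\<lambda>z. Q j z) \<in> borel_measurable (PiM {..<ns} (\<lambda>_. borel))"
      by (rule Q_measurable[OF j]) measurable
    ultimately show ?thesis by simp
  qed
  show ?thesis unfolding X_def[abs_def] by measurable
qed

lemma Q_direction:
  assumes j: "j < d"
  shows "Q j z = sqnorm ns z * Q j (direction ns z)"
proof -
  let ?r = "sqrt (sqnorm ns z)"
  have "Q j (direction ns z) = Q j (\<lambda>i\<in>{..<ns}. (1 / ?r) *\<^sub>R z i + 0 *\<^sub>R z i)"
  proof -
    have "direction ns z = (\<lambda>i\<in>{..<ns}. (1 / ?r) *\<^sub>R z i + 0 *\<^sub>R z i)"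
      by (rule ext) (auto simp: direction_eq restrict_def, simp add: direction_def)
    then show ?thesis by simp
  qed
  also have "\<dots> = (1 / ?r)\<^sup>2 * Q j z"
    unfolding Q_rotate[OF j] by simp
  finally have eq: "Q j (direction ns z) = (1 / ?r)\<^sup>2 * Q j z" .
  show ?thesis
  proof (cases "sqnorm ns z = 0")
    case False
    then show ?thesis using sqnorm_nonneg[of ns z] by (simp add: eq power_divide)
  next
    case True
    have "z i = 0" if "i < ns" for i
      using True that unfolding sqnorm_def inner_on_def by (subst (asm) sum_nonneg_eq_0_iff) auto
    then have "Q j z = 0" by (simp add: Q_def inner_on_def)
    then show ?thesis by (simp add: True)
  qed
qed

definition radius_scale :: real where "radius_scale = sqrt (real ns * (real ns + 1))"

lemma X_eq_Q:
  assumes j: "j < d" shows "X z j = 2 * radius_scale * Q j z"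
proof -
  have "real n * (real n * real s + 1) * real s = real ns * (real ns + 1)" by simp
  then have "sqrt (real n * (real n * real s + 1)) * sqrt s = radius_scale"
    unfolding radius_scale_def by (simp flip: real_sqrt_mult)
  moreover have "X z j = sqrt (real n * (real n * real s + 1)) * (2 * sqrt s * Q j z)"
    using j s_pos Q_eq_density_coords[OF j] by (simp add: X_def)
  ultimately show ?thesis by (simp add: mult_ac)
qed

text \<open>
  With R = |z|^2 and c = radius_scale, Q_j is X_j R / (2 c), and (R / (2 c))^2 has mean 1. By
  independence X_j has mean square E Q_j^2 = 1. Therefore
  E (X_j - Q_j)^2 = E (1 - R / (2 c))^2 = 2 - 2 N / sqrt (N (N + 1)), which is at most 2 / N.
\<close>

lemma X_direction_dist:
  assumes ns: "0 < ns"
  shows "(\<integral>\<^sup>+z. ennreal (\<Sum>j<d. (X (direction ns z) j - Q j z)\<^sup>2) \<partial>gaussC ns) \<le> ennreal (2 * real d / real ns)"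
proof -
  let ?G = "gaussC ns"
  define c where "c = radius_scale"
  have pos: "0 < real ns * (real ns + 1)" using ns by (intro mult_pos_pos add_nonneg_pos) auto
  then have c: "0 < c" unfolding c_def radius_scale_def by (rule real_sqrt_gt_zero)
  have c2: "c\<^sup>2 = ns * (real ns + 1)"
    unfolding c_def radius_scale_def using pos by (intro real_sqrt_pow2 less_imp_le)
  have QX: "Q j z = X (direction ns z) j * (sqnorm ns z / (2 * c))" if "j < d" for j z
    using Q_direction[OF that, of z] X_eq_Q[OF that, of "direction ns z"] c by (simp add: c_def)
  have Xm: "(\<lambda>z. ennreal ((X z j)\<^sup>2)) \<in> borel_measurable (PiM {..<ns} (\<lambda>_. borel))" if "j < d" for j
    using measurable_compose[OF X_measurable measurable_component_singleton[of j "{..<d}"]] that by simp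
  interpret G: prob_space ?G by (rule prob_space_gauss_vec)
  note moments = gauss_radius_moments[of ns]
  have sq: "square_integrable ?G (\<lambda>z. sqnorm ns z / (2 * c))"
    using square_integrable_cmult[OF moments(1), of "1 / (2 * c)"] by simp
  have int: "integrable ?G (sqnorm ns)" "integrable ?G (\<lambda>z. (sqnorm ns z)\<^sup>2)"
    using G.square_integrable_integrable[OF moments(1)] moments(1) by (auto simp: square_integrable_def)
  have ER2: "(\<integral>z. (sqnorm ns z)\<^sup>2 \<partial>?G) = 4 * c\<^sup>2"
    unfolding c2 using moments(3) by (simp add: algebra_simps)
  have E1: "(\<integral>\<^sup>+z. ennreal ((sqnorm ns z / (2 * c))\<^sup>2) \<partial>?G) = 1"
  proof -
    have "(\<integral>z. (sqnorm ns z / (2 * c))\<^sup>2 \<partial>?G) = 1"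
    proof -
      have "(\<integral>z. (sqnorm ns z / (2 * c))\<^sup>2 \<partial>?G) = (\<integral>z. (sqnorm ns z)\<^sup>2 \<partial>?G) / (4 * c\<^sup>2)"
        by (simp add: power_divide power_mult_distrib)
      then show ?thesis using c by (simp add: ER2)
    qed
    then show ?thesis using nn_integral_square[OF sq] by simp
  qed
  have EX: "(\<integral>\<^sup>+z. ennreal ((X z j)\<^sup>2) \<partial>sphere_measure ns) = 1" if j: "j < d" for j
  proof -
    have "(\<integral>\<^sup>+z. ennreal ((X z j)\<^sup>2) \<partial>sphere_measure ns) * 1
      = (\<integral>\<^sup>+z. ennreal ((X (direction ns z) j)\<^sup>2) * ennreal ((sqnorm ns z / (2 * c))\<^sup>2) \<partial>?G)"
      unfolding E1[symmetric] by (rule direction_radius_independent[OF Xm[OF j], symmetric]) simp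
    also have "\<dots> = (\<integral>\<^sup>+z. ennreal ((Q j z)\<^sup>2) \<partial>?G)"
      by (simp only: QX[OF j] power_mult_distrib ennreal_mult zero_le_power2)
    also have "\<dots> = ennreal (\<integral>z. (Q j z)\<^sup>2 \<partial>?G)"
      using square_quadratic[OF j] by (intro nn_integral_square) (simp add: Q_def[abs_def])
    also have "\<dots> = 1" using variance_quadratic[OF j] by (simp add: Q_def)
    finally show ?thesis by simp
  qed
  have E2: "(\<integral>\<^sup>+z. ennreal ((1 - sqnorm ns z / (2 * c))\<^sup>2) \<partial>?G) \<le> ennreal (2 / ns)"
  proof -
    have "(\<integral>z. (1 - sqnorm ns z / (2 * c))\<^sup>2 \<partial>?G) = (\<integral>z. 1 - sqnorm ns z / c + (sqnorm ns z)\<^sup>2 / (4 * c\<^sup>2) \<partial>?G)"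
      by (intro Bochner_Integration.integral_cong refl) (simp add: power2_eq_square algebra_simps)
    also have "\<dots> = 1 - 2 * real ns / c + 1"
      using int moments(2) ER2 G.prob_space c by simp
    also have "\<dots> \<le> 2 / real ns"
    proof -
      have bound: "1 - 2 * t / c + 1 \<le> 2 / t" if t: "0 < t" and ct: "c\<^sup>2 = t * (t + 1)" for t
      proof -
        have "c\<^sup>2 \<le> (t + 1)\<^sup>2" unfolding ct power2_eq_square[of "t + 1"] using t by (intro mult_right_mono) auto
        then have "c \<le> t + 1" by (rule power2_le_imp_le) (use t in simp)
        then have "2 * t / (t + 1) \<le> 2 * t / c" using c t by (intro divide_left_mono) auto
        moreover have "2 - 2 * t / (t + 1) = 2 / (t + 1)" using t by (simp add: field_simps)
        moreover have "2 / (t + 1) \<le> 2 / t" using t by (intro divide_left_mono) auto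
        ultimately show ?thesis by linarith
      qed
      show ?thesis by (rule bound[OF _ c2]) (use ns in simp)
    qed
    finally have "(\<integral>z. (1 - sqnorm ns z / (2 * c))\<^sup>2 \<partial>?G) \<le> 2 / ns" .
    moreover have "square_integrable ?G (\<lambda>z. 1 - sqnorm ns z / (2 * c))"
      by (intro square_integrable_diff sq G.square_integrable_const)
    ultimately show ?thesis by (simp add: nn_integral_square ennreal_leI)
  qed
  have "(\<integral>\<^sup>+z. ennreal (\<Sum>j<d. (X (direction ns z) j - Q j z)\<^sup>2) \<partial>?G)
    = (\<integral>\<^sup>+z. (\<Sum>j<d. ennreal ((X (direction ns z) j)\<^sup>2) * ennreal ((1 - sqnorm ns z / (2 * c))\<^sup>2)) \<partial>?G)"
  proof (rule nn_integral_cong)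
    fix z
    have "(\<Sum>j<d. (X (direction ns z) j - Q j z)\<^sup>2)
      = (\<Sum>j<d. (X (direction ns z) j)\<^sup>2 * (1 - sqnorm ns z / (2 * c))\<^sup>2)"
    proof (rule sum.cong[OF refl])
      fix j assume "j \<in> {..<d}"
      then have "X (direction ns z) j - Q j z = X (direction ns z) j * (1 - sqnorm ns z / (2 * c))"
        using QX[of j z] by (simp add: algebra_simps)
      then show "(X (direction ns z) j - Q j z)\<^sup>2 = (X (direction ns z) j)\<^sup>2 * (1 - sqnorm ns z / (2 * c))\<^sup>2"
        by (simp only: power_mult_distrib)
    qed
    then show "ennreal (\<Sum>j<d. (X (direction ns z) j - Q j z)\<^sup>2)
      = (\<Sum>j<d. ennreal ((X (direction ns z) j)\<^sup>2) * ennreal ((1 - sqnorm ns z / (2 * c))\<^sup>2))"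
      by (simp flip: sum_ennreal ennreal_mult)
  qed
  also have "\<dots> = (\<Sum>j<d. \<integral>\<^sup>+z. ennreal ((X (direction ns z) j)\<^sup>2) * ennreal ((1 - sqnorm ns z / (2 * c))\<^sup>2) \<partial>?G)"
  proof (rule nn_integral_sum)
    fix j assume "j \<in> {..<d}"
    then have [measurable]: "(\<lambda>z. ennreal ((X (direction ns z) j)\<^sup>2)) \<in> borel_measurable (PiM {..<ns} (\<lambda>_. borel))"
      using measurable_compose[OF direction_measurable Xm] by simp
    show "(\<lambda>z. ennreal ((X (direction ns z) j)\<^sup>2) * ennreal ((1 - sqnorm ns z / (2 * c))\<^sup>2)) \<in> borel_measurable ?G"
      by measurable
  qed
  also have "\<dots> = (\<Sum>j<d. (\<integral>\<^sup>+z. ennreal ((X z j)\<^sup>2) \<partial>sphere_measure ns) * (\<integral>\<^sup>+z. ennreal ((1 - sqnorm ns z / (2 * c))\<^sup>2) \<partial>?G))"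
    by (intro sum.cong refl direction_radius_independent Xm) auto
  also have "\<dots> = of_nat d * (\<integral>\<^sup>+z. ennreal ((1 - sqnorm ns z / (2 * c))\<^sup>2) \<partial>?G)"
    by (simp add: EX)
  also have "\<dots> \<le> of_nat d * ennreal (2 / ns)"
    by (intro mult_left_mono E2) auto
  also have "\<dots> = ennreal (2 * real d / real ns)"
    by (simp add: ennreal_of_nat_eq_real_of_nat ennreal_mult[symmetric] mult.commute)
  finally show ?thesis .
qed

lemma std_gaussian_eq: "std_gaussian d = (gauss_vec {..<d} :: (nat \<Rightarrow> real) measure)"
  by (simp add: std_gaussian_def gauss_vec_def gauss_real)

text \<open>
  A nearly optimal joint law of a Gaussian vector and y is pushed forward under x \<mapsto> X(x / |x|) in the
  first component. The cost is split at Q(x).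
\<close>

lemma wasserstein_bound:
  assumes ns: "0 < ns"
  shows "wasserstein1 d (distr (sphere_measure ns) (borel_vec d) X) (std_gaussian d)
    \<le> ennreal (sqrt (2 * real d / real ns) + (\<Sum>j<d. (schatten_norm 4 (B j))\<^sup>2) / sqrt s)"
proof (rule ennreal_le_epsilon)
  fix e :: real assume e: "0 < e"
  define S where "S = (\<Sum>j<d. (schatten_norm 4 (B j))\<^sup>2) / sqrt s"
  have S: "0 \<le> S" unfolding S_def by (intro divide_nonneg_nonneg sum_nonneg) auto
  obtain \<pi> where \<pi>: "\<pi> \<in> gauss_couplings"
    and cost: "(\<integral>\<^sup>+p. ennreal (cost p) \<partial>\<pi>) \<le> ennreal (stein_discrepancy + e\<^sup>2)"
    using near_optimal_coupling[of "e\<^sup>2"] e by auto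
  interpret P: prob_space \<pi> by (rule joint_law_prob_space[OF \<pi> prob_space_gauss_vec])
  let ?B = "PiM {..<ns} (\<lambda>_. borel) :: (nat \<Rightarrow> complex) measure" and ?R = "borel_vec d"
  let ?Y = "gauss_vec {..<d} :: (nat \<Rightarrow> real) measure"
  have sets_\<pi> [measurable_cong]: "sets \<pi> = sets (?B \<Otimes>\<^sub>M ?R)"
    using \<pi> by (simp add: joint_laws_def cong: sets_pair_measure_cong)
  define \<phi> where "\<phi> p = (X (direction ns (fst p)), snd p)" for p :: "(nat \<Rightarrow> complex) \<times> (nat \<Rightarrow> real)"
  have \<phi> [measurable]: "\<phi> \<in> \<pi> \<rightarrow>\<^sub>M ?R \<Otimes>\<^sub>M ?R" unfolding \<phi>_def[abs_def] by measurable
  define \<mu> where "\<mu> = distr (sphere_measure ns) ?R X"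
  define \<gamma> where "\<gamma> = distr \<pi> (?R \<Otimes>\<^sub>M ?R) \<phi>"
  have sets_\<mu>: "sets \<mu> = sets ?R" by (simp add: \<mu>_def)
  have \<gamma>_in: "\<gamma> \<in> couplings \<mu> ?Y"
  proof -
    have "sets \<gamma> = sets (\<mu> \<Otimes>\<^sub>M ?Y)"
      unfolding \<gamma>_def sets_distr by (intro sets_pair_measure_cong) (simp_all add: sets_\<mu>)
    moreover have "distr \<gamma> \<mu> fst = \<mu>"
    proof -
      have "distr \<gamma> \<mu> fst = distr \<gamma> ?R fst" by (rule distr_cong) (simp_all add: sets_\<mu>)
      also have "\<dots> = distr \<pi> ?R (\<lambda>p. X (direction ns (fst p)))"
        unfolding \<gamma>_def by (subst distr_distr) (simp_all add: comp_def \<phi>_def)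
      also have "\<dots> = distr (distr \<pi> (gaussC ns) fst) ?R (\<lambda>z. X (direction ns z))"
        by (subst distr_distr) (simp_all add: comp_def)
      also have "distr \<pi> (gaussC ns) fst = gaussC ns" using \<pi> by (simp add: joint_laws_def)
      also have "distr (gaussC ns) ?R (\<lambda>z. X (direction ns z)) = \<mu>"
        unfolding \<mu>_def sphere_measure_eq_distr by (subst distr_distr) (simp_all add: comp_def)
      finally show ?thesis .
    qed
    moreover have "distr \<gamma> ?Y snd = ?Y"
    proof -
      have "distr \<gamma> ?Y snd = distr \<gamma> ?R snd" by (rule distr_cong) simp_all
      also have "\<dots> = distr \<pi> ?R snd"
        unfolding \<gamma>_def by (subst distr_distr) (simp_all add: comp_def \<phi>_def)
      also have "\<dots> = distr \<pi> ?Y snd" by (rule distr_cong) simp_all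
      also have "\<dots> = ?Y" using \<pi> by (simp add: joint_laws_def)
      finally show ?thesis .
    qed
    ultimately show ?thesis by (simp add: couplings_def)
  qed
  define f1 where "f1 z = L2_set (\<lambda>j. X (direction ns z) j - Q j z) {..<d}" for z
  define f2 where "f2 p = L2_set (\<lambda>j. Q j (fst p) - snd p j) {..<d}" for p
  have Q_meas: "(\<lambda>w. Q j (g w)) \<in> borel_measurable M" if "j \<in> {..<d}" "g \<in> M \<rightarrow>\<^sub>M ?B" for j g and M :: "'z measure"
    using that by (intro Q_measurable) auto
  have X_meas: "(\<lambda>z. X (direction ns z) j) \<in> borel_measurable ?B" if "j \<in> {..<d}" for j
    using measurable_compose[OF measurable_compose[OF direction_measurable X_measurable] measurable_component_singleton[OF that]] .
  have f1_meas [measurable]: "f1 \<in> borel_measurable ?B"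
    unfolding f1_def[abs_def] L2_set_def
    by (intro borel_measurable_sqrt[THEN measurable_compose_rev] borel_measurable_sum borel_measurable_power
        borel_measurable_diff X_meas Q_meas measurable_ident_sets refl)
  have f2_meas [measurable]: "f2 \<in> borel_measurable (?B \<Otimes>\<^sub>M ?R)"
    unfolding f2_def[abs_def] L2_set_def
    by (intro borel_measurable_sqrt[THEN measurable_compose_rev] borel_measurable_sum borel_measurable_power
        borel_measurable_diff Q_meas) measurable
  have "wasserstein1 d \<mu> ?Y \<le> (\<integral>\<^sup>+p. ennreal (L2_set (\<lambda>i. fst p i - snd p i) {..<d}) \<partial>\<gamma>)"
    unfolding wasserstein1_def by (rule INF_lower[OF \<gamma>_in])
  also have "\<dots> = (\<integral>\<^sup>+p. ennreal (L2_set (\<lambda>j. X (direction ns (fst p)) j - snd p j) {..<d}) \<partial>\<pi>)"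
    unfolding \<gamma>_def L2_set_def by (subst nn_integral_distr) (simp_all add: \<phi>_def)
  also have "\<dots> \<le> (\<integral>\<^sup>+p. ennreal (f1 (fst p)) + ennreal (f2 p) \<partial>\<pi>)"
  proof (rule nn_integral_mono)
    fix p
    have "L2_set (\<lambda>j. X (direction ns (fst p)) j - snd p j) {..<d} \<le> f1 (fst p) + f2 p"
      using L2_set_triangle_ineq[of "\<lambda>j. X (direction ns (fst p)) j - Q j (fst p)" "\<lambda>j. Q j (fst p) - snd p j" "{..<d}"]
      by (simp add: f1_def f2_def)
    then show "ennreal (L2_set (\<lambda>j. X (direction ns (fst p)) j - snd p j) {..<d}) \<le> ennreal (f1 (fst p)) + ennreal (f2 p)"
      by (subst ennreal_plus[symmetric]) (auto simp: f1_def f2_def intro: ennreal_leI simp del: ennreal_plus)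
  qed
  also have "\<dots> = (\<integral>\<^sup>+p. ennreal (f1 (fst p)) \<partial>\<pi>) + (\<integral>\<^sup>+p. ennreal (f2 p) \<partial>\<pi>)"
    by (rule nn_integral_add) measurable
  also have "(\<integral>\<^sup>+p. ennreal (f1 (fst p)) \<partial>\<pi>) \<le> ennreal (sqrt (2 * real d / real ns))"
  proof (rule P.nn_integral_le_sqrt)
    have "(\<integral>\<^sup>+p. ennreal ((f1 (fst p))\<^sup>2) \<partial>\<pi>) = (\<integral>\<^sup>+z. ennreal ((f1 z)\<^sup>2) \<partial>gaussC ns)"
      by (rule joint_law_nn_integral(1)[OF \<pi>]) measurable
    also have "\<dots> \<le> ennreal (2 * real d / real ns)"
      using X_direction_dist[OF ns] by (simp add: f1_def L2_set_def sum_nonneg)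
    finally show "(\<integral>\<^sup>+p. ennreal ((f1 (fst p))\<^sup>2) \<partial>\<pi>) \<le> ennreal (2 * real d / real ns)" .
    show "(\<lambda>p. f1 (fst p)) \<in> borel_measurable \<pi>" by measurable
  qed (auto simp: f1_def)
  also have "(\<integral>\<^sup>+p. ennreal (f2 p) \<partial>\<pi>) \<le> ennreal (sqrt (stein_discrepancy + e\<^sup>2))"
  proof (rule P.nn_integral_le_sqrt)
    show "(\<integral>\<^sup>+p. ennreal ((f2 p)\<^sup>2) \<partial>\<pi>) \<le> ennreal (stein_discrepancy + e\<^sup>2)"
      using cost by (simp add: f2_def L2_set_def cost_def sum_nonneg)
    show "f2 \<in> borel_measurable \<pi>" by measurable
  qed (use stein_discrepancy_nonneg in \<open>auto simp: f2_def\<close>)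
  also have "sqrt (stein_discrepancy + e\<^sup>2) \<le> S + e"
  proof (rule real_le_lsqrt)
    show "stein_discrepancy + e\<^sup>2 \<le> (S + e)\<^sup>2"
    proof -
      have "0 \<le> 2 * S * e" using S e by simp
      then show ?thesis
        using stein_discrepancy_schatten unfolding S_def[symmetric] power2_sum by linarith
    qed
  qed (use S e in simp)
  finally have "wasserstein1 d \<mu> ?Y \<le> ennreal (sqrt (2 * real d / real ns)) + ennreal (S + e)"
    by (simp add: add_left_mono ennreal_leI)
  also have "\<dots> = ennreal (sqrt (2 * real d / real ns) + S) + ennreal e"
    using S e by (simp add: add.assoc)
  finally show "wasserstein1 d (distr (sphere_measure ns) (borel_vec d) X) (std_gaussian d)
      \<le> ennreal (sqrt (2 * real d / real ns) + (\<Sum>j<d. (schatten_norm 4 (B j))\<^sup>2) / sqrt s) + ennreal e"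
    unfolding std_gaussian_eq \<mu>_def[symmetric] S_def .
qed

text \<open>
  Each |B_j|_4^2 is at least 1 / sqrt n, so their sum is at least d / sqrt n, while
  sqrt (2 d) \<le> 2 d.
\<close>

lemma radial_error_le:
  assumes n: "0 < n" and d: "0 < d"
  shows "sqrt (2 * real d / real ns) \<le> 2 * (\<Sum>j<d. (schatten_norm 4 (B j))\<^sup>2) / sqrt s"
proof -
  have one: "1 / sqrt n \<le> (schatten_norm 4 (B j))\<^sup>2" if j: "j < d" for j
    using schatten_norm_4_lower[OF B_carrier[OF j] B_hermitian[OF j]] B_orthonormal[OF j j] n by (simp add: divide_le_eq mult.commute)
  have "d * (1 / sqrt n) \<le> (\<Sum>j<d. (schatten_norm 4 (B j))\<^sup>2)"
    using sum_mono[of "{..<d}" "\<lambda>_. 1 / sqrt n"] one by simp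
  then have S: "2 * (d / sqrt n) / sqrt s \<le> 2 * (\<Sum>j<d. (schatten_norm 4 (B j))\<^sup>2) / sqrt s"
    by (intro divide_right_mono mult_left_mono) auto
  have "sqrt (2 * real d) \<le> 2 * real d"
  proof (rule real_le_lsqrt)
    have "real d * 1 \<le> real d * real d" using d by (intro mult_left_mono) auto
    then show "2 * real d \<le> (2 * real d)\<^sup>2" by (simp add: power2_eq_square)
  qed simp
  then have "sqrt (2 * real d) / sqrt ns \<le> 2 * real d / sqrt ns" by (rule divide_right_mono) simp
  also have "\<dots> = 2 * (d / sqrt n) / sqrt s" by (simp add: real_sqrt_mult)
  finally show ?thesis using S by (simp add: real_sqrt_divide)
qed

end

theorem theorem5:
  shows "\<exists>C::real. \<forall>n s d :: nat. n > 0 \<longrightarrow> s > 0 \<longrightarrow> d > 0 \<longrightarrow>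
    (\<forall>B :: nat \<Rightarrow> complex mat.
      (\<forall>j<d. B j \<in> carrier_mat n n \<and> hermitian_mat (B j) \<and> mtrace (B j) = 0) \<longrightarrow>
      (\<forall>j<d. \<forall>k<d. mtrace (B j * B k) = (if j = k then 1 else 0)) \<longrightarrow>
      wasserstein1 d
        (distr (sphere_measure (n * s)) (borel_vec d)
          (\<lambda>z. \<lambda>j\<in>{..<d}. sqrt (real n * (real n * real s + 1)) * density_coords n s d B z j))
        (std_gaussian d)
      \<le> ennreal (C / sqrt (real s) * (\<Sum>j<d. (schatten_norm 4 (B j))\<^sup>2)))"
proof (intro exI[of _ 3] allI impI)
  fix n s d :: nat and B :: "nat \<Rightarrow> complex mat"
  assume pos: "0 < n" "0 < s" "0 < d"
    and B: "\<forall>j<d. B j \<in> carrier_mat n n \<and> hermitian_mat (B j) \<and> mtrace (B j) = 0"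
    and on: "\<forall>j<d. \<forall>k<d. mtrace (B j * B k) = (if j = k then 1 else 0)"
  interpret hermitian_family n s d B
    by unfold_locales (use pos B on in auto)
  have "wasserstein1 d (distr (sphere_measure ns) (borel_vec d) X) (std_gaussian d)
      \<le> ennreal (sqrt (2 * real d / real ns) + (\<Sum>j<d. (schatten_norm 4 (B j))\<^sup>2) / sqrt s)"
    by (rule wasserstein_bound) (use pos in simp)
  also have "\<dots> \<le> ennreal (3 / sqrt s * (\<Sum>j<d. (schatten_norm 4 (B j))\<^sup>2))"
    using radial_error_le[OF pos(1,3)] by (intro ennreal_leI) simp
  finally show "wasserstein1 d
        (distr (sphere_measure (n * s)) (borel_vec d)
          (\<lambda>z. \<lambda>j\<in>{..<d}. sqrt (real n * (real n * real s + 1)) * density_coords n s d B z j))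
        (std_gaussian d)
      \<le> ennreal (3 / sqrt (real s) * (\<Sum>j<d. (schatten_norm 4 (B j))\<^sup>2))"
    by (simp add: X_def[abs_def])
qed

end
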